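(* Let $n\ge2$ and let ${\bf m}$ be a multisegment over ${\bf Z}/n{\bf Z}$ and $i\in{\bf Z}/n{\bf Z}$. For $k\in{\bf N}^*$ put $S_{k,i}=\sum_{\ell\ge k}(m_{(\ell;i-1]}-m_{(\ell;i]})$, and let $k_0\in{\bf N}^*$ be minimal such that $S_{k_0,i}=\min_{k\in{\bf N}^*}S_{k,i}$. Then $\tilde f_i\langle{\bf m}\rangle\equiv\langle{\bf m}^+_{k_0,i}\rangle \bmod v{\cal L}$, i.e. there is an arrow ${\bf m}\xrightarrow{i}{\bf m}^+_{k_0,i}$ in the crystal graph $\widehat B(\infty)$ of ${\cal H}$.
   Context: Segments over $I={\bf Z}/n{\bf Z}$: $(\ell;i]=[i-\ell+1,\dots,i]$; multisegments ${\bf m}=\sum m_{(\ell;i]}(\ell;i]$. ${\bf k}[\ell;i]$: indecomposable nilpotent representation of length $\ell$ with head at vertex $i$ of the cyclic quiver (vertices $I$, arrows $i\to i-1$); ${\bf k}[{\bf m}]=\bigoplus{\bf k}[\ell;i]^{\oplus m_{(\ell;i]}}$ with graded dimension ${\bf dim}\,{\bf m}$. $F^{\bf c}_{{\bf a},{\bf b}}(q)$ = number of subrepresentations of ${\bf F}_q[{\bf c}]$ isomorphic to ${\bf F}_q[{\bf b}]$ with quotient $\cong{\bf F}_q[{\bf a}]$ (polynomial in $q$). The twisted Hall algebra ${\cal H}$ is the ${\bf C}(v)$-algebra with basis $u_{\bf m}$ and product $u_{\bf a}\circ u_{\bf b}=v^{m({\bf dim}\,{\bf a},{\bf dim}\,{\bf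 b})}\sum_{\bf c}F^{\bf c}_{{\bf a},{\bf b}}(v^{-2})u_{\bf c}$, $m({\bf a},{\bf b})=\sum_ia_ib_{i-1}+\sum_ia_ib_i$. PBW basis $\langle{\bf m}\rangle=v^{\sum_id_i^2-\varepsilon({\bf m})}u_{\bf m}$ (${\bf d}={\bf dim}\,{\bf m}$, $\varepsilon({\bf m})=\dim{\rm End}\,{\bf k}[{\bf m}]$); ${\cal L}$ is the ${\bf Z}[v]$-span of the PBW basis. $f_i$ acts by left multiplication by $\langle(1;i]\rangle$; $e'_i$ is its adjoint for the symmetric form with the PBW basis orthogonal and $(\langle{\bf m}\rangle,\langle{\bf m}\rangle)=\prod_{i,\ell}v^{-\binom{m_{(\ell;i]}}{2}}(1-v^2)^{(\ell-1)m_{(\ell;i]}}/[m_{(\ell;i]}]!$, where $[a]=(v^a-v^{-a})/(v-v^{-1})$. Kashiwara operator: every $x\in{\cal H}$ is uniquely written $x=\sum_{k\ge0}f_i^{(k)}x_k$ with $e'_ix_k=0$, $f_i^{(k)}=f_i^k/[k]!$, and $\tilde f_ix:=\sum_kf_i^{(k+1)}x_k$. The crystal graph $\widehat B(\infty)$ has vertices the multisegments and an arrow ${\bf m}\xrightarrow{i}{\bf m}'$ iff $\tilde f_i\langle{\bf m}\rangle\equiv\langle{\bf m}'\rangle\bmod v{\cal L}$. Notation: ${\bf m}^+_{1,i}={\bf m}+(1;i]$; for $\ell>1$, ${\bf m}^+_{\ell,i}={\bf m}+(\ell;i]-(\ell-1;i-1]$ (here $m_{(k_0-1;i-1]}>0$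 automatically when $k_0>1$). *)

theory Defs
  imports "HOL-Computational_Algebra.Polynomial" "HOL-Computational_Algebra.Fraction_Field"
    "HOL-Library.Multiset" "HOL-Library.Function_Algebras" "HOL-Algebra.Ring"
begin

text \<open>A segment (l;i] over Z/nZ (l >= 1, 0 <= i < n) is encoded as the pair (l, i):
  its length l and its head i.  A multisegment is a finite multiset of segments;
  the multiplicity m_(l;i] is count m (l, i).\<close>

type_synonym seg = "nat \<times> nat"
type_synonym mseg = "seg multiset"

definition valid_mseg :: "nat \<Rightarrow> mseg \<Rightarrow> bool" where
  "valid_mseg n m \<longleftrightarrow> (\<forall>s \<in># m. 1 \<le> fst s \<and> snd s < n)"

definition predI :: "nat \<Rightarrow> nat \<Rightarrow> nat" where
  "predI n i = (i + n - 1) mod n"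

text \<open>Basis of k[m]: triples (s, r, j) with s a segment of m, r < m_s the copy number and
  0 <= j < length s; the basis vector (s,r,j) sits at vertex head(s) - j, and the nilpotent
  operator X (arrows i -> i-1) maps (s,r,j) to (s,r,j+1) (and (s,r,l-1) to 0).\<close>

type_synonym idx = "seg \<times> nat \<times> nat"

definition Idx :: "mseg \<Rightarrow> idx set" where
  "Idx m = {(s, r, j). s \<in># m \<and> r < count m s \<and> j < fst s}"

definition vertex :: "nat \<Rightarrow> idx \<Rightarrow> nat" where
  "vertex n x = (case x of (s, r, j) \<Rightarrow> nat ((int (snd s) - int j) mod int n))"

definition gdim :: "nat \<Rightarrow> mseg \<Rightarrow> nat \<Rightarrow> nat" where
  "gdim n m i = card {x \<in> Idx m. vertex n x = i}"

definition mform :: "nat \<Rightarrow> (nat \<Rightarrow> nat) \<Rightarrow> (nat \<Rightarrow> nat) \<Rightarrow> nat" where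
  "mform n a b = (\<Sum>i<n. a i * b (predI n i)) + (\<Sum>i<n. a i * b i)"

definition Vec :: "(nat, 'b) ring_scheme \<Rightarrow> mseg \<Rightarrow> (idx \<Rightarrow> nat) set" where
  "Vec R m = {f. \<forall>x. (x \<in> Idx m \<longrightarrow> f x \<in> carrier R) \<and> (x \<notin> Idx m \<longrightarrow> f x = \<zero>\<^bsub>R\<^esub>)}"

definition vzero :: "(nat, 'b) ring_scheme \<Rightarrow> idx \<Rightarrow> nat" where
  "vzero R = (\<lambda>x. \<zero>\<^bsub>R\<^esub>)"

definition vadd :: "(nat, 'b) ring_scheme \<Rightarrow> (idx \<Rightarrow> nat) \<Rightarrow> (idx \<Rightarrow> nat) \<Rightarrow> idx \<Rightarrow> nat" where
  "vadd R f g = (\<lambda>x. f x \<oplus>\<^bsub>R\<^esub> g x)"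

definition vsmult :: "(nat, 'b) ring_scheme \<Rightarrow> nat \<Rightarrow> (idx \<Rightarrow> nat) \<Rightarrow> idx \<Rightarrow> nat" where
  "vsmult R c f = (\<lambda>x. c \<otimes>\<^bsub>R\<^esub> f x)"

definition Xop :: "(nat, 'b) ring_scheme \<Rightarrow> mseg \<Rightarrow> (idx \<Rightarrow> nat) \<Rightarrow> idx \<Rightarrow> nat" where
  "Xop R m f = (\<lambda>(s, r, j). if (s, r, j) \<in> Idx m \<and> 1 \<le> j then f (s, r, j - 1) else \<zero>\<^bsub>R\<^esub>)"

definition homog :: "(nat, 'b) ring_scheme \<Rightarrow> nat \<Rightarrow> nat \<Rightarrow> (idx \<Rightarrow> nat) \<Rightarrow> bool" where
  "homog R n t f \<longleftrightarrow> (\<forall>x. f x \<noteq> \<zero>\<^bsub>R\<^esub> \<longrightarrow> vertex n x = t)"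

definition morph :: "(nat, 'b) ring_scheme \<Rightarrow> nat \<Rightarrow> mseg \<Rightarrow> mseg
    \<Rightarrow> ((idx \<Rightarrow> nat) \<Rightarrow> (idx \<Rightarrow> nat)) \<Rightarrow> bool" where
  "morph R n b c \<phi> \<longleftrightarrow>
     (\<forall>f \<in> Vec R b. \<phi> f \<in> Vec R c) \<and>
     (\<forall>f \<in> Vec R b. \<forall>g \<in> Vec R b. \<phi> (vadd R f g) = vadd R (\<phi> f) (\<phi> g)) \<and>
     (\<forall>a \<in> carrier R. \<forall>f \<in> Vec R b. \<phi> (vsmult R a f) = vsmult R a (\<phi> f)) \<and>
     (\<forall>t. \<forall>f \<in> Vec R b. homog R n t f \<longrightarrow> homog R n t (\<phi> f)) \<and>
     (\<forall>f \<in> Vec R b. \<phi> (Xop R b f) = Xop R c (\<phi> f))"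

definition hall_count :: "(nat, 'b) ring_scheme \<Rightarrow> nat \<Rightarrow> mseg \<Rightarrow> mseg \<Rightarrow> mseg \<Rightarrow> nat" where
  "hall_count R n a b c = card {U. \<exists>\<phi> \<psi>.
      morph R n b c \<phi> \<and> inj_on \<phi> (Vec R b) \<and> \<phi> ` Vec R b = U \<and>
      morph R n c a \<psi> \<and> \<psi> ` Vec R c = Vec R a \<and> {f \<in> Vec R c. \<psi> f = vzero R} = U}"

text \<open>The Hall polynomial F^c_(a,b)(q): the polynomial whose value at q = |F| is the number
  above, for every finite field F (finite fields are taken up to isomorphism as
  HOL-Algebra fields with carrier a set of naturals).\<close>
definition hall_poly :: "nat \<Rightarrow> mseg \<Rightarrow> mseg \<Rightarrow> mseg \<Rightarrow> int poly" where
  "hall_poly n a b c = (THE P. \<forall>R :: nat ring. field R \<and> finite (carrier R) \<longrightarrow>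
       poly P (int (card (carrier R))) = int (hall_count R n a b c))"

text \<open>Endomorphisms of k[m] (over Q, the dimension does not depend on the field) as
  matrices indexed by Idx m: graded and commuting with the nilpotent operator.\<close>
definition Xmat :: "mseg \<Rightarrow> idx \<times> idx \<Rightarrow> rat" where
  "Xmat m = (\<lambda>(x, y). if x \<in> Idx m \<and> y \<in> Idx m \<and>
       (case y of (s, r, j) \<Rightarrow> x = (s, r, Suc j)) then 1 else 0)"

definition End_mats :: "nat \<Rightarrow> mseg \<Rightarrow> (idx \<times> idx \<Rightarrow> rat) set" where
  "End_mats n m = {M. (\<forall>x y. M (x, y) \<noteq> 0 \<longrightarrow> x \<in> Idx m \<and> y \<in> Idx m \<and> vertex n x = vertex n y) \<and>
      (\<forall>x y. (\<Sum>z \<in> Idx m. M (x, z) * Xmat m (z, y)) = (\<Sum>z \<in> Idx m. Xmat m (x, z) * M (z, y)))}"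

definition eps :: "nat \<Rightarrow> mseg \<Rightarrow> nat" where
  "eps n m = vector_space.dim (\<lambda>(c::rat) M. (\<lambda>p. c * M p)) (End_mats n m)"

type_synonym K = "complex poly fract"

definition vv :: K where "vv = Fract [:0, 1:] 1"

definition qint :: "int \<Rightarrow> K" where
  "qint a = (vv powi a - vv powi (- a)) / (vv - inverse vv)"

definition qfact :: "nat \<Rightarrow> K" where
  "qfact a = (\<Prod>j = 1..a. qint (int j))"

text \<open>Elements of H: finitely supported C(v)-valued functions on (valid) multisegments,
  i.e. linear combinations of the basis u_m.\<close>
type_synonym H = "mseg \<Rightarrow> K"

definition hall_elem :: "nat \<Rightarrow> H \<Rightarrow> bool" where
  "hall_elem n x \<longleftrightarrow> finite {m. x m \<noteq> 0} \<and> (\<forall>m. x m \<noteq> 0 \<longrightarrow> valid_mseg n m)"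

definition hscale :: "K \<Rightarrow> H \<Rightarrow> H" where
  "hscale c x = (\<lambda>m. c * x m)"

definition ubasis :: "mseg \<Rightarrow> H" where
  "ubasis m = (\<lambda>m'. if m' = m then 1 else 0)"

definition hall_struct :: "nat \<Rightarrow> mseg \<Rightarrow> mseg \<Rightarrow> mseg \<Rightarrow> K" where
  "hall_struct n a b c =
     (if valid_mseg n c then
        vv ^ mform n (gdim n a) (gdim n b) *
        poly (map_poly (\<lambda>z. of_int z) (hall_poly n a b c)) (inverse (vv ^ 2))
      else 0)"

definition hmult :: "nat \<Rightarrow> H \<Rightarrow> H \<Rightarrow> H" where
  "hmult n x y = (\<lambda>c. \<Sum>a \<in> {a. x a \<noteq> 0}. \<Sum>b \<in> {b. y b \<noteq> 0}. x a * y b * hall_struct n a b c)"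

definition pbw_exp :: "nat \<Rightarrow> mseg \<Rightarrow> int" where
  "pbw_exp n m = int (\<Sum>i<n. gdim n m i ^ 2) - int (eps n m)"

definition pbw :: "nat \<Rightarrow> mseg \<Rightarrow> H" where
  "pbw n m = hscale (vv powi pbw_exp n m) (ubasis m)"

definition pbw_coeff :: "nat \<Rightarrow> H \<Rightarrow> mseg \<Rightarrow> K" where
  "pbw_coeff n x m = x m * vv powi (- pbw_exp n m)"

definition pbw_norm :: "mseg \<Rightarrow> K" where
  "pbw_norm m = (\<Prod>s \<in> set_mset m.
      vv powi (- int (count m s choose 2)) * (1 - vv ^ 2) ^ ((fst s - 1) * count m s)
      / qfact (count m s))"

definition hform :: "nat \<Rightarrow> H \<Rightarrow> H \<Rightarrow> K" where
  "hform n x y = (\<Sum>m \<in> {m. x m \<noteq> 0 \<or> y m \<noteq> 0}. pbw_coeff n x m * pbw_coeff n y m * pbw_norm m)"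

definition f_op :: "nat \<Rightarrow> nat \<Rightarrow> H \<Rightarrow> H" where
  "f_op n i x = hmult n (pbw n {#(1, i)#}) x"

definition f_div :: "nat \<Rightarrow> nat \<Rightarrow> nat \<Rightarrow> H \<Rightarrow> H" where
  "f_div n i k x = hscale (inverse (qfact k)) ((f_op n i ^^ k) x)"

definition e'_op :: "nat \<Rightarrow> nat \<Rightarrow> H \<Rightarrow> H" where
  "e'_op n i x = (THE y. hall_elem n y \<and>
      (\<forall>z. hall_elem n z \<longrightarrow> hform n y z = hform n x (f_op n i z)))"

definition kf_op :: "nat \<Rightarrow> nat \<Rightarrow> H \<Rightarrow> H" where
  "kf_op n i x = (THE y. \<exists>xs N. (\<forall>k. hall_elem n (xs k) \<and> e'_op n i (xs k) = 0) \<and>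
      (\<forall>k > N. xs k = 0) \<and>
      x = (\<Sum>k \<le> N. f_div n i k (xs k)) \<and>
      y = (\<Sum>k \<le> N. f_div n i (Suc k) (xs k)))"

definition in_vL :: "nat \<Rightarrow> H \<Rightarrow> bool" where
  "in_vL n x \<longleftrightarrow> (\<exists>M c. finite M \<and> (\<forall>m \<in> M. valid_mseg n m) \<and>
      x = (\<Sum>m \<in> M. hscale (vv * poly (map_poly (\<lambda>z. of_int z) (c m)) vv) (pbw n m)))"

definition crystal_arrow :: "nat \<Rightarrow> nat \<Rightarrow> mseg \<Rightarrow> mseg \<Rightarrow> bool" where
  "crystal_arrow n i m m' \<longleftrightarrow> in_vL n (kf_op n i (pbw n m) - pbw n m')"

text \<open>S_(k,i) = sum_(l >= k) (m_(l;i-1] - m_(l;i]) (only lengths occurring in m contribute).\<close>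
definition S_sum :: "nat \<Rightarrow> mseg \<Rightarrow> nat \<Rightarrow> nat \<Rightarrow> int" where
  "S_sum n m i k = (\<Sum>l \<in> {l \<in> fst ` set_mset m. k \<le> l}.
      int (count m (l, predI n i)) - int (count m (l, i)))"

definition m_plus :: "nat \<Rightarrow> mseg \<Rightarrow> nat \<Rightarrow> nat \<Rightarrow> mseg" where
  "m_plus n m l i = (if l = 1 then m + {#(1, i)#}
                     else m + {#(l, i)#} - {#(l - 1, predI n i)#})"

end

theory Submission
  imports Defs "HOL-Computational_Algebra.Primes"
begin

text \<open>
  Put $x_l = m_{(l;i]}$, $y_l = m_{(l;i-1]}$ and $A_l = \sum_{k \ge l} y_k - \sum_{k > l} x_k$, so that
  $S_l = A_l - x_l$. Counting the submodules with simple quotient shows that $f_i$ sends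
  $\langle m \rangle$ to $\sum_l v^{A_l} [x_l + 1] \langle m^+_l \rangle$; with the dual formula for
  $e'_i$ this gives $e'_i f_i = v^{-2} f_i e'_i + 1$.

  At $v = 0$ the PBW basis is orthonormal, and a sum of squares of Laurent polynomials over the
  integers has no pole only if none of the summands has one. Applied to the norm of
  $\langle m \rangle = \sum_k f_i^{(k)} x_k$ this shows that all $x_k$ lie in the lattice and that
  exactly one of them, of index $K(m)$, is nonzero modulo $v$. Hence the Kashiwara operator induces, up
  to sign, an injection $F$ on multisegments, and $K(F(m)) = K(m) + 1$.

  Let $\varepsilon(m) = - \min_k S_k$. The norm of $e'_i \langle m \rangle$ yields $K \le \varepsilon$. The
  map $m \mapsto m^+_{k_0}$ raises $\varepsilon$ by one and reaches every multisegment with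
  $\varepsilon > 0$, so summing both functions over all multisegments of a given total length forces
  $K = \varepsilon$. Then the leading term of $f_i \langle m \rangle$, which has order
  $v^{-\varepsilon}$, shows that $F(m) = m^+_l$ with positive sign for some $l$ at which $S$ is minimal,
  and $\varepsilon(F(m)) = \varepsilon(m) + 1$ leaves only $l = k_0$.
\<close>

section \<open>Laurent polynomials over the integers and the local ring at $v = 0$\<close>

text \<open>The ground field is C(v), where sums of squares may cancel; positivity is available only
  for coefficients in Z[v, v^(-1)]. So the components x_k have to be integral, although f^((k)) has
  the denominator [k]!. This is why f_i is cut into its summands f_l, one for each l: they satisfy
  f_(l') f_l = v^2 f_l f_(l') for l < l', so the quantum binomial theorem writes the divided powers
  of f_i in those of the f_l, which involve only quantum binomial coefficients. The recursive
  construction of the x_k introduces no denominators either.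

  The relation between e'_i and f_i is a telescoping sum: the l-th diagonal term gives v^(2 A_l) -
  v^(2 A_(l-1)), and A_l = 0 for large l produces the summand 1.

  No x_k is ever computed. Their behaviour at v = 0 is read off from norms, because f^((k))
  multiplies norms on the kernel of e'_i by a factor of value 1 and different k are orthogonal. Such
  estimates bound K only from above, which is why a count has to supply the converse. Norms also
  leave a sign open; it is fixed because the leading coefficients of f_i are nonnegative.\<close>

definition ev :: "int poly \<Rightarrow> K" where
  "ev P = poly (map_poly (\<lambda>z. of_int z) P) vv"

lemma ev_0 [simp]: "ev 0 = 0"
  by (simp add: ev_def)

lemma ev_pCons [simp]: "ev (pCons a P) = of_int a + vv * ev P"
  by (simp add: ev_def map_poly_pCons)

lemma ev_1 [simp]: "ev 1 = 1"
  by (simp add: one_pCons)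

lemma ev_add [simp]: "ev (P + Q) = ev P + ev Q"
  by (induction P Q rule: poly_induct2) (simp_all add: algebra_simps)

lemma ev_smult [simp]: "ev (smult a P) = of_int a * ev P"
  by (induction P) (simp_all add: algebra_simps)

lemma ev_mult [simp]: "ev (P * Q) = ev P * ev Q"
  by (induction P) (simp_all add: algebra_simps)

lemma ev_minus [simp]: "ev (- P) = - ev P"
  using ev_add[of P "- P"] by (simp add: eq_neg_iff_add_eq_0 add.commute)

lemma of_int_K: "(of_int a :: K) = Fract [:of_int a:] 1"
proof -
  have nat: "(of_nat k :: K) = Fract [:of_nat k:] 1" for k
    by (induction k) (simp_all add: Zero_fract_def One_fract_def one_pCons)
  show ?thesis
    by (cases a) (simp_all add: nat del: of_nat_Suc)
qed

lemma ev_Fract: "ev P = Fract (map_poly of_int P) 1"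
  by (induction P)
    (simp_all add: Zero_fract_def of_int_K vv_def map_poly_pCons)

lemma ev_eq_0_iff [simp]: "ev P = 0 \<longleftrightarrow> P = 0"
  by (simp add: ev_Fract Zero_fract_def eq_fract poly_eq_iff coeff_map_poly)

lemma vv_neq_0 [simp]: "vv \<noteq> 0"
  by (simp add: vv_def Zero_fract_def eq_fract)

lemma vv_power_neq_1: "0 < k \<Longrightarrow> vv ^ k \<noteq> 1"
proof
  assume "0 < k" and e: "vv ^ k = 1"
  have "ev (monom 1 k) = vv ^ k"
    by (induction k) (simp_all add: monom_0 monom_Suc)
  then have "ev (monom 1 k - 1) = 0"
    using ev_add[of "monom 1 k" "- 1"] e by simp
  then have "coeff (monom 1 k - 1 :: int poly) k = 0"
    by (simp only: ev_eq_0_iff) simp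
  with \<open>0 < k\<close> show False by simp
qed

definition laurent :: "K \<Rightarrow> bool" where
  "laurent x \<longleftrightarrow> (\<exists>k P. x * vv ^ k = ev P)"

text \<open>\<open>val0 x r\<close>: the element \<open>x\<close> is a quotient of integral polynomials whose denominator
  has constant term 1, and \<open>r\<close> is its value at $v = 0$.\<close>

definition val0 :: "K \<Rightarrow> int \<Rightarrow> bool" where
  "val0 x r \<longleftrightarrow> (\<exists>P Q. coeff Q 0 = 1 \<and> x * ev Q = ev P \<and> coeff P 0 = r)"

lemma val0_ev: "val0 (ev P) (coeff P 0)"
  unfolding val0_def by (rule exI[of _ P], rule exI[of _ 1]) simp

lemma val0_0 [simp]: "val0 0 0"
  using val0_ev[of 0] by simp

lemma val0_1 [simp]: "val0 1 1"
  using val0_ev[of 1] by simp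

lemma val0_vv: "val0 vv 0"
  using val0_ev[of "[:0, 1:]"] by simp

lemma val0_add: assumes "val0 x r" "val0 y s" shows "val0 (x + y) (r + s)"
proof -
  from assms obtain P Q P' Q' where *: "coeff Q 0 = 1" "x * ev Q = ev P" "coeff P 0 = r"
    "coeff Q' 0 = 1" "y * ev Q' = ev P'" "coeff P' 0 = s" unfolding val0_def by blast
  have "(x + y) * ev (Q * Q') = (x * ev Q) * ev Q' + (y * ev Q') * ev Q"
    by (simp add: algebra_simps)
  also have "\<dots> = ev (P * Q' + P' * Q)" using * by simp
  finally show ?thesis unfolding val0_def using *
    by (intro exI[of _ "P * Q' + P' * Q"] exI[of _ "Q * Q'"]) (simp add: coeff_mult)
qed

lemma val0_mult: assumes "val0 x r" "val0 y s" shows "val0 (x * y) (r * s)"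
proof -
  from assms obtain P Q P' Q' where *: "coeff Q 0 = 1" "x * ev Q = ev P" "coeff P 0 = r"
    "coeff Q' 0 = 1" "y * ev Q' = ev P'" "coeff P' 0 = s" unfolding val0_def by blast
  have "(x * y) * ev (Q * Q') = (x * ev Q) * (y * ev Q')"
    by (simp add: algebra_simps)
  also have "\<dots> = ev (P * P')" using * by simp
  finally show ?thesis unfolding val0_def using *
    by (intro exI[of _ "P * P'"] exI[of _ "Q * Q'"]) (simp add: coeff_mult)
qed

lemma val0_minus: "val0 x r \<Longrightarrow> val0 (- x) (- r)"
  using val0_mult[OF val0_ev[of "-1"]] by force

lemma val0_diff: "val0 x r \<Longrightarrow> val0 y s \<Longrightarrow> val0 (x - y) (r - s)"
  using val0_add[OF _ val0_minus] by force

lemma val0_sum: "(\<And>i. i \<in> I \<Longrightarrow> val0 (x i) (r i)) \<Longrightarrow> val0 (sum x I) (sum r I)"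
  by (induction I rule: infinite_finite_induct) (simp_all add: val0_add)

lemma val0_power: "val0 x r \<Longrightarrow> val0 (x ^ k) (r ^ k)"
  by (induction k) (simp_all add: val0_mult)

lemma val0_prod_1: "(\<And>i. i \<in> I \<Longrightarrow> val0 (x i) 1) \<Longrightarrow> val0 (prod x I) 1"
  by (induction I rule: infinite_finite_induct) (simp_all add: val0_mult[of _ 1 _ 1, simplified])

lemma val0_inverse: assumes "val0 x 1" shows "val0 (inverse x) 1"
proof -
  from assms obtain P Q where *: "coeff Q 0 = 1" "x * ev Q = ev P" "coeff P 0 = 1"
    unfolding val0_def by blast
  have "P \<noteq> 0" using * by auto
  then have "x \<noteq> 0" using *(2) by auto
  then have "inverse x * ev P = ev Q" by (simp flip: *(2))
  with * show ?thesis unfolding val0_def by blast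
qed

lemma val0_unique: assumes "val0 x r" "val0 x s" shows "r = s"
proof -
  from assms obtain P Q P' Q' where *: "coeff Q 0 = 1" "x * ev Q = ev P" "coeff P 0 = r"
    "coeff Q' 0 = 1" "x * ev Q' = ev P'" "coeff P' 0 = s" unfolding val0_def by blast
  have "ev (P * Q' - P' * Q) = ev (P * Q') - ev (P' * Q)"
    using ev_add[of "P * Q'" "- (P' * Q)"] by simp
  also have "\<dots> = (x * ev Q) * ev Q' - (x * ev Q') * ev Q" using * by simp
  finally have "P * Q' = P' * Q" by (simp add: algebra_simps)
  then have "coeff (P * Q') 0 = coeff (P' * Q) 0" by simp
  with * show ?thesis by (simp add: coeff_mult)
qed

lemma laurent_ev: "laurent (ev P)"
  unfolding laurent_def by (rule exI[of _ 0]) auto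

lemma laurent_0 [simp]: "laurent 0" and laurent_1 [simp]: "laurent 1"
  using laurent_ev[of 0] laurent_ev[of 1] by simp_all

lemma ev_monom: "ev (monom 1 k) = vv ^ k"
  by (induction k) (simp_all add: monom_0 monom_Suc)

lemma laurent_shift: "x * vv ^ k = ev P \<Longrightarrow> x * vv ^ (k + j) = ev (P * monom 1 j)"
  by (simp add: power_add ev_monom mult.assoc[symmetric])

lemma laurent_add: assumes "laurent x" "laurent y" shows "laurent (x + y)"
proof -
  from assms obtain k P l Q where *: "x * vv ^ k = ev P" "y * vv ^ l = ev Q"
    unfolding laurent_def by blast
  have "(x + y) * vv ^ (k + l) = ev (P * monom 1 l + Q * monom 1 k)"
    using laurent_shift[OF *(1), of l] laurent_shift[OF *(2), of k]
    by (simp add: algebra_simps)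
  then show ?thesis unfolding laurent_def by blast
qed

lemma laurent_mult: assumes "laurent x" "laurent y" shows "laurent (x * y)"
proof -
  from assms obtain k P l Q where *: "x * vv ^ k = ev P" "y * vv ^ l = ev Q"
    unfolding laurent_def by blast
  have "x * y * vv ^ (k + l) = (x * vv ^ k) * (y * vv ^ l)"
    by (simp add: algebra_simps power_add)
  then have "x * y * vv ^ (k + l) = ev (P * Q)" using * by simp
  then show ?thesis unfolding laurent_def by blast
qed

lemma laurent_minus: "laurent x \<Longrightarrow> laurent (- x)"
  using laurent_mult[OF laurent_ev[of "- 1"]] by force

lemma laurent_diff: "laurent x \<Longrightarrow> laurent y \<Longrightarrow> laurent (x - y)"
  using laurent_add[OF _ laurent_minus] by force

lemma laurent_sum: "(\<And>i. i \<in> I \<Longrightarrow> laurent (x i)) \<Longrightarrow> laurent (sum x I)"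
  by (induction I rule: infinite_finite_induct) (simp_all add: laurent_add)

lemma laurent_power: "laurent (vv ^ k)"
  using laurent_ev[of "monom 1 k"] by (simp add: ev_monom)

lemma laurent_powi: "laurent (vv powi a)"
proof (cases "a \<ge> 0")
  case True
  then show ?thesis using laurent_power by (simp add: power_int_def)
next
  case False
  then have "vv powi a * vv ^ nat (- a) = ev 1"
    by (simp add: power_int_def power_inverse)
  then show ?thesis unfolding laurent_def by blast
qed

text \<open>Z[v, v^(-1)] meets the local ring in Z[v]: while a denominator v^(k+1) is present,
  regularity of \<open>x\<close> makes the constant coefficient of the numerator vanish, and one v
  cancels. Since \<open>in_vL\<close> asks for polynomial coefficients, values at v = 0 have to be
  turned back into polynomials.\<close>

lemma laurent_val0_ev:
  assumes "laurent x" "val0 x r"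
  obtains P where "x = ev P" "coeff P 0 = r"
proof -
  have "\<exists>P. x = ev P \<and> coeff P 0 = r" if "x * vv ^ k = ev P" for k P
    using that
  proof (induction k arbitrary: P)
    case 0
    then have "x = ev P" by simp
    then have "val0 x (coeff P 0)" using val0_ev by simp
    then show ?case using \<open>val0 x r\<close> val0_unique \<open>x = ev P\<close> by auto
  next
    case (Suc k)
    have "val0 (x * vv ^ Suc k) 0"
      using val0_mult[OF \<open>val0 x r\<close> val0_power[OF val0_vv, of "Suc k"]] by simp
    with Suc.prems have "coeff P 0 = 0" using val0_ev val0_unique by metis
    then obtain P' where "P = pCons 0 P'" by (cases P) auto
    then have "x * vv ^ k = ev P'" using Suc.prems by simp
    then show ?case by (rule Suc.IH)
  qed
  with \<open>laurent x\<close> that show ?thesis unfolding laurent_def by blast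
qed

text \<open>If the sum had a pole, the squares of the leading coefficients would add up to zero.\<close>

lemma regular_of_sum_squares:
  assumes "finite I" "\<And>i. i \<in> I \<Longrightarrow> val0 (a i) 1" "\<And>i. i \<in> I \<Longrightarrow> laurent (c i)"
    and "val0 (\<Sum>i\<in>I. a i * (c i)\<^sup>2) r" and "i \<in> I"
  shows "\<exists>s. val0 (c i) s"
proof -
  define good where "good k \<longleftrightarrow> (\<forall>i\<in>I. \<exists>P. c i * vv ^ k = ev P)" for k
  have "\<forall>i\<in>I. \<exists>k P. c i * vv ^ k = ev P" using assms(3) unfolding laurent_def by blast
  then obtain k where k: "\<forall>i\<in>I. \<exists>P. c i * vv ^ k i = ev P" by metis
  have "good (\<Sum>i\<in>I. k i)" unfolding good_def
  proof
    fix i assume "i \<in> I"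
    then have "k i \<le> (\<Sum>i\<in>I. k i)" using \<open>finite I\<close> by (intro member_le_sum) auto
    then obtain d where d: "(\<Sum>i\<in>I. k i) = k i + d" using le_Suc_ex by blast
    from k \<open>i \<in> I\<close> obtain P where "c i * vv ^ k i = ev P" by blast
    then show "\<exists>P. c i * vv ^ (\<Sum>i\<in>I. k i) = ev P" unfolding d by (blast intro: laurent_shift)
  qed
  moreover have "good k" if "good (Suc k)" for k
  proof -
    from that obtain P where P: "\<And>i. i \<in> I \<Longrightarrow> c i * vv ^ Suc k = ev (P i)"
      unfolding good_def by metis
    have "val0 (\<Sum>i\<in>I. a i * (ev (P i))\<^sup>2) (\<Sum>i\<in>I. 1 * (coeff (P i) 0)\<^sup>2)"
      by (intro val0_sum val0_mult val0_power val0_ev assms)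
    also have "(\<Sum>i\<in>I. a i * (ev (P i))\<^sup>2) = (\<Sum>i\<in>I. a i * (c i)\<^sup>2) * (vv ^ Suc k)\<^sup>2"
      unfolding sum_distrib_right by (intro sum.cong) (simp_all flip: P add: power_mult_distrib)
    finally have "val0 ((\<Sum>i\<in>I. a i * (c i)\<^sup>2) * (vv ^ Suc k)\<^sup>2) (\<Sum>i\<in>I. (coeff (P i) 0)\<^sup>2)"
      by simp
    moreover have "val0 ((\<Sum>i\<in>I. a i * (c i)\<^sup>2) * (vv ^ Suc k)\<^sup>2) (r * (0 ^ Suc k)\<^sup>2)"
      by (intro val0_mult val0_power val0_vv assms)
    ultimately have "(\<Sum>i\<in>I. (coeff (P i) 0)\<^sup>2) = r * (0 ^ Suc k)\<^sup>2"
      by (rule val0_unique)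
    then have z: "\<forall>i\<in>I. coeff (P i) 0 = 0"
      using \<open>finite I\<close> by (simp add: sum_nonneg_eq_0_iff)
    show "good k" unfolding good_def
    proof
      fix i assume "i \<in> I"
      obtain Q where "P i = pCons 0 Q" using z \<open>i \<in> I\<close> by (cases "P i") auto
      then have "vv * (c i * vv ^ k) = vv * ev Q" using P[OF \<open>i \<in> I\<close>] by (simp add: ac_simps)
      then show "\<exists>P. c i * vv ^ k = ev P" by auto
    qed
  qed
  ultimately have "good 0" by (rule_tac inc_induct[of 0 "\<Sum>i\<in>I. k i" good]) auto
  then obtain P where "c i = ev P" using \<open>i \<in> I\<close> unfolding good_def by auto
  then show ?thesis by (auto intro: val0_ev)
qed

section \<open>Quantum integers\<close>

lemma vv_diff_inverse_neq_0: "vv - inverse vv \<noteq> 0"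
  using vv_power_neq_1[of 2] by (simp add: field_simps power2_eq_square)

lemma qint_0 [simp]: "qint 0 = 0" and qint_1 [simp]: "qint 1 = 1"
  using vv_diff_inverse_neq_0 by (simp_all add: qint_def power_int_minus)

lemma qint_add: "qint (a + b) = vv powi (- b) * qint a + vv powi a * qint b"
proof -
  have "vv powi (- b) * (vv powi a - vv powi (- a)) + vv powi a * (vv powi b - vv powi (- b))
      = vv powi (a + b) - vv powi (- (a + b))"
    by (simp add: right_diff_distrib add.commute flip: power_int_add)
  then show ?thesis
    unfolding qint_def by (simp only: times_divide_eq_right flip: add_divide_distrib)
qed

lemma qint_Suc: "qint (int (Suc k)) = vv powi (- int k) + vv * qint (int k)"
  using qint_add[of 1 "int k"] by (simp add: add.commute)

text \<open>The product is 1 + v^2 + ... + v^(2k): the pole of [k+1] has order k and leading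
  coefficient 1.\<close>

lemma val0_qint: "val0 (vv powi (int k) * qint (int (Suc k))) 1"
proof (induction k)
  case (Suc k)
  have "vv powi int (Suc k) * qint (int (Suc (Suc k)))
      = 1 + vv\<^sup>2 * (vv powi int k * qint (int (Suc k)))"
    by (subst qint_Suc, simp add: ring_distribs power_int_minus)
      (simp add: power_int_add power_int_diff power_int_minus power2_eq_square field_simps)
  then show ?case
    using val0_add[OF val0_1 val0_mult[OF val0_power[OF val0_vv, of 2] Suc.IH]] by simp
qed simp

lemma qint_neq_0: "0 < k \<Longrightarrow> qint (int k) \<noteq> 0"
  using val0_qint[of "k - 1"] val0_unique[OF val0_0, of 1] by (cases k) auto

lemma qfact_0 [simp]: "qfact 0 = 1"
  by (simp add: qfact_def)

lemma qfact_Suc: "qfact (Suc k) = qint (int (Suc k)) * qfact k"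
  by (simp add: qfact_def)

lemma qfact_neq_0 [simp]: "qfact k \<noteq> 0"
  by (induction k) (simp_all add: qfact_Suc qint_neq_0 del: of_nat_Suc)

text \<open>The norm of $f^{(k)} x$ for $x$ in the kernel of $e'$ of norm 1.\<close>

definition gam :: "nat \<Rightarrow> K" where
  "gam k = vv powi (- int (k choose 2)) / qfact k"

lemma gam_0 [simp]: "gam 0 = 1"
  by (simp add: gam_def numeral_2_eq_2)

text \<open>The recursion dictated by adjointness: moving one f across the form turns [k+1] times
  the norm of f^((k+1)) x into v^(-k) times the norm of f^((k)) x.\<close>

lemma gam_Suc: "gam (Suc k) * qint (int (Suc k)) = vv powi (- int k) * gam k"
proof -
  have "int (Suc k choose 2) = int k + int (k choose 2)"
    by (simp add: numeral_2_eq_2)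
  then show ?thesis
    using qint_neq_0[of "Suc k"]
    by (simp add: gam_def qfact_Suc power_int_add power_int_diff power_int_minus field_simps
        del: of_nat_Suc)
qed

lemma val0_gam: "val0 (gam k) 1"
proof (induction k)
  case (Suc k)
  have "gam (Suc k) = inverse (vv powi int k * qint (int (Suc k))) * gam k"
    using gam_Suc[of k] qint_neq_0[of "Suc k"]
    by (simp add: power_int_minus field_simps del: of_nat_Suc)
  then show ?case using val0_mult[OF val0_inverse[OF val0_qint[of k]] Suc.IH] by simp
qed simp

lemma val0_pbw_norm: "val0 (pbw_norm m) 1"
proof -
  have "val0 (1 - vv\<^sup>2) (1 - 0\<^sup>2)" by (intro val0_diff val0_power val0_vv val0_1)
  from val0_power[OF this] have "val0 ((1 - vv\<^sup>2) ^ j) 1" for j by simp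
  from val0_mult[OF val0_gam this] show ?thesis
    unfolding pbw_norm_def by (intro val0_prod_1) (simp add: gam_def)
qed

text \<open>The quantum falling factorial [x][x-1]...[x-k+1]; divided by \<open>qfact k\<close> it
  is a quantum binomial coefficient.\<close>

definition qff :: "nat \<Rightarrow> nat \<Rightarrow> K" where
  "qff x k = (\<Prod>j<k. qint (int x - int j))"

lemma qff_0 [simp]: "qff x 0 = 1"
  by (simp add: qff_def)

lemma qff_Suc: "qff x (Suc k) = qff x k * qint (int x - int k)"
  by (simp add: qff_def)

lemma qff_Suc_Suc: "qff (Suc x) (Suc k) = qint (int (Suc x)) * qff x k"
  unfolding qff_def by (subst prod.lessThan_Suc_shift) (simp add: o_def)

lemma qff_eq_0: "x < k \<Longrightarrow> qff x k = 0"
  unfolding qff_def by (intro prod_zero bexI[of _ x]) auto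

text \<open>Induction by the quantum Pascal rule, which is \<open>qint_add\<close> for the splitting
  x + 1 = (x - j) + (j + 1).\<close>

lemma laurent_qbinom: "laurent (qff x k / qfact k)"
proof (induction x arbitrary: k)
  case 0
  then show ?case by (cases "k = 0") (simp_all add: qff_eq_0)
next
  case (Suc x)
  show ?case
  proof (cases k)
    case (Suc j)
    have "int (Suc x) = (int x - int j) + int (Suc j)" by simp
    then have "qint (int (Suc x)) = vv powi (- int (Suc j)) * qint (int x - int j)
        + vv powi (int x - int j) * qint (int (Suc j))"
      by (simp only: qint_add)
    then have "qff (Suc x) k / qfact k = vv powi (- int (Suc j)) * (qff x (Suc j) / qfact (Suc j))
        + vv powi (int x - int j) * (qff x j / qfact j)"
      using qint_neq_0[of "Suc j"]
      unfolding Suc qff_Suc_Suc by (simp add: qff_Suc qfact_Suc field_simps del: of_nat_Suc)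
    then show ?thesis
      by (simp only:) (intro laurent_add laurent_mult laurent_powi Suc.IH)
  qed simp
qed

section \<open>The operators $f_i$ and $e'_i$ in PBW coordinates\<close>

definition len :: "mseg \<Rightarrow> nat" where
  "len m = sum_mset (image_mset fst m)"

lemma len_simps [simp]: "len {#} = 0" "len (add_mset s m) = fst s + len m"
  by (simp_all add: len_def)

lemma len_ge: "s \<in># m \<Longrightarrow> fst s \<le> len m"
  by (metis insert_DiffM le_add1 len_simps(2))

text \<open>The form in PBW coordinates. Summing over the common support keeps the sum finite as
  soon as one of the two arguments has finite support.\<close>

definition ip :: "H \<Rightarrow> H \<Rightarrow> K" where
  "ip X Y = (\<Sum>m\<in>{m. X m \<noteq> 0 \<and> Y m \<noteq> 0}. X m * Y m * pbw_norm m)"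

lemma ip_eq_sum:
  "finite S \<Longrightarrow> {m. X m \<noteq> 0 \<and> Y m \<noteq> 0} \<subseteq> S \<Longrightarrow> ip X Y = (\<Sum>m\<in>S. X m * Y m * pbw_norm m)"
  unfolding ip_def by (rule sum.mono_neutral_left) auto

lemma ip_commute: "ip X Y = ip Y X"
  unfolding ip_def by (intro sum.cong) (auto simp: mult.commute)

lemma pbw_norm_add_mset:
  "pbw_norm (add_mset s m) * qint (int (Suc (count m s)))
    = pbw_norm m * vv powi (- int (count m s)) * (1 - vv\<^sup>2) ^ (fst s - 1)"
proof -
  define g where "g s k = gam k * (1 - vv\<^sup>2) ^ ((fst s - 1) * k)" for s :: seg and k
  \<comment> \<open>An absent segment contributes the factor 1, so the product may run over a set
    that contains \<open>s\<close> in any case.\<close>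
  have g: "pbw_norm m = (\<Prod>t\<in>insert s (set_mset m). g t (count m t))" for m
    unfolding pbw_norm_def g_def
    by (cases "s \<in># m") (simp_all add: gam_def insert_absorb not_in_iff numeral_2_eq_2)
  have "g s (Suc k) * qint (int (Suc k)) = g s k * vv powi (- int k) * (1 - vv\<^sup>2) ^ (fst s - 1)"
    for k
  proof -
    have "g s (Suc k) * qint (int (Suc k)) = gam (Suc k) * qint (int (Suc k))
        * ((1 - vv\<^sup>2) ^ ((fst s - 1) * k) * (1 - vv\<^sup>2) ^ (fst s - 1))"
      by (simp only: g_def mult_Suc_right power_add) (simp only: mult_ac)
    then show ?thesis
      unfolding gam_Suc g_def by (simp only: mult_ac)
  qed
  moreover have "(\<Prod>t\<in>set_mset m - {s}. g t (count (add_mset s m) t))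
      = (\<Prod>t\<in>set_mset m - {s}. g t (count m t))"
    by (intro prod.cong) auto
  ultimately show ?thesis
    unfolding g[of m] g[of "add_mset s m"]
    by (simp add: prod.insert_remove algebra_simps del: of_nat_Suc)
qed

text \<open>Here \<open>p\<close> plays the role of i - 1. The relations between f and e' use only
  that the two vertices differ; the cyclic order enters with the Hall numbers.\<close>

locale adjacent_vertices =
  fixes n i p :: nat
  assumes i: "i < n" and p: "p < n" and ip_neq: "i \<noteq> p"
begin

lemma ip_neq' [simp]: "i \<noteq> p" "p \<noteq> i" using ip_neq by auto

definition xx :: "mseg \<Rightarrow> nat \<Rightarrow> nat" where "xx c l = count c (l, i)"
definition yy :: "mseg \<Rightarrow> nat \<Rightarrow> nat" where "yy c l = count c (l, p)"

definition up :: "nat \<Rightarrow> mseg \<Rightarrow> mseg" where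
  "up l m = (if l = 1 then m + {#(1, i)#} else m + {#(l, i)#} - {#(l - 1, p)#})"

definition dn :: "nat \<Rightarrow> mseg \<Rightarrow> mseg" where
  "dn l c = (if l = 1 then c - {#(1, i)#} else c - {#(l, i)#} + {#(l - 1, p)#})"

definition AA :: "mseg \<Rightarrow> nat \<Rightarrow> int" where
  "AA c l = int (size {#s \<in># c. snd s = p \<and> l \<le> fst s#})
    - int (size {#s \<in># c. snd s = i \<and> l < fst s#})"

text \<open>Multiset difference is truncated, so \<open>up l m\<close> is the intended multisegment
  only under this condition. Where it fails, the coefficient \<open>bet\<close> vanishes.\<close>

definition can_up :: "nat \<Rightarrow> mseg \<Rightarrow> bool" where
  "can_up l m \<longleftrightarrow> l = 1 \<or> 0 < yy m (l - 1)"

lemma can_up_cases: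
  assumes "1 \<le> l" "can_up l m"
  obtains "l = 1" "up l m = add_mset (l, i) m"
  | m' where "1 < l" "m = add_mset (l - 1, p) m'" "up l m = add_mset (l, i) m'"
proof (cases "l = 1")
  case True
  then show ?thesis using that by (simp add: up_def)
next
  case False
  then have "1 < l" "(l - 1, p) \<in># m"
    using assms by (auto simp: can_up_def yy_def)
  then show ?thesis using that(2)[of "m - {#(l - 1, p)#}"] by (simp add: up_def)
qed

lemma can_dn_cases:
  assumes "1 \<le> l" "0 < xx c l"
  obtains c' where "l = 1" "c = add_mset (l, i) c'" "dn l c = c'"
  | c' where "1 < l" "c = add_mset (l, i) c'" "dn l c = add_mset (l - 1, p) c'"
proof -
  have "(l, i) \<in># c" using assms by (simp add: xx_def)
  then obtain c' where "c = add_mset (l, i) c'" by (metis mset_add)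
  then show ?thesis using that[of c'] assms by (cases "l = 1") (auto simp: dn_def)
qed

lemma dn_up: "1 \<le> l \<Longrightarrow> can_up l m \<Longrightarrow> dn l (up l m) = m"
  by (erule can_up_cases, assumption) (auto simp: dn_def)

lemma up_dn: "1 \<le> l \<Longrightarrow> 0 < xx c l \<Longrightarrow> up l (dn l c) = c"
  by (erule can_dn_cases, assumption) (auto simp: up_def)

lemma can_up_dn: "1 \<le> l \<Longrightarrow> 0 < xx c l \<Longrightarrow> can_up l (dn l c)"
  by (erule can_dn_cases, assumption) (auto simp: can_up_def yy_def)

lemma len_up: "1 \<le> l \<Longrightarrow> can_up l m \<Longrightarrow> len (up l m) = Suc (len m)"
  by (erule can_up_cases, assumption) auto

lemma len_dn: "1 \<le> l \<Longrightarrow> 0 < xx c l \<Longrightarrow> len c = Suc (len (dn l c))"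
  by (erule can_dn_cases, assumption) auto

lemma valid_up: "1 \<le> l \<Longrightarrow> can_up l m \<Longrightarrow> valid_mseg n (up l m) \<longleftrightarrow> valid_mseg n m"
proof -
  assume "1 \<le> l" "can_up l m"
  then show ?thesis using i p by (cases rule: can_up_cases) (auto simp: valid_mseg_def)
qed

lemma valid_dn: "1 \<le> l \<Longrightarrow> 0 < xx c l \<Longrightarrow> valid_mseg n (dn l c) \<longleftrightarrow> valid_mseg n c"
  using valid_up[of l "dn l c"] by (simp add: can_up_dn up_dn)

lemma xx_up: "1 \<le> l \<Longrightarrow> can_up l m \<Longrightarrow> xx (up l m) k = xx m k + of_bool (k = l)"
  by (erule can_up_cases, assumption) (auto simp: xx_def)

lemma xx_dn: "1 \<le> l \<Longrightarrow> 0 < xx c l \<Longrightarrow> xx (dn l c) k = xx c k - of_bool (k = l)"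
  by (erule can_dn_cases, assumption) (auto simp: xx_def)

lemma yy_dn: "1 \<le> l \<Longrightarrow> 0 < xx c l \<Longrightarrow> yy (dn l c) k = yy c k + of_bool (Suc k = l \<and> l \<noteq> 1)"
  by (erule can_dn_cases, assumption) (auto simp: yy_def)

text \<open>For k < l the gained (l;i] and the lost (l-1;i-1] each lower A_k by one. At k = l
  nothing changes, because A_l counts segments with head i only beyond length l.\<close>

lemma AA_up:
  "1 \<le> l \<Longrightarrow> can_up l m \<Longrightarrow> 1 \<le> k \<Longrightarrow> AA (up l m) k = AA m k - 2 * of_bool (k < l)"
  by (erule can_up_cases, assumption) (auto simp: AA_def)

lemma AA_dn:
  "1 \<le> l \<Longrightarrow> 0 < xx c l \<Longrightarrow> 1 \<le> k \<Longrightarrow> AA (dn l c) k = AA c k + 2 * of_bool (k < l)"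
  by (erule can_dn_cases, assumption) (auto simp: AA_def)

lemma size_filter_ge:
  "size {#s \<in># (m :: mseg). snd s = j \<and> l \<le> fst s#} = count m (l, j) + size {#s \<in># m. snd s = j \<and> l < fst s#}"
  by (induction m) (auto simp: le_less)

lemma AA_eq: "AA m l = AA m (Suc l) + int (yy m l) - int (xx m (Suc l))"
  unfolding AA_def yy_def xx_def using size_filter_ge[of p l m] size_filter_ge[of i "Suc l" m]
  by (simp add: Suc_le_eq)

lemma AA_large: "len m < l \<Longrightarrow> AA m l = 0"
proof -
  assume "len m < l"
  then have "{#s \<in># m. snd s = p \<and> l \<le> fst s#} = {#}" "{#s \<in># m. snd s = i \<and> l < fst s#} = {#}"
    by (auto dest: len_ge)
  note * = this
  show ?thesis unfolding AA_def * by simp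
qed

lemma xx_large: "len m < l \<Longrightarrow> xx m l = 0"
  unfolding xx_def using len_ge[of "(l, i)" m] by (force simp: not_in_iff[symmetric])

lemma yy_large: "len m < l \<Longrightarrow> yy m l = 0"
  unfolding yy_def using len_ge[of "(l, p)" m] by (force simp: not_in_iff[symmetric])

lemma up_dn_commute:
  assumes "1 \<le> l" "1 \<le> l'" "l \<noteq> l'" "can_up l m" "0 < xx m l'"
  shows "up l (dn l' m) = dn l' (up l m)"
proof -
  have "(l', i) \<in># m" "l = 1 \<or> (l - 1, p) \<in># m - {#(l', i)#}"
    using assms by (auto simp: can_up_def xx_def yy_def in_diff_count)
  then obtain c where c: "m = add_mset (l', i) c" "l = 1 \<or> (l - 1, p) \<in># c"
    by (metis add_mset_remove_trivial mset_add)
  then obtain c' where "l = 1 \<or> c = add_mset (l - 1, p) c'" by (metis mset_add)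
  with c assms show ?thesis unfolding up_def dn_def by (auto simp: add_mset_commute)
qed

lemma dn_dn_commute:
  assumes "1 \<le> l" "1 \<le> l'" "l \<noteq> l'" "0 < xx m l" "0 < xx m l'"
  shows "dn l (dn l' m) = dn l' (dn l m)"
proof -
  have "(l', i) \<in># m" "(l, i) \<in># m - {#(l', i)#}"
    using assms by (auto simp: xx_def in_diff_count)
  then obtain c where "m = add_mset (l', i) (add_mset (l, i) c)"
    by (metis insert_DiffM)
  with assms show ?thesis unfolding dn_def by (auto simp: add_mset_commute)
qed

text \<open>The share of (l-1;i-1] in the ratio of the norms of \<open>up l m\<close> and
  \<open>m\<close>: for y such segments it is [y] v^(y-1) (1 - v^2) = 1 - v^(2y).\<close>

definition bet :: "mseg \<Rightarrow> nat \<Rightarrow> K" where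
  "bet m l = (if l = 1 then 1 else 1 - vv ^ (2 * yy m (l - 1)))"

lemma bet_eq_0: "\<not> can_up l m \<Longrightarrow> bet m l = 0"
  by (simp add: bet_def can_up_def)

text \<open>The l-th summand of f, read at the target: \<open>c\<close> arises from
  \<open>dn l c\<close>, A_l is the same at both, and x_l is larger by one at \<open>c\<close>, so
  [x_l + 1] appears as [x_l]. If \<open>c\<close> contains no (l;i], the factor [0] = 0 hides the
  meaningless \<open>dn l c\<close>.\<close>

definition fl :: "nat \<Rightarrow> H \<Rightarrow> H" where
  "fl l X c = vv powi AA c l * qint (int (xx c l)) * X (dn l c)"

text \<open>The adjoint of \<open>fl l\<close>: the coefficient v^(A_l) [x_l + 1] times the ratio of
  norms from \<open>pbw_norm_up\<close>. The exponent that remains is S_l.\<close>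

definition el :: "nat \<Rightarrow> H \<Rightarrow> H" where
  "el l X m = vv powi (AA m l - int (xx m l)) * bet m l * X (up l m)"

definition ff :: "H \<Rightarrow> H" where
  "ff X c = (\<Sum>l = 1..len c. fl l X c)"

definition ee :: "H \<Rightarrow> H" where
  "ee X m = (\<Sum>l = 1..Suc (len m). el l X m)"

lemma fl_eq_0: "xx c l = 0 \<Longrightarrow> fl l X c = 0"
  by (simp add: fl_def)

lemma el_eq_0: "\<not> can_up l m \<Longrightarrow> el l X m = 0"
  by (simp add: el_def bet_eq_0)

lemma can_up_le: "can_up l m \<Longrightarrow> l \<le> Suc (len m)"
  using yy_large[of m "l - 1"] by (fastforce simp: can_up_def)

lemma ff_bound: "len c \<le> N \<Longrightarrow> ff X c = (\<Sum>l = 1..N. fl l X c)"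
  unfolding ff_def by (rule sum.mono_neutral_left) (auto intro!: fl_eq_0 xx_large)

lemma ee_bound: "Suc (len m) \<le> N \<Longrightarrow> ee X m = (\<Sum>l = 1..N. el l X m)"
  unfolding ee_def by (rule sum.mono_neutral_left) (auto intro!: el_eq_0 dest: can_up_le)

text \<open>Exactly one exponent moves: for l' < l the step \<open>up l\<close> lowers A at l' by 2,
  for l < l' the step \<open>dn l'\<close> raises A at l by 2. Either way the two orders differ by
  v^(-2).\<close>

lemma el_fl_commute:
  assumes "1 \<le> l" "1 \<le> l'" "l \<noteq> l'"
  shows "el l (fl l' X) m = vv powi (- 2) * fl l' (el l X) m"
proof (cases "can_up l m \<and> 0 < xx m l'")
  case True
  then have u: "can_up l m" and x: "0 < xx m l'" by auto
  have "yy (dn l' m) (l - 1) = yy m (l - 1) \<or> l = 1"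
    using assms by (auto simp: yy_dn[OF assms(2) x])
  then have "bet (dn l' m) l = bet m l"
    by (auto simp: bet_def)
  moreover have "vv powi (AA m l - int (xx m l)) * vv powi (AA (up l m) l')
    = vv powi (- 2) * (vv powi AA m l' * vv powi (AA (dn l' m) l - int (xx (dn l' m) l)))"
    using assms unfolding AA_up[OF assms(1) u assms(2)] AA_dn[OF assms(2) x assms(1)]
    by (simp add: xx_dn[OF assms(2) x] algebra_simps flip: power_int_add)
  ultimately show ?thesis
    using assms by (simp add: el_def fl_def up_dn_commute u x xx_up[OF assms(1) u])
next
  case False
  then consider "\<not> can_up l m" | "can_up l m" "xx m l' = 0" by blast
  then show ?thesis
  proof cases
    case 1
    have "fl l' (el l X) m = 0"
    proof (cases "xx m l' = 0")
      case False
      then have "\<not> can_up l (dn l' m)" using 1 assms by (auto simp: can_up_def yy_dn)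
      then show ?thesis by (simp add: fl_def el_eq_0)
    qed (rule fl_eq_0)
    then show ?thesis using 1 by (simp add: el_eq_0)
  next
    case 2
    then show ?thesis using assms by (simp add: el_def fl_def xx_up)
  qed
qed

text \<open>For equal indices the skew commutator is diagonal, but not a constant; it has the shape
  of a difference of consecutive terms, prepared for telescoping in \<open>ee_ff\<close>.\<close>

lemma el_fl_same:
  assumes "1 \<le> l"
  shows "el l (fl l X) m - vv powi (- 2) * fl l (el l X) m
    = (vv powi (2 * AA m l) - (if l = 1 then 0 else vv powi (2 * AA m (l - 1)))) * X m"
proof -
  define x where "x = int (xx m l)"
  define A where "A = AA m l"
  define b where "b = (if l = 1 then 0 else vv ^ (2 * yy m (l - 1)))"
  have e: "el l (fl l X) m = vv powi (A - x) * (1 - b) * (vv powi A * qint (x + 1)) * X m"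
  proof (cases "can_up l m")
    case True
    then have "int (xx (up l m) l) = x + 1" using assms by (simp add: xx_up x_def)
    with True show ?thesis
      using assms by (simp add: el_def fl_def dn_up AA_up A_def x_def bet_def b_def)
  next
    case False
    then have "bet m l = 0" by (rule bet_eq_0)
    then have "1 - b = 0" by (simp add: bet_def b_def split: if_splits)
    then show ?thesis using \<open>bet m l = 0\<close> by (simp add: el_def)
  qed
  \<comment> \<open>\<open>dn l m\<close> has one more segment (l-1;i-1] than \<open>m\<close>,
    whence the extra v^2 next to \<open>b\<close>.\<close>
  have f: "fl l (el l X) m = vv powi A * qint x * (vv powi (A - x + 1) * (1 - vv\<^sup>2 * b)) * X m"
  proof (cases "xx m l = 0")
    case False
    then have x: "0 < xx m l" by simp
    have "AA (dn l m) l - int (xx (dn l m) l) = A - x + 1"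
      using x assms by (simp add: xx_dn AA_dn x_def A_def of_nat_diff)
    moreover have "bet (dn l m) l = 1 - vv\<^sup>2 * b"
      using x assms by (simp add: bet_def b_def yy_dn power_add power2_eq_square)
    ultimately show ?thesis
      using assms x by (simp only: el_def fl_def up_dn A_def x_def mult_ac)
  qed (simp add: x_def fl_def)
  have q1: "qint (x + 1) = vv powi x + vv powi (- 1) * qint x"
    using qint_add[of x 1] by simp
  then have q2: "qint (x + 1) = vv powi (- x) + vv * qint x"
    using qint_add[of 1 x] by (simp add: add.commute)
  have "vv powi (A - x) * (1 - b) * (vv powi A * qint (x + 1))
      - vv powi (- 2) * (vv powi A * qint x * (vv powi (A - x + 1) * (1 - vv\<^sup>2 * b)))
    = vv powi A * vv powi (A - x) * ((1 - b) * qint (x + 1) - qint x * (inverse vv - vv * b))"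
    by (simp add: power_int_add power_int_diff power_int_minus field_simps power2_eq_square)
  also have "(1 - b) * qint (x + 1) - qint x * (inverse vv - vv * b)
      = vv powi x - b * vv powi (- x)"
  proof -
    have 1: "vv powi x = qint (x + 1) - inverse vv * qint x"
      using q1 by (simp add: power_int_minus)
    have 2: "vv powi (- x) = qint (x + 1) - vv * qint x"
      using q2 by simp
    show ?thesis unfolding 1 2 by (simp add: algebra_simps)
  qed
  also have "vv powi A * vv powi (A - x) * (vv powi x - b * vv powi (- x))
      = vv powi (2 * A) - vv powi (2 * A - 2 * x) * b"
  proof -
    have 1: "vv powi (2 * A) = vv powi A * vv powi (A - x) * vv powi x"
      and 2: "vv powi (2 * A - 2 * x) = vv powi A * vv powi (A - x) * vv powi (- x)"
      by (simp_all add: algebra_simps flip: power_int_add)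
    show ?thesis unfolding 1 2 by (simp only: right_diff_distrib mult_ac)
  qed
  \<comment> \<open>\<open>b\<close> shifts the exponent by 2 y_(l-1), and A_(l-1) = A_l + y_(l-1) -
    x_l.\<close>
  also have "vv powi (2 * A - 2 * x) * b = (if l = 1 then 0 else vv powi (2 * AA m (l - 1)))"
  proof (cases "l = 1")
    case False
    obtain k where "l = Suc k" using assms by (cases l) auto
    then have "2 * AA m (l - 1) = 2 * A - 2 * x + int (2 * yy m (l - 1))"
      using AA_eq[of m k] unfolding A_def x_def by simp
    then have "vv powi (2 * AA m (l - 1)) = vv powi (2 * A - 2 * x) * vv ^ (2 * yy m (l - 1))"
      by (simp only: power_int_add vv_neq_0 power_int_of_nat simp_thms)
    then show ?thesis unfolding b_def using False by simp
  qed (simp add: b_def)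
  finally have *: "vv powi (A - x) * (1 - b) * (vv powi A * qint (x + 1))
      - vv powi (- 2) * (vv powi A * qint x * (vv powi (A - x + 1) * (1 - vv\<^sup>2 * b)))
    = vv powi (2 * A) - (if l = 1 then 0 else vv powi (2 * AA m (l - 1)))" .
  have "y * z - c * (y' * z) = (y - c * y') * z" for y z c y' :: K
    by (simp add: algebra_simps)
  then show ?thesis
    unfolding e f A_def[symmetric] *[symmetric] .
qed

lemma ee_ff: "ee (ff X) m = vv powi (- 2) * ff (ee X) m + X m"
proof -
  \<comment> \<open>One bound that is large enough for the inner and outer sums of both
    products.\<close>
  define N where "N = Suc (Suc (len m))"
  have "el l (ff X) m = (\<Sum>l' = 1..N. el l (fl l' X) m)" if "l \<in> {1..N}" for l
  proof (cases "can_up l m")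
    case True
    then have "ff X (up l m) = (\<Sum>l' = 1..N. fl l' X (up l m))"
      using that by (intro ff_bound) (auto simp: len_up N_def)
    then show ?thesis by (simp add: el_def sum_distrib_left)
  qed (simp add: el_eq_0)
  then have e: "ee (ff X) m = (\<Sum>l = 1..N. \<Sum>l' = 1..N. el l (fl l' X) m)"
    by (simp add: ee_bound[of m N] N_def)
  have "fl l' (ee X) m = (\<Sum>l = 1..N. fl l' (el l X) m)" if "l' \<in> {1..N}" for l'
  proof (cases "xx m l' = 0")
    case False
    then have "ee X (dn l' m) = (\<Sum>l = 1..N. el l X (dn l' m))"
      using that len_dn[of l' m] by (intro ee_bound) (auto simp: N_def)
    then show ?thesis by (simp add: fl_def sum_distrib_left)
  qed (simp add: fl_eq_0)
  then have "ff (ee X) m = (\<Sum>l' = 1..N. \<Sum>l = 1..N. fl l' (el l X) m)"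
    by (simp add: ff_bound[of m N] N_def)
  then have f: "ff (ee X) m = (\<Sum>l = 1..N. \<Sum>l' = 1..N. fl l' (el l X) m)"
    by (simp only: sum.swap[of "\<lambda>l' l. fl l' (el l X) m"])
  \<comment> \<open>The value 0 at l = 0 encodes the missing subtracted term for l = 1.\<close>
  define h where "h l = (if l = 0 then 0 else vv powi (2 * AA m l))" for l
  have "ee (ff X) m - vv powi (- 2) * ff (ee X) m
      = (\<Sum>l = 1..N. \<Sum>l' = 1..N. el l (fl l' X) m - vv powi (- 2) * fl l' (el l X) m)"
    unfolding e f by (simp only: sum_distrib_left sum_subtractf)
  also have "\<dots> = (\<Sum>l = 1..N. \<Sum>l' = 1..N. if l' = l then (h l - h (l - 1)) * X m else 0)"
    using el_fl_same el_fl_commute by (intro sum.cong refl) (auto simp: h_def)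
  also have "\<dots> = (\<Sum>l = 1..N. (h l - h (l - 1)) * X m)"
    by (intro sum.cong refl) simp
  also have "\<dots> = (\<Sum>l = 1..N. h l - h (l - 1)) * X m"
    by (simp add: sum_distrib_right)
  also have "(\<Sum>l = 1..N. h l - h (l - 1)) = h N"
    using sum_telescope''[of 0 N h] by (simp add: h_def atLeastSucAtMost_greaterThanAtMost)
  also have "h N = 1"
    by (simp add: h_def N_def AA_large)
  finally show ?thesis by (simp add: algebra_simps)
qed

text \<open>\<open>pbw_norm_add_mset\<close> is applied twice, to the segment gained and to the
  segment lost. One factor 1 - v^2 survives and completes the quantum integer of the lost segment to
  \<open>bet\<close>.\<close>

lemma pbw_norm_up:
  assumes "1 \<le> l" "can_up l m"
  shows "pbw_norm (up l m) * qint (int (Suc (xx m l)))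
    = pbw_norm m * vv powi (- int (xx m l)) * bet m l"
  using assms
proof (cases rule: can_up_cases)
  case 1
  then show ?thesis
    using pbw_norm_add_mset[of "(l, i)" m] by (simp add: xx_def bet_def)
next
  case (2 m')
  define y where "y = count m' (l - 1, p)"
  define q where "q = (1 - vv\<^sup>2) ^ (l - 2)"
  have q: "(1 - vv\<^sup>2) ^ (l - 1) = (1 - vv\<^sup>2) * q"
    using \<open>1 < l\<close> by (simp add: q_def numeral_2_eq_2 Suc_diff_Suc flip: power_Suc)
  have "qint (int (Suc y)) * (vv powi int y * (1 - vv\<^sup>2)) = 1 - vv ^ (2 * Suc y)"
  proof -
    have "qint (int (Suc y)) = (vv ^ Suc y - inverse (vv ^ Suc y)) / (vv - inverse vv)"
      by (simp only: qint_def power_int_minus power_int_of_nat)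
    moreover have "(vv ^ Suc y - inverse (vv ^ Suc y)) / (vv - inverse vv) * (vv ^ y * (1 - vv\<^sup>2))
        = 1 - vv ^ Suc y * vv ^ Suc y"
      using vv_diff_inverse_neq_0 by (simp add: field_simps power2_eq_square)
    ultimately show ?thesis by (simp add: mult_2 flip: power_add)
  qed
  then have b: "bet m l = qint (int (Suc y)) * (vv powi int y * (1 - vv\<^sup>2))"
    using 2 by (simp add: bet_def yy_def y_def del: of_nat_Suc)
  have "pbw_norm m * qint (int (Suc y)) = pbw_norm m' * vv powi (- int y) * q"
    using pbw_norm_add_mset[of "(l - 1, p)" m'] 2 by (simp add: y_def q_def numeral_2_eq_2)
  then have *: "pbw_norm m' * q = pbw_norm m * qint (int (Suc y)) * vv powi int y"
    by (simp add: power_int_minus field_simps del: of_nat_Suc)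
  have "pbw_norm (up l m) * qint (int (Suc (xx m l)))
      = pbw_norm m' * vv powi (- int (xx m l)) * ((1 - vv\<^sup>2) * q)"
    using pbw_norm_add_mset[of "(l, i)" m'] 2 q by (simp add: xx_def)
  also have "\<dots> = (pbw_norm m' * q) * (vv powi (- int (xx m l)) * (1 - vv\<^sup>2))"
    by (simp only: mult_ac)
  finally show ?thesis unfolding b * by (simp only: mult_ac)
qed

text \<open>Both sides are sums over the same edges from \<open>m\<close> to \<open>up l m\<close>:
  \<open>P\<close> lists them by their targets, \<open>Q\<close> by their sources, and
  \<open>pbw_norm_up\<close> identifies the terms edge by edge.\<close>

lemma ff_adjoint:
  assumes X: "finite {m. X m \<noteq> 0}" and Y: "finite {m. Y m \<noteq> 0}"
  shows "ip (ff X) Y = ip X (ee Y)"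
proof -
  define P where "P = {(c, l). 1 \<le> l \<and> 0 < xx c l \<and> X (dn l c) \<noteq> 0 \<and> Y c \<noteq> 0}"
  define Q where "Q = {(m, l). 1 \<le> l \<and> can_up l m \<and> X m \<noteq> 0 \<and> Y (up l m) \<noteq> 0}"
  have "ip (ff X) Y = (\<Sum>c\<in>{c. Y c \<noteq> 0}. ff X c * Y c * pbw_norm c)"
    using Y by (intro ip_eq_sum) auto
  also have "\<dots> = (\<Sum>c\<in>{c. Y c \<noteq> 0}. \<Sum>l = 1..len c. fl l X c * Y c * pbw_norm c)"
    by (simp add: ff_def sum_distrib_right)
  also have "\<dots> = (\<Sum>(c, l)\<in>(SIGMA c:{c. Y c \<noteq> 0}. {1..len c}). fl l X c * Y c * pbw_norm c)"
    using Y by (subst sum.Sigma) auto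
  also have "\<dots> = (\<Sum>(c, l)\<in>P. fl l X c * Y c * pbw_norm c)"
  proof (rule sum.mono_neutral_right)
    show "P \<subseteq> (SIGMA c:{c. Y c \<noteq> 0}. {1..len c})"
    proof
      fix a assume "a \<in> P"
      then obtain c l where "a = (c, l)" "1 \<le> l" "0 < xx c l" "Y c \<noteq> 0" by (auto simp: P_def)
      moreover from this have "l \<le> len c" using xx_large[of c l] by (cases "len c < l") auto
      ultimately show "a \<in> (SIGMA c:{c. Y c \<noteq> 0}. {1..len c})" by simp
    qed
    show "\<forall>a\<in>(SIGMA c:{c. Y c \<noteq> 0}. {1..len c}) - P. (case a of (c, l) \<Rightarrow> fl l X c * Y c * pbw_norm c) = 0"
      by (clarsimp simp: P_def fl_def) (metis gr0I of_nat_0 qint_0)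
  qed (use Y in simp)
  also have "\<dots> = (\<Sum>(m, l)\<in>Q. X m * el l Y m * pbw_norm m)"
  proof (rule sum.reindex_bij_witness[of _ "\<lambda>(m, l). (up l m, l)" "\<lambda>(c, l). (dn l c, l)"])
    fix a assume "a \<in> P"
    then obtain c l where a: "a = (c, l)" "1 \<le> l" "0 < xx c l" by (auto simp: P_def)
    define m where "m = dn l c"
    have m: "can_up l m" "c = up l m" using a by (simp_all add: m_def can_up_dn up_dn)
    have N: "pbw_norm c * qint (int (xx c l)) = pbw_norm m * vv powi (- int (xx m l)) * bet m l"
      using pbw_norm_up[OF a(2) m(1)] m(2) a(2) by (simp add: xx_up[OF a(2) m(1)])
    have A: "AA c l = AA m l" using m a(2) by (simp add: AA_up)
    have "fl l X c * Y c * pbw_norm c = vv powi AA m l * X m * Y c * (pbw_norm c * qint (int (xx c l)))"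
      unfolding fl_def A m_def by (simp only: mult_ac)
    also have "\<dots> = X m * (vv powi AA m l * vv powi (- int (xx m l)) * bet m l * Y c) * pbw_norm m"
      unfolding N by (simp only: mult_ac)
    also have "\<dots> = X m * el l Y m * pbw_norm m"
      unfolding el_def m(2)[symmetric] by (simp flip: power_int_add)
    finally show "(case case a of (c, l) \<Rightarrow> (dn l c, l) of (m, l) \<Rightarrow> X m * el l Y m * pbw_norm m)
        = (case a of (c, l) \<Rightarrow> fl l X c * Y c * pbw_norm c)"
      by (simp only: a prod.case m_def)
  qed (auto simp: P_def Q_def up_dn dn_up can_up_dn xx_up)
  also have "\<dots> = (\<Sum>(m, l)\<in>(SIGMA m:{m. X m \<noteq> 0}. {1..Suc (len m)}). X m * el l Y m * pbw_norm m)"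
  proof (rule sum.mono_neutral_left)
    show "Q \<subseteq> (SIGMA m:{m. X m \<noteq> 0}. {1..Suc (len m)})"
      by (auto simp: Q_def dest: can_up_le)
    show "\<forall>a\<in>(SIGMA m:{m. X m \<noteq> 0}. {1..Suc (len m)}) - Q. (case a of (m, l) \<Rightarrow> X m * el l Y m * pbw_norm m) = 0"
      by (clarsimp simp: Q_def el_def) (metis bet_eq_0)
  qed (use X in simp)
  also have "\<dots> = (\<Sum>m\<in>{m. X m \<noteq> 0}. \<Sum>l = 1..Suc (len m). X m * el l Y m * pbw_norm m)"
    using X by (subst sum.Sigma) auto
  also have "\<dots> = (\<Sum>m\<in>{m. X m \<noteq> 0}. X m * ee Y m * pbw_norm m)"
    unfolding ee_def by (simp only: sum_distrib_left sum_distrib_right)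
  also have "\<dots> = ip X (ee Y)"
    using X by (intro ip_eq_sum[symmetric]) auto
  finally show ?thesis .
qed

end

section \<open>Divided powers and the decomposition into components of the kernel of $e'_i$\<close>

definition lin :: "(H \<Rightarrow> H) \<Rightarrow> bool" where
  "lin T \<longleftrightarrow> (\<forall>a b X Y. T (\<lambda>c. a * X c + b * Y c) = (\<lambda>c. a * T X c + b * T Y c))"

lemma lin_comb: "lin T \<Longrightarrow> T (\<lambda>c. a * X c + b * Y c) = (\<lambda>c. a * T X c + b * T Y c)"
  by (simp add: lin_def)

lemma lin_zero: "lin T \<Longrightarrow> T (\<lambda>c. 0) = (\<lambda>c. 0)"
  using lin_comb[of T 0 "\<lambda>c. 0" 0 "\<lambda>c. 0"] by simp

lemma lin_scale: "lin T \<Longrightarrow> T (\<lambda>c. a * X c) = (\<lambda>c. a * T X c)"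
  using lin_comb[of T a X 0 X] by simp

lemma lin_add: "lin T \<Longrightarrow> T (\<lambda>c. X c + Y c) = (\<lambda>c. T X c + T Y c)"
  using lin_comb[of T 1 X 1 Y] by simp

lemma lin_diff: "lin T \<Longrightarrow> T (\<lambda>c. X c - Y c) = (\<lambda>c. T X c - T Y c)"
  using lin_comb[of T 1 X "- 1" Y] by simp

lemma lin_sum: "lin T \<Longrightarrow> T (\<lambda>c. \<Sum>a\<in>I. Y a c) = (\<lambda>c. \<Sum>a\<in>I. T (Y a) c)"
proof (induction I rule: infinite_finite_induct)
  case (insert x I)
  then show ?case using lin_add[of T "Y x" "\<lambda>c. \<Sum>a\<in>I. Y a c"] by simp
qed (simp_all add: lin_zero)

lemma lin_sum_scale:
  assumes "lin T" shows "T (\<lambda>c. \<Sum>a\<in>I. r a * Y a c) = (\<lambda>c. \<Sum>a\<in>I. r a * T (Y a) c)"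
  by (simp only: lin_sum[OF assms] lin_scale[OF assms])

lemma lin_funpow: "lin T \<Longrightarrow> lin (T ^^ k)"
  by (induction k) (simp_all add: lin_def)

definition divided_power :: "(H \<Rightarrow> H) \<Rightarrow> nat \<Rightarrow> H \<Rightarrow> H" where
  "divided_power T k X = (\<lambda>c. inverse (qfact k) * (T ^^ k) X c)"

lemma lin_divided_power: "lin T \<Longrightarrow> lin (divided_power T k)"
  using lin_funpow[of T k] by (simp add: lin_def divided_power_def algebra_simps)

lemma divided_power_0 [simp]: "divided_power T 0 X = X"
  by (simp add: divided_power_def)

lemma lin_divided_power_Suc:
  assumes "lin T"
  shows "T (divided_power T k X) = (\<lambda>c. qint (int (Suc k)) * divided_power T (Suc k) X c)"
  using qint_neq_0[of "Suc k"] unfolding divided_power_def lin_scale[OF assms]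
  by (intro ext) (simp add: qfact_Suc field_simps del: of_nat_Suc)

lemma divided_power_skew_commute:
  assumes "lin A" "lin B" "\<And>X. B (A X) = (\<lambda>c. vv\<^sup>2 * A (B X) c)"
  shows "B (divided_power A k X) = (\<lambda>c. vv ^ (2 * k) * divided_power A k (B X) c)"
proof -
  have "B ((A ^^ k) X) = (\<lambda>c. vv ^ (2 * k) * (A ^^ k) (B X) c)"
  proof (induction k)
    case (Suc k)
    show ?case
      unfolding funpow.simps o_apply assms(3) Suc.IH lin_scale[OF assms(1)]
      by (simp add: power2_eq_square mult.assoc)
  qed simp
  then show ?thesis
    unfolding divided_power_def lin_scale[OF assms(2)] by (simp only: mult_ac)
qed

text \<open>The quantum binomial theorem. In divided powers the binomial coefficients disappear and
  only powers of v remain, so integrality passes from the two summands to their sum.\<close>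

lemma divided_power_quantum_binomial:
  assumes A: "lin A" and B: "lin B" and BA: "\<And>X. B (A X) = (\<lambda>c. vv\<^sup>2 * A (B X) c)"
    and T: "\<And>X. T X = (\<lambda>c. A X c + B X c)"
  shows "divided_power T k X = (\<lambda>c. \<Sum>a\<le>k. vv ^ (a * (k - a)) * divided_power A a (divided_power B (k - a) X) c)"
proof -
  have linT: "lin T"
    using A B by (simp add: lin_def T algebra_simps)
  have "(T ^^ k) X = (\<lambda>c. qfact k * (\<Sum>a\<le>k. vv ^ (a * (k - a)) * divided_power A a (divided_power B (k - a) X) c))"
  proof (induction k)
    case (Suc k)
    define D where "D a b = divided_power A a (divided_power B b X)" for a b
    have AD: "A (D a b) = (\<lambda>c. qint (int (Suc a)) * D (Suc a) b c)" for a b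
      by (simp only: D_def lin_divided_power_Suc[OF A])
    have BD: "B (D a b) = (\<lambda>c. vv ^ (2 * a) * (qint (int (Suc b)) * D a (Suc b) c))" for a b
      by (simp only: D_def divided_power_skew_commute[OF A B BA] lin_divided_power_Suc[OF B] lin_scale[OF lin_divided_power[OF A]])
    \<comment> \<open>The term with exponents a, b arises from a - 1, b through A and from a, b - 1
      through B. The truncated differences at 0 are harmless because [0] = 0.\<close>
    have coeff: "vv ^ ((a - 1) * b) * qint (int a) + vv ^ (a * (b - 1) + 2 * a) * qint (int b)
        = qint (int (a + b)) * vv ^ (a * b)" for a b
    proof -
      have "vv ^ ((a - 1) * b) * qint (int a) = vv ^ (a * b) * (vv powi (- int b) * qint (int a))"
        by (cases a) (simp_all add: power_add power_int_minus)
      moreover have "vv ^ (a * (b - 1) + 2 * a) * qint (int b)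
          = vv ^ (a * b) * (vv powi int a * qint (int b))"
        by (cases b) (simp_all add: power_add mult_2)
      ultimately show ?thesis
        using qint_add[of "int a" "int b"] by (simp only: of_nat_add ring_distribs mult_ac)
    qed
    have "T (\<lambda>c. \<Sum>a\<le>k. vv ^ (a * (k - a)) * D a (k - a) c) c
        = qint (int (Suc k)) * (\<Sum>a\<le>Suc k. vv ^ (a * (Suc k - a)) * D a (Suc k - a) c)" for c
    proof -
      have "T (\<lambda>c. \<Sum>a\<le>k. vv ^ (a * (k - a)) * D a (k - a) c) c
          = (\<Sum>a\<le>k. vv ^ (a * (k - a)) * (qint (int (Suc a)) * D (Suc a) (k - a) c))
          + (\<Sum>a\<le>k. vv ^ (a * (k - a)) * (vv ^ (2 * a) * (qint (int (Suc (k - a))) * D a (Suc (k - a)) c)))"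
        by (simp only: lin_sum_scale[OF linT] T AD BD distrib_left sum.distrib)
      also have "(\<Sum>a\<le>k. vv ^ (a * (k - a)) * (qint (int (Suc a)) * D (Suc a) (k - a) c))
          = (\<Sum>a\<le>Suc k. vv ^ ((a - 1) * (Suc k - a)) * qint (int a) * D a (Suc k - a) c)"
        by (subst sum.atMost_Suc_shift) (simp del: of_nat_Suc add: mult.assoc)
      also have "(\<Sum>a\<le>k. vv ^ (a * (k - a)) * (vv ^ (2 * a) * (qint (int (Suc (k - a))) * D a (Suc (k - a)) c)))
          = (\<Sum>a\<le>Suc k. vv ^ (a * (Suc k - a - 1) + 2 * a) * qint (int (Suc k - a)) * D a (Suc k - a) c)"
      proof -
        have "(\<Sum>a\<le>Suc k. vv ^ (a * (Suc k - a - 1) + 2 * a) * qint (int (Suc k - a)) * D a (Suc k - a) c)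
            = (\<Sum>a\<le>k. vv ^ (a * (Suc k - a - 1) + 2 * a) * qint (int (Suc k - a)) * D a (Suc k - a) c)"
          by simp
        also have "\<dots> = (\<Sum>a\<le>k. vv ^ (a * (k - a)) * (vv ^ (2 * a) * (qint (int (Suc (k - a))) * D a (Suc (k - a)) c)))"
        proof (intro sum.cong refl)
          fix a assume "a \<in> {..k}"
          then have "Suc k - a = Suc (k - a)" by (simp add: Suc_diff_le)
          then show "vv ^ (a * (Suc k - a - 1) + 2 * a) * qint (int (Suc k - a)) * D a (Suc k - a) c
              = vv ^ (a * (k - a)) * (vv ^ (2 * a) * (qint (int (Suc (k - a))) * D a (Suc (k - a)) c))"
            by (simp only: diff_Suc_1 power_add mult.assoc)
        qed
        finally show ?thesis by (rule sym)
      qed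
      also have "(\<Sum>a\<le>Suc k. vv ^ ((a - 1) * (Suc k - a)) * qint (int a) * D a (Suc k - a) c)
          + (\<Sum>a\<le>Suc k. vv ^ (a * (Suc k - a - 1) + 2 * a) * qint (int (Suc k - a)) * D a (Suc k - a) c)
          = (\<Sum>a\<le>Suc k. (qint (int (a + (Suc k - a))) * vv ^ (a * (Suc k - a))) * D a (Suc k - a) c)"
        unfolding sum.distrib[symmetric] coeff[symmetric] by (simp only: distrib_right)
      also have "\<dots> = qint (int (Suc k)) * (\<Sum>a\<le>Suc k. vv ^ (a * (Suc k - a)) * D a (Suc k - a) c)"
        unfolding sum_distrib_left by (intro sum.cong refl) (simp del: of_nat_Suc)
      finally show ?thesis .
    qed
    then have "T (\<lambda>c. \<Sum>a\<le>k. vv ^ (a * (k - a)) * D a (k - a) c)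
        = (\<lambda>c. qint (int (Suc k)) * (\<Sum>a\<le>Suc k. vv ^ (a * (Suc k - a)) * D a (Suc k - a) c))"
      by (rule ext)
    then show ?case
      unfolding funpow.simps o_apply Suc.IH qfact_Suc lin_scale[OF linT] D_def[symmetric]
      by (simp only: mult_ac)
  qed simp
  then show ?thesis unfolding divided_power_def[of T] by (intro ext) simp
qed

section \<open>Integrality of the divided powers, uniqueness and existence of the
  decomposition\<close>

context adjacent_vertices
begin

lemma lin_fl: "lin (fl l)"
  by (simp add: lin_def fl_def fun_eq_iff algebra_simps)

lemma lin_el: "lin (el l)"
  by (simp add: lin_def el_def fun_eq_iff algebra_simps)

lemma lin_ff: "lin ff"
  unfolding lin_def ff_def by (simp only: lin_comb[OF lin_fl] sum.distrib sum_distrib_left simp_thms)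

lemma lin_ee: "lin ee"
  unfolding lin_def ee_def by (simp only: lin_comb[OF lin_el] sum.distrib sum_distrib_left simp_thms)

text \<open>For l < l' the step \<open>dn l'\<close> raises A_l by 2, whereas \<open>dn l\<close>
  leaves A at l' unchanged.\<close>

lemma fl_fl_commute:
  assumes "1 \<le> l" "l < l'"
  shows "fl l' (fl l X) = (\<lambda>c. vv\<^sup>2 * fl l (fl l' X) c)"
proof
  fix c
  have l': "1 \<le> l'" "l \<noteq> l'" using assms by auto
  show "fl l' (fl l X) c = vv\<^sup>2 * fl l (fl l' X) c"
  proof (cases "0 < xx c l \<and> 0 < xx c l'")
    case True
    have "vv powi (AA c l + 2) = vv powi AA c l * vv\<^sup>2"
      by (simp add: power_int_add)
    then show ?thesis
      using True assms l' dn_dn_commute[of l l' c] by (simp add: fl_def xx_dn AA_dn)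
  next
    case False
    then show ?thesis using assms l' by (cases "xx c l' = 0"; cases "xx c l = 0") (auto simp: fl_def xx_dn)
  qed
qed

text \<open>Along the iterates of \<open>dn l\<close> the exponent A_l is constant and x_l drops by
  one each time, so the quantum integers multiply to a falling factorial.\<close>

lemma fl_funpow:
  "1 \<le> l \<Longrightarrow> (fl l ^^ k) X c = vv powi (int k * AA c l) * qff (xx c l) k * X ((dn l ^^ k) c)"
proof (induction k arbitrary: c)
  case (Suc k)
  show ?case
  proof (cases "xx c l")
    case 0
    then show ?thesis by (simp add: fl_def qff_eq_0)
  next
    case (Suc x)
    then have "xx (dn l c) l = x" "AA (dn l c) l = AA c l"
      using Suc.prems by (simp_all add: xx_dn AA_dn)
    then show ?thesis
      using Suc.IH[OF Suc.prems, of "dn l c"] Suc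
      by (simp add: fl_def qff_Suc_Suc funpow_swap1 ring_distribs power_int_add del: of_nat_Suc)
        (simp add: ring_distribs power_int_add)
  qed
qed simp

text \<open>Unlike in \<open>ff\<close>, the number of summands does not depend on the argument,
  which permits an induction that removes one summand at a time.\<close>

definition gl :: "nat \<Rightarrow> H \<Rightarrow> H" where
  "gl N X c = (\<Sum>l = 1..N. fl l X c)"

lemma lin_gl: "lin (gl N)"
  unfolding lin_def gl_def by (simp only: lin_comb[OF lin_fl] sum.distrib sum_distrib_left simp_thms)

text \<open>The last summand skew commutes with the sum of the others, so the quantum binomial
  theorem applies; the divided powers of a single summand have quantum binomial coefficients by
  \<open>fl_funpow\<close>.\<close>

lemma laurent_divided_power_gl: "(\<And>m. laurent (X m)) \<Longrightarrow> laurent (divided_power (gl N) k X m)"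
proof (induction N arbitrary: k X m)
  case 0
  have "(gl 0 ^^ k) X m = (if k = 0 then X m else 0)" by (cases k) (simp_all add: gl_def)
  with 0 show ?case by (simp add: divided_power_def)
next
  case (Suc N)
  have comm: "fl (Suc N) (gl N Y) = (\<lambda>c. vv\<^sup>2 * gl N (fl (Suc N) Y) c)" for Y
  proof -
    have "fl (Suc N) (gl N Y) = (\<lambda>c. \<Sum>l = 1..N. fl (Suc N) (fl l Y) c)"
      unfolding gl_def by (rule lin_sum[OF lin_fl])
    also have "\<dots> = (\<lambda>c. \<Sum>l = 1..N. vv\<^sup>2 * fl l (fl (Suc N) Y) c)"
      by (intro ext sum.cong refl) (simp add: fl_fl_commute)
    finally show ?thesis by (simp add: gl_def sum_distrib_left)
  qed
  have "laurent (divided_power (fl (Suc N)) b X c)" for b c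
  proof -
    have "divided_power (fl (Suc N)) b X c = vv powi (int b * AA c (Suc N))
        * (qff (xx c (Suc N)) b / qfact b) * X ((dn (Suc N) ^^ b) c)"
      by (simp add: divided_power_def fl_funpow divide_inverse)
    then show ?thesis
      using Suc.prems by (simp only:) (intro laurent_mult laurent_powi laurent_qbinom)
  qed
  then have "laurent (vv ^ (a * (k - a)) * divided_power (gl N) a (divided_power (fl (Suc N)) (k - a) X) m)" for a
    by (intro laurent_mult laurent_power Suc.IH)
  moreover have "gl (Suc N) Y = (\<lambda>c. gl N Y c + fl (Suc N) Y c)" for Y
    by (simp add: gl_def fun_eq_iff)
  ultimately show ?case
    by (subst divided_power_quantum_binomial[OF lin_gl lin_fl comm]) (auto intro: laurent_sum)
qed

definition fd :: "nat \<Rightarrow> H \<Rightarrow> H" where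
  "fd = divided_power ff"

lemma lin_fd: "lin (fd k)"
  unfolding fd_def by (rule lin_divided_power[OF lin_ff])

lemma fd_0 [simp]: "fd 0 X = X"
  by (simp add: fd_def)

lemma ff_fd: "ff (fd k X) = (\<lambda>c. qint (int (Suc k)) * fd (Suc k) X c)"
  unfolding fd_def by (rule lin_divided_power_Suc[OF lin_ff])

lemma laurent_fd:
  assumes "\<And>m. laurent (X m)" shows "laurent (fd k X m)"
proof -
  \<comment> \<open>Steps down only shorten a multisegment, so below length \<open>N\<close> all
    iterates of \<open>ff\<close> and \<open>gl N\<close> agree.\<close>
  have "(ff ^^ k) X c = (gl N ^^ k) X c" if "len c \<le> N" for N c
    using that
  proof (induction k arbitrary: c)
    case (Suc k)
    have "fl l ((ff ^^ k) X) c = fl l ((gl N ^^ k) X) c" if "1 \<le> l" for l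
    proof (cases "xx c l = 0")
      case False
      then have "len (dn l c) \<le> N" using len_dn[of l c] that Suc.prems by simp
      then show ?thesis by (simp add: fl_def Suc.IH)
    qed (simp add: fl_eq_0)
    then show ?case
      by (simp add: ff_bound[OF Suc.prems] gl_def[of N "(gl N ^^ k) X"] del: One_nat_def)
  qed simp
  then have "fd k X m = divided_power (gl (len m)) k X m" by (simp add: fd_def divided_power_def)
  then show ?thesis using laurent_divided_power_gl[OF assms] by simp
qed

text \<open>Each further f passes through e' with factor v^(-2) and adds 1, so the coefficient for
  f^(k+1) is 1 + v^(-2) + ... + v^(-2k) = v^(-k) [k+1]; the divided powers cancel [k+1].\<close>

lemma ee_fd:
  assumes "ee X = (\<lambda>c. 0)"
  shows "ee (fd (Suc k) X) = (\<lambda>c. vv powi (- int k) * fd k X c)"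
proof -
  have "ee ((ff ^^ Suc k) X) = (\<lambda>c. vv powi (- int k) * qint (int (Suc k)) * (ff ^^ k) X c)"
  proof (induction k)
    case 0
    have "ff (ee X) = (\<lambda>c. 0)" using assms lin_zero[OF lin_ff] by simp
    then show ?case by (intro ext) (simp add: ee_ff)
  next
    case (Suc k)
    have "vv powi (- 2) * (vv powi (- int k) * qint (int (Suc k))) + 1
        = vv powi (- int (Suc k)) * qint (int (Suc (Suc k)))"
    proof -
      have "qint (int (Suc (Suc k))) = vv powi (- 1) * qint (int (Suc k)) + vv powi int (Suc k)"
        using qint_add[of "int (Suc k)" 1] by (simp add: add.commute)
      moreover have "vv powi (- int (Suc k)) * vv powi (- 1) = vv powi (- 2) * vv powi (- int k)"
        by (subst (1 2) power_int_add[symmetric]) simp_all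
      moreover have "vv powi (- int (Suc k)) * vv powi int (Suc k) = 1"
        by (simp only: power_int_minus) (simp add: field_simps del: of_nat_Suc)
      ultimately show ?thesis by (simp only: distrib_left mult.assoc[symmetric])
    qed
    note coeff = this
    have "ee ((ff ^^ Suc (Suc k)) X) c
        = vv powi (- 2) * ff (ee ((ff ^^ Suc k) X)) c + (ff ^^ Suc k) X c" for c
      using ee_ff[of "(ff ^^ Suc k) X" c] by simp
    also have "\<dots> c = (vv powi (- 2) * (vv powi (- int k) * qint (int (Suc k))) + 1) * (ff ^^ Suc k) X c" for c
      unfolding Suc.IH lin_scale[OF lin_ff] by (simp add: algebra_simps del: of_nat_Suc)
    finally show ?case unfolding coeff by (rule ext)
  qed
  then show ?thesis
    using qint_neq_0[of "Suc k"] unfolding fd_def divided_power_def lin_scale[OF lin_ee]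
    by (intro ext) (simp add: qfact_Suc field_simps del: of_nat_Suc funpow.simps)
qed

text \<open>e' removes the term of index 0 and lowers all other indices by one, so the induction
  hypothesis disposes of the terms of positive index, and then nothing but x_0 is left in the
  relation.\<close>

lemma decomposition_unique:
  assumes "\<forall>k\<le>N. ee (x k) = (\<lambda>c. 0)" "(\<lambda>c. \<Sum>k\<le>N. fd k (x k) c) = (\<lambda>c. 0)" "k \<le> N"
  shows "x k = (\<lambda>c. 0)"
  using assms
proof (induction N arbitrary: x k)
  case (Suc N)
  define y where "y k = (\<lambda>c. vv powi (- int k) * x (Suc k) c)" for k
  have sum: "(\<lambda>c. \<Sum>k\<le>Suc N. fd k (x k) c) = (\<lambda>c. x 0 c + (\<Sum>k\<le>N. fd (Suc k) (x (Suc k)) c))"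
    by (simp only: sum.atMost_Suc_shift fd_0)
  have "(\<lambda>c. 0) = ee (\<lambda>c. x 0 c + (\<Sum>k\<le>N. fd (Suc k) (x (Suc k)) c))"
    using Suc.prems(2) lin_zero[OF lin_ee] unfolding sum by simp
  also have "\<dots> = (\<lambda>c. ee (x 0) c + (\<Sum>k\<le>N. ee (fd (Suc k) (x (Suc k))) c))"
    by (simp only: lin_add[OF lin_ee] lin_sum[OF lin_ee])
  also have "\<dots> = (\<lambda>c. \<Sum>k\<le>N. fd k (y k) c)"
  proof -
    have "ee (fd (Suc k) (x (Suc k))) = fd k (y k)" if "k \<le> N" for k
      using Suc.prems(1) that unfolding y_def lin_scale[OF lin_fd] by (intro ee_fd) simp
    then show ?thesis using Suc.prems(1) by (simp cong: sum.cong_simp)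
  qed
  finally have "(\<lambda>c. \<Sum>k\<le>N. fd k (y k) c) = (\<lambda>c. 0)" by (rule sym)
  moreover have "\<forall>k\<le>N. ee (y k) = (\<lambda>c. 0)"
    using Suc.prems(1) by (simp add: y_def lin_scale[OF lin_ee])
  ultimately have "y k = (\<lambda>c. 0)" if "k \<le> N" for k
    using Suc.IH that by blast
  then have z: "x (Suc k) = (\<lambda>c. 0)" if "k \<le> N" for k
    using that by (fastforce simp: y_def fun_eq_iff)
  then have "x 0 = (\<lambda>c. 0)"
    using Suc.prems(2) unfolding sum by (simp add: lin_zero[OF lin_fd] cong: sum.cong_simp)
  with z Suc.prems(3) show ?case by (cases k) auto
qed simp

text \<open>The degree d part of the Z[v, v^(-1)]-form. Its finite rank provides finite sums, its
  integrality the positivity of squares.\<close>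

definition graded :: "nat \<Rightarrow> H \<Rightarrow> bool" where
  "graded d X \<longleftrightarrow> (\<forall>m. laurent (X m) \<and> (X m \<noteq> 0 \<longrightarrow> valid_mseg n m \<and> len m = d))"

lemma graded_laurent: "graded d X \<Longrightarrow> laurent (X m)"
  by (simp add: graded_def)

lemma graded_scale: "laurent a \<Longrightarrow> graded d X \<Longrightarrow> graded d (\<lambda>c. a * X c)"
  by (auto simp: graded_def laurent_mult)

lemma graded_diff: "graded d X \<Longrightarrow> graded d Y \<Longrightarrow> graded d (\<lambda>c. X c - Y c)"
  by (auto simp: graded_def laurent_diff) (metis diff_zero diff_0 right_minus_eq)+

lemma graded_sum: "(\<And>a. a \<in> I \<Longrightarrow> graded d (Y a)) \<Longrightarrow> graded d (\<lambda>c. \<Sum>a\<in>I. Y a c)"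
  unfolding graded_def by (auto simp: laurent_sum) (metis (mono_tags, lifting) sum.neutral)+

lemma ff_support:
  assumes "ff X c \<noteq> 0"
  obtains l where "1 \<le> l" "0 < xx c l" "X (dn l c) \<noteq> 0"
proof -
  from assms obtain l where "l \<in> {1..len c}" "fl l X c \<noteq> 0"
    unfolding ff_def by (meson sum.neutral)
  then show ?thesis using that[of l] by (cases "xx c l") (auto simp: fl_def)
qed

lemma ee_support:
  assumes "ee X m \<noteq> 0"
  obtains l where "1 \<le> l" "can_up l m" "X (up l m) \<noteq> 0"
proof -
  from assms obtain l where "l \<in> {1..Suc (len m)}" "el l X m \<noteq> 0"
    unfolding ee_def by (meson sum.neutral)
  then show ?thesis using that[of l] el_eq_0[of l m X] by (cases "can_up l m") (auto simp: el_def)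
qed

lemma graded_fd:
  assumes "graded d X" shows "graded (d + k) (fd k X)"
proof -
  have "valid_mseg n m \<and> len m = d + k" if "(ff ^^ k) X m \<noteq> 0" for m
    using that
  proof (induction k arbitrary: m)
    case 0
    then show ?case using assms by (simp add: graded_def)
  next
    case (Suc k)
    then have "ff ((ff ^^ k) X) m \<noteq> 0" by simp
    then obtain l where "1 \<le> l" "0 < xx m l" "(ff ^^ k) X (dn l m) \<noteq> 0" by (rule ff_support)
    then show ?case using Suc.IH[of "dn l m"] len_dn[of l m] valid_dn[of l m] by auto
  qed
  then show ?thesis
    using laurent_fd[of X k] assms by (auto simp: graded_def) (auto simp: fd_def divided_power_def)
qed

lemma laurent_el: "laurent (X (up l m)) \<Longrightarrow> laurent (el l X m)"
  unfolding el_def bet_def by (auto intro!: laurent_mult laurent_powi laurent_diff laurent_power)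

lemma graded_ee:
  assumes "graded (Suc d) X" shows "graded d (ee X)"
  unfolding graded_def
proof (intro allI conjI impI)
  fix m
  show "laurent (ee X m)"
    unfolding ee_def using assms by (intro laurent_sum laurent_el) (simp add: graded_def)
  show "valid_mseg n m" "len m = d" if "ee X m \<noteq> 0"
  proof -
    from that obtain l where "1 \<le> l" "can_up l m" "X (up l m) \<noteq> 0" by (rule ee_support)
    then show "valid_mseg n m" "len m = d"
      using assms len_up[of l m] valid_up[of l m] by (auto simp: graded_def)
  qed
qed

lemma ee_graded_0: "graded 0 X \<Longrightarrow> ee X = (\<lambda>c. 0)"
  by (rule ext, rule ccontr, erule ee_support) (metis graded_def len_up nat.distinct(1))

text \<open>If $e' x = \sum_k f^{(k)} z_k$, then $x - \sum_k v^k f^{(k+1)} z_k$ lies in the kernel.\<close>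

lemma decomposition_exists:
  "graded d X \<Longrightarrow> \<exists>x. (\<forall>k\<le>d. graded (d - k) (x k) \<and> ee (x k) = (\<lambda>c. 0))
    \<and> X = (\<lambda>c. \<Sum>k\<le>d. fd k (x k) c)"
proof (induction d arbitrary: X)
  case 0
  then show ?case by (intro exI[of _ "\<lambda>_. X"]) (simp add: ee_graded_0)
next
  case (Suc d)
  from Suc.IH[OF graded_ee[OF Suc.prems]] obtain z where
    z: "\<And>k. k \<le> d \<Longrightarrow> graded (d - k) (z k)" "\<And>k. k \<le> d \<Longrightarrow> ee (z k) = (\<lambda>c. 0)"
      "ee X = (\<lambda>c. \<Sum>k\<le>d. fd k (z k) c)" by blast
  define w where "w k = (\<lambda>c. vv ^ k * z k c)" for k
  have w: "graded (d - k) (w k)" "ee (w k) = (\<lambda>c. 0)" if "k \<le> d" for k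
    using z that by (simp_all add: w_def graded_scale laurent_power lin_scale[OF lin_ee])
  define x0 where "x0 = (\<lambda>c. X c - (\<Sum>k\<le>d. fd (Suc k) (w k) c))"
  have "graded (Suc d) (fd (Suc k) (w k))" if "k \<le> d" for k
    using graded_fd[OF w(1)[OF that], of "Suc k"] that by simp
  then have h0: "graded (Suc d) x0"
    unfolding x0_def by (intro graded_diff Suc.prems graded_sum) simp
  have "ee (fd (Suc k) (w k)) = fd k (z k)" if "k \<le> d" for k
    unfolding ee_fd[OF w(2)[OF that]] by (simp add: w_def lin_scale[OF lin_fd] power_int_minus fun_eq_iff)
  then have e0: "ee x0 = (\<lambda>c. 0)"
    unfolding x0_def by (simp add: lin_diff[OF lin_ee] lin_sum[OF lin_ee] z(3) cong: sum.cong_simp)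
  define x where "x k = (case k of 0 \<Rightarrow> x0 | Suc j \<Rightarrow> w j)" for k
  have "\<forall>k\<le>Suc d. graded (Suc d - k) (x k) \<and> ee (x k) = (\<lambda>c. 0)"
    using h0 e0 w by (auto simp: x_def split: nat.splits)
  moreover have "X = (\<lambda>c. \<Sum>k\<le>Suc d. fd k (x k) c)"
    unfolding sum.atMost_Suc_shift by (simp add: x_def x0_def)
  ultimately show ?case by blast
qed

end

section \<open>The crystal at $v = 0$\<close>

definition value_at_0 :: "K \<Rightarrow> int" where
  "value_at_0 x = (THE r. val0 x r)"

lemma value_at_0_eq: "val0 x r \<Longrightarrow> value_at_0 x = r"
  unfolding value_at_0_def using val0_unique by blast

definition regular :: "K \<Rightarrow> bool" where
  "regular x \<longleftrightarrow> val0 x (value_at_0 x)"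

lemma val0_regular: "val0 x r \<Longrightarrow> regular x"
  by (simp add: regular_def value_at_0_eq)

lemma regular_val0: "regular x \<Longrightarrow> val0 x (value_at_0 x)"
  by (simp add: regular_def)

lemma sum_squares_eq_1:
  fixes r :: "'a \<Rightarrow> int"
  assumes "finite I" "(\<Sum>a\<in>I. (r a)\<^sup>2) = 1"
  obtains b where "b \<in> I" "(r b)\<^sup>2 = 1" "\<And>a. a \<in> I \<Longrightarrow> a \<noteq> b \<Longrightarrow> r a = 0"
proof -
  obtain b where b: "b \<in> I" "r b \<noteq> 0"
    using assms by (metis (no_types, lifting) power_zero_numeral sum.neutral zero_neq_one)
  have "(r b)\<^sup>2 + (\<Sum>a\<in>I - {b}. (r a)\<^sup>2) = 1"
    using assms b by (simp add: sum.remove)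
  moreover have "(r b)\<^sup>2 > 0" using b by simp
  moreover have "(\<Sum>a\<in>I - {b}. (r a)\<^sup>2) \<ge> 0" by (intro sum_nonneg) simp
  ultimately have *: "(r b)\<^sup>2 = 1" "(\<Sum>a\<in>I - {b}. (r a)\<^sup>2) = 0" by linarith+
  then have "\<forall>a\<in>I - {b}. (r a)\<^sup>2 = 0"
    using assms(1) by (subst (asm) sum_nonneg_eq_0_iff) auto
  with b * that show ?thesis by auto
qed

context adjacent_vertices
begin

definition msegs :: "nat \<Rightarrow> mseg set" where
  "msegs d = {m. valid_mseg n m \<and> len m = d}"

lemma finite_msegs: "finite (msegs d)"
proof (induction d rule: less_induct)
  case (less d)
  have "msegs d \<subseteq> {{#}} \<union> (\<Union>s\<in>{1..d} \<times> {..<n}. add_mset s ` msegs (d - fst s))"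
  proof
    fix m assume m: "m \<in> msegs d"
    show "m \<in> {{#}} \<union> (\<Union>s\<in>{1..d} \<times> {..<n}. add_mset s ` msegs (d - fst s))"
    proof (cases m)
      case (add s m')
      then have "s \<in> {1..d} \<times> {..<n}" "m' \<in> msegs (d - fst s)"
        using m by (auto simp: msegs_def valid_mseg_def mem_Times_iff)
      then show ?thesis using add by blast
    qed simp
  qed
  moreover have "finite (msegs (d - fst s))" if "s \<in> {1..d} \<times> {..<n}" for s
    using that by (intro less) auto
  then have "finite ({{#}} \<union> (\<Union>s\<in>{1..d} \<times> {..<n}. add_mset s ` msegs (d - fst s)))"
    by (intro finite_UnI finite_UN_I finite_imageI) auto
  ultimately show ?case by (rule finite_subset)
qed

text \<open>The form on one degree. The fixed finite index set makes bilinearity immediate, without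
  any discussion of supports.\<close>

definition ipd :: "nat \<Rightarrow> H \<Rightarrow> H \<Rightarrow> K" where
  "ipd d X Y = (\<Sum>m\<in>msegs d. X m * Y m * pbw_norm m)"

lemma graded_eq_0: "graded d X \<Longrightarrow> m \<notin> msegs d \<Longrightarrow> X m = 0"
  by (auto simp: graded_def msegs_def)

lemma graded_support: "graded d X \<Longrightarrow> {m. X m \<noteq> 0} \<subseteq> msegs d"
  using graded_eq_0 by blast

lemma graded_finite: "graded d X \<Longrightarrow> finite {m. X m \<noteq> 0}"
  using graded_support finite_msegs finite_subset by blast

lemma ip_eq_ipd: "graded d X \<Longrightarrow> ip X Y = ipd d X Y"
  unfolding ipd_def using finite_msegs by (rule ip_eq_sum) (use graded_eq_0 in blast)

text \<open>At v = 0 the form becomes the standard scalar product of integer vectors, because all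
  PBW norms have value 1.\<close>

lemma val0_ipd:
  "(\<And>b. b \<in> msegs d \<Longrightarrow> val0 (X b) (r b)) \<Longrightarrow> (\<And>b. b \<in> msegs d \<Longrightarrow> val0 (Y b) (s b))
    \<Longrightarrow> val0 (ipd d X Y) (\<Sum>b\<in>msegs d. r b * s b)"
  unfolding ipd_def using val0_mult[OF val0_mult val0_pbw_norm] by (intro val0_sum) fastforce

text \<open>Positivity for an orthogonal sum: written over pairs (k, b), the weighted sum of norms
  is a sum of squares with weights of value 1, so no single coefficient can have a pole.\<close>

lemma regular_of_norms:
  assumes "val0 (\<Sum>k\<in>I. a k * ipd (D k) (z k) (z k)) r" "finite I"
    and "\<And>k. k \<in> I \<Longrightarrow> val0 (a k) 1" "\<And>k b. k \<in> I \<Longrightarrow> laurent (z k b)" "k \<in> I" "b \<in> msegs (D k)"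
  shows "regular (z k b)"
proof -
  define S where "S = (SIGMA k:I. msegs (D k))"
  have "(\<Sum>k\<in>I. a k * ipd (D k) (z k) (z k))
      = (\<Sum>(k, b)\<in>S. (a k * pbw_norm b) * (z k b)\<^sup>2)"
    unfolding ipd_def sum_distrib_left S_def using \<open>finite I\<close> finite_msegs
    by (subst sum.Sigma) (auto intro!: sum.cong simp: power2_eq_square mult_ac)
  also have "\<dots> = (\<Sum>p\<in>S. (case p of (k, b) \<Rightarrow> a k * pbw_norm b) * (case p of (k, b) \<Rightarrow> z k b)\<^sup>2)"
    by (intro sum.cong) auto
  finally have "val0 (\<Sum>p\<in>S. (case p of (k, b) \<Rightarrow> a k * pbw_norm b) * (case p of (k, b) \<Rightarrow> z k b)\<^sup>2) r"
    using assms(1) by simp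
  then have "\<exists>s. val0 (case (k, b) of (k, b) \<Rightarrow> z k b) s"
    using val0_mult[OF _ val0_pbw_norm, of _ 1] assms finite_msegs
    by (elim regular_of_sum_squares[rotated 3]) (auto simp: S_def)
  then show ?thesis by (auto intro: val0_regular)
qed

text \<open>One f at a time is moved across the form, where \<open>ee_fd\<close> lowers the other
  divided power, until one side is in the kernel of e'.\<close>

lemma ip_fd_fd:
  assumes "graded d X" "graded e Y" "ee X = (\<lambda>c. 0)" "ee Y = (\<lambda>c. 0)"
  shows "ip (fd k X) (fd j Y) = (if k = j then gam k * ip X Y else 0)"
proof -
  have scale: "ip (\<lambda>c. a * Z c) W = a * ip Z W" if "graded f Z" for a Z W f
  proof -
    have "ip (\<lambda>c. a * Z c) W = ipd f (\<lambda>c. a * Z c) W"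
      unfolding ipd_def using finite_msegs by (rule ip_eq_sum) (use graded_eq_0[OF that] in auto)
    also have "\<dots> = a * ipd f Z W" by (simp add: ipd_def sum_distrib_left mult.assoc)
    finally show ?thesis using ip_eq_ipd[OF that] by simp
  qed
  have step: "qint (int (Suc k)) * ip (fd (Suc k) X) W = ip (fd k X) (ee W)"
    if "graded d X" "graded f W" for d f k X W
    using ff_adjoint[OF graded_finite[OF graded_fd[OF that(1), of k]] graded_finite[OF that(2)]]
      scale[OF graded_fd[OF that(1)], of "qint (int (Suc k))" "Suc k" W]
    unfolding ff_fd by simp
  have zero: "ip Z (\<lambda>c. 0) = 0" for Z
    by (simp add: ip_def)
  show ?thesis
  proof (induction k arbitrary: j)
    case 0
    show ?case
    proof (cases j)
      case (Suc i)
      have "qint (int (Suc i)) * ip (fd (Suc i) Y) X = 0"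
        using step[OF assms(2,1), of i] assms(3) zero by simp
      then show ?thesis using Suc qint_neq_0[of "Suc i"] by (simp add: ip_commute del: of_nat_Suc)
    qed simp
  next
    case (Suc k)
    show ?case
    proof (cases j)
      case 0
      have "qint (int (Suc k)) * ip (fd (Suc k) X) Y = 0"
        using step[OF assms(1,2), of k] assms(4) zero by simp
      then show ?thesis using 0 qint_neq_0[of "Suc k"] by (simp del: of_nat_Suc)
    next
      case (Suc i)
      have "qint (int (Suc k)) * ip (fd (Suc k) X) (fd (Suc i) Y)
          = vv powi (- int i) * ip (fd k X) (fd i Y)"
        using step[OF assms(1) graded_fd[OF assms(2)], of k "Suc i"]
          scale[OF graded_fd[OF assms(2)], of "vv powi (- int i)" i "fd k X"]
        unfolding ee_fd[OF assms(4)] by (simp add: ip_commute)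
      also have "\<dots> = (if k = i then qint (int (Suc k)) * (gam (Suc k) * ip X Y) else 0)"
      proof -
        have "vv powi (- int k) * (gam k * z) = qint (int (Suc k)) * (gam (Suc k) * z)" for z
          unfolding mult.assoc[symmetric] gam_Suc[symmetric] by (simp only: mult_ac)
        then show ?thesis
          unfolding Suc.IH by (cases "k = i") (simp_all only: if_True if_False simp_thms mult_zero_right)
      qed
      finally show ?thesis using Suc qint_neq_0[of "Suc k"] by (simp split: if_splits del: of_nat_Suc)
    qed
  qed
qed

text \<open>The exponents \<open>s\<close> and \<open>t\<close> may differ, because a vector already
  shifted by the Kashiwara operator is also paired with an unshifted decomposition.\<close>

lemma ipd_sum_fd:
  assumes "\<And>k. k \<in> I \<Longrightarrow> ee (x k) = (\<lambda>c. 0)" "\<And>j. j \<in> J \<Longrightarrow> ee (y j) = (\<lambda>c. 0)"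
    and "\<And>k. k \<in> I \<Longrightarrow> graded (d k) (x k) \<and> d k + s k = e" "\<And>j. j \<in> J \<Longrightarrow> graded (d' j) (y j)"
  shows "ipd e (\<lambda>c. \<Sum>k\<in>I. a k * fd (s k) (x k) c) (\<lambda>c. \<Sum>j\<in>J. b j * fd (t j) (y j) c)
    = (\<Sum>k\<in>I. \<Sum>j\<in>J. a k * b j * (if s k = t j then gam (s k) * ipd (d k) (x k) (y j) else 0))"
proof -
  have "ipd e (\<lambda>c. \<Sum>k\<in>I. a k * fd (s k) (x k) c) (\<lambda>c. \<Sum>j\<in>J. b j * fd (t j) (y j) c)
      = (\<Sum>k\<in>I. \<Sum>j\<in>J. a k * b j * ipd e (fd (s k) (x k)) (fd (t j) (y j)))"
  proof -
    have "ipd e (\<lambda>c. \<Sum>k\<in>I. a k * fd (s k) (x k) c) (\<lambda>c. \<Sum>j\<in>J. b j * fd (t j) (y j) c)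
        = (\<Sum>m\<in>msegs e. \<Sum>k\<in>I. \<Sum>j\<in>J. a k * b j * (fd (s k) (x k) m * fd (t j) (y j) m * pbw_norm m))"
      unfolding ipd_def sum_distrib_right
      by (intro sum.cong refl) (simp add: sum_distrib_left mult_ac)
    also have "\<dots> = (\<Sum>k\<in>I. \<Sum>j\<in>J. \<Sum>m\<in>msegs e. a k * b j * (fd (s k) (x k) m * fd (t j) (y j) m * pbw_norm m))"
      by (subst sum.swap) (intro sum.cong refl sum.swap)
    finally show ?thesis unfolding ipd_def sum_distrib_left .
  qed
  also have "\<dots> = (\<Sum>k\<in>I. \<Sum>j\<in>J. a k * b j * (if s k = t j then gam (s k) * ipd (d k) (x k) (y j) else 0))"
  proof (intro sum.cong refl)
    fix k j assume k: "k \<in> I" and j: "j \<in> J"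
    have "graded e (fd (s k) (x k))" using assms(3)[OF k] graded_fd by metis
    from ip_eq_ipd[OF this]
    have "ipd e (fd (s k) (x k)) (fd (t j) (y j)) = (if s k = t j then gam (s k) * ip (x k) (y j) else 0)"
      using ip_fd_fd[of "d k" "x k" "d' j" "y j"] assms k j by metis
    then show "a k * b j * ipd e (fd (s k) (x k)) (fd (t j) (y j))
        = a k * b j * (if s k = t j then gam (s k) * ipd (d k) (x k) (y j) else 0)"
      using ip_eq_ipd[of "d k" "x k"] assms(3)[OF k] by simp
  qed
  finally show ?thesis .
qed

lemma ipd_sum_fd_diag:
  assumes "\<And>k. k \<in> I \<Longrightarrow> ee (x k) = (\<lambda>c. 0)" "\<And>k. k \<in> I \<Longrightarrow> ee (y k) = (\<lambda>c. 0)"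
    and "\<And>k. k \<in> I \<Longrightarrow> graded (d k) (x k) \<and> d k + s k = e" "\<And>k. k \<in> I \<Longrightarrow> graded (d k) (y k)"
    and "inj_on s I" "finite I"
  shows "ipd e (\<lambda>c. \<Sum>k\<in>I. a k * fd (s k) (x k) c) (\<lambda>c. \<Sum>k\<in>I. b k * fd (s k) (y k) c)
    = (\<Sum>k\<in>I. a k * b k * gam (s k) * ipd (d k) (x k) (y k))"
proof -
  have "(\<Sum>j\<in>I. a k * b j * (if s k = s j then gam (s k) * ipd (d k) (x k) (y j) else 0))
      = a k * b k * gam (s k) * ipd (d k) (x k) (y k)" if "k \<in> I" for k
  proof -
    have "(\<Sum>j\<in>I. a k * b j * (if s k = s j then gam (s k) * ipd (d k) (x k) (y j) else 0))
        = (\<Sum>j\<in>I. if j = k then a k * b k * gam (s k) * ipd (d k) (x k) (y k) else 0)"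
      using that assms(5) by (intro sum.cong refl) (auto simp: inj_on_def mult_ac)
    then show ?thesis using that assms(6) by simp
  qed
  then show ?thesis
    by (subst ipd_sum_fd[where d = d and d' = d]) (use assms in \<open>auto intro!: sum.cong\<close>)
qed

lemma graded_ubasis: "m \<in> msegs d \<Longrightarrow> graded d (ubasis m)"
  by (auto simp: graded_def ubasis_def msegs_def)

text \<open>A chosen decomposition with coefficients in Z[v, v^(-1)]. By
  \<open>decomposition_unique\<close> it is the one that defines the Kashiwara operator over
  C(v).\<close>

definition component :: "mseg \<Rightarrow> nat \<Rightarrow> H" where
  "component m = (SOME x. (\<forall>k\<le>len m. graded (len m - k) (x k) \<and> ee (x k) = (\<lambda>c. 0))
    \<and> ubasis m = (\<lambda>c. \<Sum>k\<le>len m. fd k (x k) c))"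

lemma component:
  assumes "m \<in> msegs d"
  shows "k \<le> d \<Longrightarrow> graded (d - k) (component m k)" "k \<le> d \<Longrightarrow> ee (component m k) = (\<lambda>c. 0)"
    and "ubasis m = (\<lambda>c. \<Sum>k\<le>d. fd k (component m k) c)"
proof -
  have d: "len m = d" using assms by (simp add: msegs_def)
  from someI_ex[OF decomposition_exists[OF graded_ubasis[OF assms]]]
  show "k \<le> d \<Longrightarrow> graded (d - k) (component m k)" "k \<le> d \<Longrightarrow> ee (component m k) = (\<lambda>c. 0)"
    and "ubasis m = (\<lambda>c. \<Sum>k\<le>d. fd k (component m k) c)"
    unfolding component_def d by blast+
qed

lemma ipd_ubasis: "m \<in> msegs d \<Longrightarrow> ipd d (ubasis m) (ubasis m') = (if m = m' then pbw_norm m else 0)"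
  unfolding ipd_def ubasis_def
  by (subst sum.remove[OF finite_msegs, of m]) (auto intro: sum.neutral)

lemma ipd_ubasis_component:
  assumes "m \<in> msegs d" "m' \<in> msegs d"
  shows "(\<Sum>k\<le>d. gam k * ipd (d - k) (component m k) (component m' k)) = (if m = m' then pbw_norm m else 0)"
proof -
  have "ipd d (\<lambda>c. \<Sum>k\<le>d. 1 * fd k (component m k) c) (\<lambda>c. \<Sum>k\<le>d. 1 * fd k (component m' k) c)
      = (\<Sum>k\<le>d. 1 * 1 * gam k * ipd (d - k) (component m k) (component m' k))"
    by (rule ipd_sum_fd_diag) (use component assms in auto)
  then show ?thesis
    using ipd_ubasis[OF assms(1), of m'] component(3)[OF assms(1)] component(3)[OF assms(2)] by simp
qed

text \<open>The norm of a PBW element is regular and equals the sum of the norms of the components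
  with weights \<open>gam k\<close>.\<close>

lemma regular_component:
  assumes "m \<in> msegs d" "k \<le> d" "b \<in> msegs (d - k)"
  shows "regular (component m k b)"
proof (rule regular_of_norms[where I = "{..d}" and a = gam and D = "\<lambda>k. d - k"])
  show "val0 (\<Sum>k\<le>d. gam k * ipd (d - k) (component m k) (component m k)) 1"
    using ipd_ubasis_component[OF assms(1,1)] by (simp add: val0_pbw_norm)
  show "laurent (component m j c)" if "j \<in> {..d}" for j c
    using graded_laurent[OF component(1)[OF assms(1)]] that by simp
qed (use assms in \<open>auto simp: val0_gam\<close>)

definition comp_val :: "mseg \<Rightarrow> nat \<Rightarrow> mseg \<Rightarrow> int" where
  "comp_val m k b = value_at_0 (component m k b)"

lemma val0_component: "m \<in> msegs d \<Longrightarrow> k \<le> d \<Longrightarrow> b \<in> msegs (d - k) \<Longrightarrow> val0 (component m k b) (comp_val m k b)"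
  unfolding comp_val_def by (rule regular_val0[OF regular_component])

lemma val0_ipd_component:
  "m \<in> msegs d \<Longrightarrow> m' \<in> msegs d' \<Longrightarrow> k \<le> d \<Longrightarrow> j \<le> d' \<Longrightarrow> d - k = d' - j
    \<Longrightarrow> val0 (ipd (d - k) (component m k) (component m' j)) (\<Sum>b\<in>msegs (d - k). comp_val m k b * comp_val m' j b)"
  by (rule val0_ipd) (auto intro: val0_component)

lemma comp_val_orthonormal:
  assumes "m \<in> msegs d" "m' \<in> msegs d"
  shows "(\<Sum>k\<le>d. \<Sum>b\<in>msegs (d - k). comp_val m k b * comp_val m' k b) = of_bool (m = m')"
proof -
  have "val0 (\<Sum>k\<le>d. gam k * ipd (d - k) (component m k) (component m' k))
      (\<Sum>k\<le>d. 1 * (\<Sum>b\<in>msegs (d - k). comp_val m k b * comp_val m' k b))"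
    by (intro val0_sum val0_mult val0_gam val0_ipd_component) (use assms in auto)
  moreover have "val0 (if m = m' then pbw_norm m else 0) (of_bool (m = m'))"
    by (simp add: val0_pbw_norm)
  ultimately show ?thesis
    unfolding ipd_ubasis_component[OF assms] using val0_unique by fastforce
qed

definition depth :: "mseg \<Rightarrow> nat" where
  "depth m = (SOME k. k \<le> len m \<and> (\<exists>b\<in>msegs (len m - k). comp_val m k b \<noteq> 0))"

text \<open>By \<open>comp_val_orthonormal\<close> the integers \<open>comp_val m k b\<close> form a
  vector of length 1, so a single entry is nonzero, and it is 1 or -1.\<close>

lemma depth:
  assumes "m \<in> msegs d"
  shows "depth m \<le> d" "(\<Sum>b\<in>msegs (d - depth m). (comp_val m (depth m) b)\<^sup>2) = 1"
    and "\<And>k b. k \<le> d \<Longrightarrow> b \<in> msegs (d - k) \<Longrightarrow> comp_val m k b \<noteq> 0 \<Longrightarrow> k = depth m"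
proof -
  have d: "len m = d" using assms by (simp add: msegs_def)
  define S where "S = (SIGMA k:{..d}. msegs (d - k))"
  have "finite S" unfolding S_def using finite_msegs by auto
  moreover have "(\<Sum>p\<in>S. (case p of (k, b) \<Rightarrow> comp_val m k b)\<^sup>2) = 1"
    using comp_val_orthonormal[OF assms assms] finite_msegs unfolding S_def
    by (subst (asm) sum.Sigma) (auto simp: power2_eq_square case_prod_unfold)
  ultimately obtain p where "p \<in> S" "(case p of (k, b) \<Rightarrow> comp_val m k b)\<^sup>2 = 1"
    "\<And>a. a \<in> S \<Longrightarrow> a \<noteq> p \<Longrightarrow> (case a of (k, b) \<Rightarrow> comp_val m k b) = 0"
    by (rule sum_squares_eq_1[of S "\<lambda>p. case p of (k, b) \<Rightarrow> comp_val m k b"]) blast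
  then obtain k b where kb: "k \<le> d" "b \<in> msegs (d - k)" "(comp_val m k b)\<^sup>2 = 1"
    "\<And>j c. j \<le> d \<Longrightarrow> c \<in> msegs (d - j) \<Longrightarrow> (j, c) \<noteq> (k, b) \<Longrightarrow> comp_val m j c = 0"
    unfolding S_def by fastforce
  have "comp_val m k b \<noteq> 0" using kb(3) by auto
  then have "\<exists>k. k \<le> d \<and> (\<exists>b\<in>msegs (d - k). comp_val m k b \<noteq> 0)" using kb by blast
  from someI_ex[OF this] have K: "depth m \<le> d" "\<exists>b\<in>msegs (d - depth m). comp_val m (depth m) b \<noteq> 0"
    unfolding depth_def d by auto
  have u: "j = k" if "j \<le> d" "c \<in> msegs (d - j)" "comp_val m j c \<noteq> 0" for j c
    using kb(4)[OF that(1,2)] that(3) by auto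
  with K have "depth m = k" by blast
  show "depth m \<le> d" by (rule K)
  show "j = depth m" if "j \<le> d" "c \<in> msegs (d - j)" "comp_val m j c \<noteq> 0" for j c
    unfolding \<open>depth m = k\<close> using that by (rule u)
  have "(\<Sum>c\<in>msegs (d - k). (comp_val m k c)\<^sup>2) = (\<Sum>c\<in>msegs (d - k). if c = b then 1 else 0)"
    using kb by (intro sum.cong) auto
  then show "(\<Sum>b\<in>msegs (d - depth m). (comp_val m (depth m) b)\<^sup>2) = 1"
    using kb finite_msegs \<open>depth m = k\<close> by simp
qed

definition f_tilde :: "mseg \<Rightarrow> H" where
  "f_tilde m = (\<lambda>c. \<Sum>k\<le>len m. fd (Suc k) (component m k) c)"

lemma f_tilde: "m \<in> msegs d \<Longrightarrow> f_tilde m = (\<lambda>c. \<Sum>k\<le>d. fd (Suc k) (component m k) c)"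
  by (simp add: f_tilde_def msegs_def)

lemma graded_f_tilde: assumes "m \<in> msegs d" shows "graded (Suc d) (f_tilde m)"
  unfolding f_tilde[OF assms]
proof (rule graded_sum)
  fix k assume "k \<in> {..d}"
  then show "graded (Suc d) (fd (Suc k) (component m k))"
    using graded_fd[OF component(1)[OF assms], of k "Suc k"] by simp
qed

text \<open>Raising every divided power by one only replaces the weights \<open>gam k\<close> by
  \<open>gam (Suc k)\<close>. All of them have value 1, so the Gram matrix at v = 0 is still the
  identity.\<close>

lemma val0_ipd_f_tilde:
  assumes "m \<in> msegs d" "m' \<in> msegs d"
  shows "val0 (ipd (Suc d) (f_tilde m) (f_tilde m')) (of_bool (m = m'))"
proof -
  have "ipd (Suc d) (\<lambda>c. \<Sum>k\<le>d. 1 * fd (Suc k) (component m k) c) (\<lambda>c. \<Sum>k\<le>d. 1 * fd (Suc k) (component m' k) c)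
      = (\<Sum>k\<le>d. 1 * 1 * gam (Suc k) * ipd (d - k) (component m k) (component m' k))"
    by (rule ipd_sum_fd_diag) (use component assms in auto)
  then have "ipd (Suc d) (f_tilde m) (f_tilde m') = (\<Sum>k\<le>d. gam (Suc k) * ipd (d - k) (component m k) (component m' k))"
    by (simp add: f_tilde[OF assms(1)] f_tilde[OF assms(2)])
  moreover have "val0 (\<Sum>k\<le>d. gam (Suc k) * ipd (d - k) (component m k) (component m' k))
      (\<Sum>k\<le>d. 1 * (\<Sum>b\<in>msegs (d - k). comp_val m k b * comp_val m' k b))"
    by (intro val0_sum val0_mult val0_gam val0_ipd_component) (use assms in auto)
  ultimately show ?thesis using comp_val_orthonormal[OF assms] by simp
qed

lemma regular_f_tilde:
  assumes "m \<in> msegs d" "c \<in> msegs (Suc d)"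
  shows "regular (f_tilde m c)"
  using regular_of_norms[where I = "{()}" and a = "\<lambda>_. 1" and D = "\<lambda>_. Suc d" and z = "\<lambda>_. f_tilde m"]
    val0_ipd_f_tilde[OF assms(1,1)] assms(2) graded_laurent[OF graded_f_tilde[OF assms(1)]] by simp

definition ft_val :: "mseg \<Rightarrow> mseg \<Rightarrow> int" where
  "ft_val m c = value_at_0 (f_tilde m c)"

lemma val0_f_tilde: "m \<in> msegs d \<Longrightarrow> c \<in> msegs (Suc d) \<Longrightarrow> val0 (f_tilde m c) (ft_val m c)"
  unfolding ft_val_def by (rule regular_val0[OF regular_f_tilde])

lemma ft_val_orthonormal:
  assumes "m \<in> msegs d" "m' \<in> msegs d"
  shows "(\<Sum>c\<in>msegs (Suc d). ft_val m c * ft_val m' c) = of_bool (m = m')"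
proof -
  have "val0 (ipd (Suc d) (f_tilde m) (f_tilde m')) (\<Sum>c\<in>msegs (Suc d). ft_val m c * ft_val m' c)"
    by (rule val0_ipd) (rule val0_f_tilde[OF assms(1)], assumption, rule val0_f_tilde[OF assms(2)])
  then show ?thesis using val0_ipd_f_tilde[OF assms] val0_unique by blast
qed

definition succ_mseg :: "mseg \<Rightarrow> mseg" where
  "succ_mseg m = (SOME c. c \<in> msegs (Suc (len m)) \<and> ft_val m c \<noteq> 0)"

lemma succ_mseg:
  assumes "m \<in> msegs d"
  shows "succ_mseg m \<in> msegs (Suc d)" "(ft_val m (succ_mseg m))\<^sup>2 = 1"
    and "\<And>c. c \<in> msegs (Suc d) \<Longrightarrow> c \<noteq> succ_mseg m \<Longrightarrow> ft_val m c = 0"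
proof -
  have d: "len m = d" using assms by (simp add: msegs_def)
  have "(\<Sum>c\<in>msegs (Suc d). (ft_val m c)\<^sup>2) = 1"
    using ft_val_orthonormal[OF assms assms] by (simp add: power2_eq_square)
  with finite_msegs obtain b where b: "b \<in> msegs (Suc d)" "(ft_val m b)\<^sup>2 = 1"
    "\<And>a. a \<in> msegs (Suc d) \<Longrightarrow> a \<noteq> b \<Longrightarrow> ft_val m a = 0"
    by (rule sum_squares_eq_1[of "msegs (Suc d)" "ft_val m"]) blast
  have "ft_val m b \<noteq> 0" using b(2) by auto
  with b have "\<exists>c. c \<in> msegs (Suc d) \<and> ft_val m c \<noteq> 0" by blast
  from someI_ex[OF this] have "succ_mseg m \<in> msegs (Suc d)" "ft_val m (succ_mseg m) \<noteq> 0"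
    unfolding succ_mseg_def d by auto
  with b(3) have "succ_mseg m = b" by blast
  with b show "succ_mseg m \<in> msegs (Suc d)" "(ft_val m (succ_mseg m))\<^sup>2 = 1"
    and "\<And>c. c \<in> msegs (Suc d) \<Longrightarrow> c \<noteq> succ_mseg m \<Longrightarrow> ft_val m c = 0" by auto
qed

lemma sum_ft_val:
  assumes "m \<in> msegs d"
  shows "(\<Sum>c\<in>msegs (Suc d). ft_val m c * h c) = ft_val m (succ_mseg m) * h (succ_mseg m)"
proof -
  have "(\<Sum>c\<in>msegs (Suc d). ft_val m c * h c) = (\<Sum>c\<in>msegs (Suc d). if c = succ_mseg m then ft_val m c * h c else 0)"
    using succ_mseg(3)[OF assms] by (intro sum.cong) auto
  then show ?thesis using finite_msegs succ_mseg(1)[OF assms] by simp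
qed

text \<open>Two different rows of \<open>ft_val\<close> with their only nonzero entry in the same
  place would not be orthogonal.\<close>

lemma succ_mseg_inj: "inj_on succ_mseg (msegs d)"
proof (rule inj_onI, rule ccontr)
  fix m m' assume m: "m \<in> msegs d" "m' \<in> msegs d" "succ_mseg m = succ_mseg m'" "m \<noteq> m'"
  then have "ft_val m (succ_mseg m) * ft_val m' (succ_mseg m') = 0"
    using ft_val_orthonormal[OF m(1,2)] sum_ft_val[OF m(1), of "ft_val m'"] by simp
  then show False using succ_mseg(2)[OF m(1)] succ_mseg(2)[OF m(2)] by auto
qed

text \<open>The pairing of \<open>f_tilde m\<close> with the PBW element of
  \<open>succ_mseg m\<close> has value 1 or -1. Expanded into components, only index pairs (k, k+1)
  contribute, and such a pair is nonzero at v = 0 only if both indices are the respective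
  depths.\<close>

lemma depth_succ_mseg:
  assumes m: "m \<in> msegs d"
  shows "depth (succ_mseg m) = Suc (depth m)"
proof -
  note succ_mseg = succ_mseg(1,2)[OF m]
  define r where "r k j = (\<Sum>b\<in>msegs (d - k). comp_val m k b * comp_val (succ_mseg m) j b)" for k j
  have "ipd (Suc d) (f_tilde m) (ubasis (succ_mseg m)) = f_tilde m (succ_mseg m) * pbw_norm (succ_mseg m)"
    unfolding ipd_def ubasis_def
    by (subst sum.remove[OF finite_msegs succ_mseg(1)]) (auto intro!: sum.neutral)
  then have 1: "val0 (ipd (Suc d) (f_tilde m) (ubasis (succ_mseg m))) (ft_val m (succ_mseg m))"
    using val0_mult[OF val0_f_tilde[OF m succ_mseg(1)] val0_pbw_norm] by simp
  have "ipd (Suc d) (\<lambda>c. \<Sum>k\<le>d. 1 * fd (Suc k) (component m k) c) (\<lambda>c. \<Sum>j\<le>Suc d. 1 * fd j (component (succ_mseg m) j) c)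
    = (\<Sum>k\<le>d. \<Sum>j\<le>Suc d. 1 * 1 * (if Suc k = j then gam (Suc k) * ipd (d - k) (component m k) (component (succ_mseg m) j) else 0))"
    by (rule ipd_sum_fd[where d' = "\<lambda>j. Suc d - j"]) (use component m succ_mseg in auto)
  then have "ipd (Suc d) (f_tilde m) (ubasis (succ_mseg m))
    = (\<Sum>k\<le>d. \<Sum>j\<le>Suc d. if Suc k = j then gam (Suc k) * ipd (d - k) (component m k) (component (succ_mseg m) j) else 0)"
    using f_tilde[OF m] component(3)[OF succ_mseg(1)] by simp
  moreover have "val0 (\<Sum>k\<le>d. \<Sum>j\<le>Suc d. if Suc k = j then gam (Suc k) * ipd (d - k) (component m k) (component (succ_mseg m) j) else 0)
      (\<Sum>k\<le>d. \<Sum>j\<le>Suc d. if Suc k = j then 1 * r k j else 0)"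
  proof (intro val0_sum)
    fix k j assume "k \<in> {..d}" "j \<in> {..Suc d}"
    then show "val0 (if Suc k = j then gam (Suc k) * ipd (d - k) (component m k) (component (succ_mseg m) j) else 0)
        (if Suc k = j then 1 * r k j else 0)"
      unfolding r_def using val0_mult[OF val0_gam[of "Suc k"] val0_ipd_component[OF m succ_mseg(1), of k "Suc k"]] by auto
  qed
  ultimately have "ft_val m (succ_mseg m) = (\<Sum>k\<le>d. \<Sum>j\<le>Suc d. if Suc k = j then 1 * r k j else 0)"
    using 1 val0_unique by simp
  moreover have "ft_val m (succ_mseg m) \<noteq> 0" using succ_mseg by auto
  ultimately have "(\<Sum>k\<le>d. \<Sum>j\<le>Suc d. if Suc k = j then 1 * r k j else 0) \<noteq> 0" by simp
  then obtain k where k: "k \<le> d" "(\<Sum>j\<le>Suc d. if Suc k = j then 1 * r k j else 0) \<noteq> 0"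
    by (rule sum.not_neutral_contains_not_neutral) simp
  then have "r k (Suc k) \<noteq> 0" by (simp split: if_splits)
  then obtain b where b: "b \<in> msegs (d - k)" "comp_val m k b * comp_val (succ_mseg m) (Suc k) b \<noteq> 0"
    unfolding r_def by (rule sum.not_neutral_contains_not_neutral)
  then have "k = depth m" "Suc k = depth (succ_mseg m)"
    using depth(3)[OF m k(1) b(1)] depth(3)[OF succ_mseg(1), of "Suc k" b] k(1) by auto
  then show ?thesis by simp
qed

end

section \<open>The statistic epsilon, its equality with the depth, and the leading term of
  f_i\<close>

context adjacent_vertices
begin

definition SS :: "mseg \<Rightarrow> nat \<Rightarrow> int" where
  "SS m l = AA m l - int (xx m l)"

text \<open>S_l vanishes beyond the length of \<open>m\<close>, so a finite range suffices; its last
  index contributes the value 0, whence \<open>ep\<close> is nonnegative.\<close>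

definition ep :: "mseg \<Rightarrow> int" where
  "ep m = - Min (SS m ` {1..Suc (len m)})"

definition first :: "mseg \<Rightarrow> nat" where
  "first m = (LEAST l. 1 \<le> l \<and> SS m l = - ep m)"

lemma SS_Suc: "SS m l = SS m (Suc l) + int (yy m l) - int (xx m l)"
  by (simp add: SS_def AA_eq[of m l])

lemma SS_large: "len m < l \<Longrightarrow> SS m l = 0"
  by (simp add: SS_def AA_large xx_large)

lemma SS_up:
  "1 \<le> l \<Longrightarrow> can_up l m \<Longrightarrow> 1 \<le> k \<Longrightarrow> SS (up l m) k = SS m k - 2 * of_bool (k < l) - of_bool (k = l)"
  by (simp add: SS_def AA_up xx_up)

lemma SS_dn:
  "1 \<le> l \<Longrightarrow> 0 < xx m l \<Longrightarrow> 1 \<le> k \<Longrightarrow> SS (dn l m) k = SS m k + 2 * of_bool (k < l) + of_bool (k = l)"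
  by (auto simp: SS_def AA_dn xx_dn of_nat_diff)

lemma ep_attained: "\<exists>l\<ge>1. SS m l = - ep m"
proof -
  have "Min (SS m ` {1..Suc (len m)}) \<in> SS m ` {1..Suc (len m)}"
    by (intro Min_in) auto
  then show ?thesis by (fastforce simp: ep_def)
qed

lemma ep_ge: assumes "1 \<le> l" shows "- ep m \<le> SS m l"
proof -
  have le: "- ep m \<le> SS m k" if "k \<in> {1..Suc (len m)}" for k
  proof -
    have "Min (SS m ` {1..Suc (len m)}) \<le> SS m k"
      using that by (intro Min_le) auto
    then show ?thesis by (simp only: ep_def)
  qed
  show ?thesis
  proof (cases "l \<le> Suc (len m)")
    case False
    then have "SS m l = SS m (Suc (len m))" by (simp add: SS_large)
    then show ?thesis using le[of "Suc (len m)"] by simp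
  qed (use le assms in auto)
qed

lemma ep_eqI: "(\<And>l. 1 \<le> l \<Longrightarrow> - e \<le> SS m l) \<Longrightarrow> 1 \<le> k \<Longrightarrow> SS m k = - e \<Longrightarrow> ep m = e"
  using ep_ge[of k m] ep_attained[of m] by fastforce

lemma ep_nonneg: "0 \<le> ep m"
  using ep_ge[of "Suc (len m)" m] by (simp add: SS_large)

lemma first_eqI:
  "1 \<le> l \<Longrightarrow> SS m l = - ep m \<Longrightarrow> (\<And>k. 1 \<le> k \<Longrightarrow> k < l \<Longrightarrow> SS m k \<noteq> - ep m) \<Longrightarrow> first m = l"
  unfolding first_def by (rule Least_equality) (auto simp: not_less[symmetric])

text \<open>Removing the longest possible segment at which the minimum is attained inverts the
  combinatorial Kashiwara operator.\<close>

lemma ep_pos_preimage: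
  assumes m: "m \<in> msegs (Suc d)" and pos: "0 < ep m"
  obtains m' where "m' \<in> msegs d" "up (first m') m' = m" "ep m' = ep m - 1"
proof -
  define P where "P l \<longleftrightarrow> 1 \<le> l \<and> SS m l = - ep m" for l
  \<comment> \<open>For positive \<open>ep\<close> the minimum is negative and cannot be attained
    where S vanishes, so a greatest index exists.\<close>
  have bound: "l \<le> len m" if "P l" for l
    using that pos SS_large[of m l] by (force simp: P_def not_le[symmetric])
  define l where "l = Greatest P"
  have "\<exists>l. P l" using ep_attained unfolding P_def by blast
  then have l: "P l" and great: "\<And>k. P k \<Longrightarrow> k \<le> l"
    unfolding l_def using bound by (metis GreatestI_nat, metis Greatest_le_nat)
  then have l1: "1 \<le> l" "SS m l = - ep m" by (auto simp: P_def)
  have gt: "- ep m < SS m k" if "l < k" for k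
    using great[of k] ep_ge[of k m] that l1 by (fastforce simp: P_def)
  \<comment> \<open>S_l < S_(l+1) together with S_l = S_(l+1) + y_l - x_l forces x_l > y_l.\<close>
  have x: "0 < xx m l"
    using SS_Suc[of m l] gt[of "Suc l"] l1 by (cases "xx m l") auto
  define m' where "m' = dn l m"
  have SS': "SS m' k = SS m k + 2 * of_bool (k < l) + of_bool (k = l)" if "1 \<le> k" for k
    unfolding m'_def using l1 x that by (rule_tac SS_dn) auto
  \<comment> \<open>Values before l rise by 2, the value at l by 1, and later values were already
    larger than the minimum. So the new minimum is larger by one and is attained at l, but not
    before.\<close>
  have ep': "ep m' = ep m - 1"
  proof (rule ep_eqI)
    show "- (ep m - 1) \<le> SS m' k" if "1 \<le> k" for k
      using SS'[OF that] ep_ge[OF that, of m] gt[of k] by (cases k l rule: linorder_cases) auto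
    show "SS m' l = - (ep m - 1)" using SS'[OF l1(1)] l1(2) by simp
  qed (rule l1)
  have "first m' = l"
  proof (rule first_eqI)
    show "SS m' l = - ep m'" using SS'[OF l1(1)] l1(2) ep' by simp
    show "SS m' k \<noteq> - ep m'" if "1 \<le> k" "k < l" for k
      using SS'[OF that(1)] ep_ge[OF that(1), of m] that(2) ep' by simp
  qed (rule l1)
  moreover have "up l m' = m" unfolding m'_def using l1(1) x by (rule up_dn)
  moreover have "m' \<in> msegs d"
    using m len_dn[OF l1(1) x] valid_dn[OF l1(1) x] by (simp add: msegs_def m'_def)
  ultimately show ?thesis using that ep' by blast
qed

lemma val0_powi_nonneg: "0 \<le> a \<Longrightarrow> val0 (vv powi a) (of_bool (a = 0))"
  using val0_power[OF val0_vv, of "nat a"] by (auto simp: power_int_def power_0_left)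

text \<open>If m = \<open>up l c\<close>, the exponent in \<open>el\<close> is S_l(c) = S_l(m) + 1,
  which is at least 1 - ep m. Hence the pole of e' at a PBW element has order at most ep m -
  1.\<close>

lemma regular_ee_ubasis:
  shows "regular (vv powi (ep m - 1) * ee (ubasis m) c)"
proof -
  have "\<exists>r. val0 (vv powi (ep m - 1) * el l (ubasis m) c) r" if "1 \<le> l" for l
  proof (cases "can_up l c \<and> up l c = m")
    case True
    then have "SS m l = SS c l - 1" using SS_up[of l c l] that by auto
    then have "ep m + SS m l = (ep m - 1) + SS c l" by simp
    then have "vv powi (ep m + SS m l) = vv powi (ep m - 1) * vv powi SS c l"
      by (simp only: power_int_add vv_neq_0 simp_thms)
    then have "vv powi (ep m - 1) * el l (ubasis m) c = vv powi (ep m + SS m l) * bet c l"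
      using True by (simp add: el_def ubasis_def SS_def[symmetric] mult.assoc)
    moreover have "\<exists>r. val0 (bet c l) r"
      unfolding bet_def using val0_diff[OF val0_1 val0_power[OF val0_vv]] val0_1 by (metis (full_types))
    then obtain r where "val0 (bet c l) r" ..
    moreover have "0 \<le> ep m + SS m l" using ep_ge[OF that, of m] by simp
    ultimately show ?thesis using val0_mult[OF val0_powi_nonneg] by metis
  next
    case False
    then have "el l (ubasis m) c = 0" by (auto simp: el_def ubasis_def bet_eq_0)
    then show ?thesis by (auto intro: exI[of _ 0])
  qed
  then obtain r where "\<And>l. 1 \<le> l \<Longrightarrow> val0 (vv powi (ep m - 1) * el l (ubasis m) c) (r l)"
    by metis
  then have "val0 (\<Sum>l = 1..Suc (len c). vv powi (ep m - 1) * el l (ubasis m) c) (\<Sum>l = 1..Suc (len c). r l)"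
    by (intro val0_sum) auto
  then show ?thesis unfolding ee_def sum_distrib_left by (rule val0_regular)
qed

lemma ipd_scale: "ipd d (\<lambda>c. a * X c) (\<lambda>c. b * Y c) = a * b * ipd d X Y"
  unfolding ipd_def sum_distrib_left by (intro sum.cong refl) (simp only: mult_ac)

text \<open>Since e' sends f^((k+1)) x_(k+1) to v^(-k) f^((k)) x_(k+1), regularity of v^(ep - 1) e'
  makes v^(ep - 1 - k) x_(k+1) regular. If k + 1 > ep, then x_(k+1) vanishes at v = 0, so k + 1 is
  not the depth.\<close>

lemma depth_le_ep:
  assumes m: "m \<in> msegs d"
  shows "int (depth m) \<le> ep m"
proof (rule ccontr)
  assume "\<not> int (depth m) \<le> ep m"
  then have less: "ep m < int (depth m)" by simp
  with ep_nonneg[of m] obtain k where k: "depth m = Suc k" by (cases "depth m") auto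
  with depth(1)[OF m] obtain d' where d: "d = Suc d'" and kd: "k \<le> d'" by (cases d) auto
  \<comment> \<open>The component of index 0 is annihilated by e', so the indices are shifted by
    one.\<close>
  define x where "x j = component m (Suc j)" for j
  have x: "graded (d' - j) (x j)" "ee (x j) = (\<lambda>c. 0)" if "j \<le> d'" for j
    using component(1,2)[OF m, of "Suc j"] that by (simp_all add: x_def d)
  define W where "W = (\<lambda>c. vv powi (ep m - 1) * ee (ubasis m) c)"
  have e: "ee (fd (Suc j) (x j)) = (\<lambda>c. vv powi (- int j) * fd j (x j) c)" if "j \<le> d'" for j
    using ee_fd[OF x(2)[OF that]] .
  have "ee (ubasis m) = ee (\<lambda>c. component m 0 c + (\<Sum>j\<le>d'. fd (Suc j) (x j) c))"
    unfolding component(3)[OF m] d by (simp only: sum.atMost_Suc_shift fd_0 x_def)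
  also have "\<dots> = (\<lambda>c. \<Sum>j\<le>d'. vv powi (- int j) * fd j (x j) c)"
    using component(2)[OF m, of 0] e by (simp add: lin_add[OF lin_ee] lin_sum[OF lin_ee] cong: sum.cong_simp)
  finally have W: "W = (\<lambda>c. \<Sum>j\<le>d'. vv powi (ep m - 1 - int j) * fd j (x j) c)"
    unfolding W_def by (simp add: sum_distrib_left mult.assoc[symmetric] flip: power_int_add)
  have "ipd d' W W = (\<Sum>j\<le>d'. vv powi (ep m - 1 - int j) * vv powi (ep m - 1 - int j) * gam j
      * ipd (d' - j) (x j) (x j))"
    unfolding W by (rule ipd_sum_fd_diag) (use x in auto)
  also have "\<dots> = (\<Sum>j\<le>d'. gam j * ipd (d' - j) (\<lambda>c. vv powi (ep m - 1 - int j) * x j c)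
      (\<lambda>c. vv powi (ep m - 1 - int j) * x j c))"
    unfolding ipd_scale by (simp only: mult_ac)
  finally have 1: "val0 (\<Sum>j\<le>d'. gam j * ipd (d' - j) (\<lambda>c. vv powi (ep m - 1 - int j) * x j c)
      (\<lambda>c. vv powi (ep m - 1 - int j) * x j c)) (\<Sum>b\<in>msegs d'. value_at_0 (W b) * value_at_0 (W b))"
    using val0_ipd[of d' W "\<lambda>b. value_at_0 (W b)" W "\<lambda>b. value_at_0 (W b)"] regular_ee_ubasis[of m]
    by (simp add: W_def regular_val0)
  have reg: "regular (vv powi (ep m - 1 - int k) * x k b)" if "b \<in> msegs (d' - k)" for b
    by (rule regular_of_norms[OF 1]) (use that kd in \<open>auto simp: val0_gam graded_laurent[OF x(1)] laurent_mult laurent_powi\<close>)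
  have "comp_val m (depth m) b = 0" if "b \<in> msegs (d - depth m)" for b
  proof -
    have b: "b \<in> msegs (d' - k)" using that by (simp add: d k)
    have "0 < int (depth m) - ep m" using less by simp
    then have "val0 (vv powi (int (depth m) - ep m) * (vv powi (ep m - 1 - int k) * x k b))
        (0 * value_at_0 (vv powi (ep m - 1 - int k) * x k b))"
      using val0_mult[OF val0_powi_nonneg regular_val0[OF reg[OF b]], of "int (depth m) - ep m"] by simp
    moreover have "vv powi (int (depth m) - ep m) * (vv powi (ep m - 1 - int k) * x k b) = component m (depth m) b"
      by (simp add: k x_def mult.assoc[symmetric] flip: power_int_add)
    ultimately have "val0 (component m (depth m) b) 0" by simp
    then show ?thesis unfolding comp_val_def by (rule value_at_0_eq)
  qed
  then show False using depth(2)[OF m] by simp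
qed

text \<open>The sum of epsilon in degree d + 1 is at most the sum of epsilon + 1 in degree d, since
  \<open>g\<close> is injective where epsilon is positive. By induction the latter is the sum of the
  depths over the image of \<open>succ_mseg\<close>, hence at most the sum of all depths in degree d
  + 1. With \<open>depth_le_ep\<close> in every term, equality holds everywhere.\<close>

lemma depth_eq_ep: "m \<in> msegs d \<Longrightarrow> int (depth m) = ep m"
proof (induction d arbitrary: m)
  case 0
  then have "ep m = 0" by (intro ep_eqI[of _ _ 1]) (auto simp: msegs_def SS_large)
  then show ?case using depth(1)[OF 0] by simp
next
  case (Suc d)
  have "\<exists>m'. m' \<in> msegs d \<and> up (first m') m' = m \<and> ep m' = ep m - 1" if "m \<in> msegs (Suc d)" "0 < ep m" for m
    using ep_pos_preimage[OF that] by metis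
  then obtain g where g: "\<And>m. m \<in> msegs (Suc d) \<Longrightarrow> 0 < ep m \<Longrightarrow>
      g m \<in> msegs d \<and> up (first (g m)) (g m) = m \<and> ep (g m) = ep m - 1"
    by metis
  define Q where "Q = {m \<in> msegs (Suc d). 0 < ep m}"
  have "(\<Sum>m\<in>msegs (Suc d). ep m) = (\<Sum>m\<in>Q. ep m)"
    unfolding Q_def by (rule sum.mono_neutral_right) (use finite_msegs ep_nonneg in \<open>auto simp: order.order_iff_strict\<close>)
  also have "\<dots> = (\<Sum>m\<in>Q. ep (g m) + 1)"
    using g by (intro sum.cong) (auto simp: Q_def)
  also have "\<dots> = (\<Sum>m\<in>g ` Q. ep m + 1)"
  proof -
    have "inj_on g Q" using g by (intro inj_onI) (metis (no_types, lifting) Q_def mem_Collect_eq)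
    then show ?thesis by (simp add: sum.reindex)
  qed
  also have "\<dots> \<le> (\<Sum>m\<in>msegs d. ep m + 1)"
    using g ep_nonneg finite_msegs by (intro sum_mono2) (auto simp: Q_def add_nonneg_nonneg)
  also have "\<dots> = (\<Sum>m\<in>msegs d. int (depth (succ_mseg m)))"
    using Suc.IH by (intro sum.cong refl) (simp add: depth_succ_mseg)
  also have "\<dots> = (\<Sum>c\<in>succ_mseg ` msegs d. int (depth c))"
    by (simp add: sum.reindex[OF succ_mseg_inj])
  also have "\<dots> \<le> (\<Sum>c\<in>msegs (Suc d). int (depth c))"
    using succ_mseg(1) finite_msegs by (intro sum_mono2) auto
  finally have le: "(\<Sum>c\<in>msegs (Suc d). ep c) \<le> (\<Sum>c\<in>msegs (Suc d). int (depth c))" .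
  show ?case
  proof (rule ccontr)
    assume "int (depth m) \<noteq> ep m"
    then have "int (depth m) < ep m" using depth_le_ep[OF Suc.prems] by simp
    then have "(\<Sum>c\<in>msegs (Suc d). int (depth c)) < (\<Sum>c\<in>msegs (Suc d). ep c)"
      using depth_le_ep Suc.prems finite_msegs by (intro sum_strict_mono_ex1) auto
    with le show False by simp
  qed
qed

text \<open>\<open>U\<close> is f applied to the PBW element, rescaled by the order of its pole. At
  v = 0 its coefficients \<open>u\<close> count indices and are nonnegative; its pairing with
  \<open>f_tilde m\<close> has value 1. The only surviving product of an entry 1 or -1 with an entry
  of \<open>u\<close> is therefore 1, which settles the sign and the shape of the successor.\<close>

lemma succ_mseg_eq_up_aux:
  assumes m: "m \<in> msegs d"
  shows "ft_val m (succ_mseg m) = 1" "\<exists>l\<ge>1. can_up l m \<and> SS m l = - ep m \<and> succ_mseg m = up l m"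
proof -
  define K where "K = depth m"
  have ep: "ep m = int K" using depth_eq_ep[OF m] by (simp add: K_def)
  define U where "U = (\<lambda>c. vv powi int K * ff (ubasis m) c)"
  define good where "good c l \<longleftrightarrow> 0 < xx c l \<and> dn l c = m \<and> SS m l = - ep m" for c l
  define u where "u c = (\<Sum>l = 1..len c. of_bool (good c l) :: int)" for c
  \<comment> \<open>The coefficient v^(K + A_l) [x_l + 1] equals v^(K + S_l) times a factor of value
    1, so only indices with minimal S_l survive.\<close>
  have "val0 (vv powi int K * fl l (ubasis m) c) (of_bool (good c l))" if l: "1 \<le> l" for l c
  proof (cases "0 < xx c l \<and> dn l c = m")
    case True
    then have "AA m l = AA c l" "xx c l = Suc (xx m l)"
      using l by (auto simp: AA_dn xx_dn)
    moreover from this have "int K + AA c l = (ep m + SS m l) + int (xx m l)"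
      by (simp add: SS_def ep)
    then have "vv powi int K * vv powi AA c l = vv powi (ep m + SS m l) * vv powi int (xx m l)"
      by (subst (1 2) power_int_add[symmetric]) simp_all
    ultimately have "vv powi int K * fl l (ubasis m) c
        = vv powi (ep m + SS m l) * (vv powi int (xx m l) * qint (int (Suc (xx m l))))"
      using True by (simp only: fl_def ubasis_def if_True mult_1_right mult.assoc[symmetric] simp_thms)
    moreover have "0 \<le> ep m + SS m l" using ep_ge[OF l, of m] by simp
    ultimately have "val0 (vv powi int K * fl l (ubasis m) c) (of_bool (ep m + SS m l = 0) * 1)"
      using val0_mult[OF val0_powi_nonneg val0_qint] by simp
    moreover have "ep m + SS m l = 0 \<longleftrightarrow> good c l" using True by (auto simp: good_def)
    ultimately show ?thesis by simp
  next
    case False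
    then have "fl l (ubasis m) c = 0" by (auto simp: fl_def ubasis_def)
    then show ?thesis using False by (auto simp: good_def)
  qed
  then have U_val: "val0 (U c) (u c)" for c
    unfolding U_def u_def ff_def sum_distrib_left by (intro val0_sum) auto
  \<comment> \<open>f maps f^((k)) x_k to [k+1] f^((k+1)) x_k, and v^K [k+1] has leading term v^(K -
    k).\<close>
  define q where "q k = vv powi (int K - int k)" for k
  have "ff (ubasis m) = (\<lambda>c. \<Sum>k\<le>d. qint (int (Suc k)) * fd (Suc k) (component m k) c)"
    unfolding component(3)[OF m] by (simp only: lin_sum[OF lin_ff] ff_fd)
  then have U: "U = (\<lambda>c. \<Sum>k\<le>d. (vv powi int K * qint (int (Suc k))) * fd (Suc k) (component m k) c)"
    unfolding U_def by (simp only: sum_distrib_left mult.assoc)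
  have qg: "vv powi int K * qint (int (Suc k)) * gam (Suc k) = q k * gam k" for k
  proof -
    have "vv powi int K * qint (int (Suc k)) * gam (Suc k) = vv powi int K * (gam (Suc k) * qint (int (Suc k)))"
      by (simp only: mult_ac)
    also have "\<dots> = (vv powi int K * vv powi (- int k)) * gam k"
      unfolding gam_Suc by (simp only: mult_ac)
    also have "vv powi int K * vv powi (- int k) = q k"
      unfolding q_def by (subst power_int_add[symmetric]) auto
    finally show ?thesis .
  qed
  have "ipd (Suc d) U U = (\<Sum>k\<le>d. (vv powi int K * qint (int (Suc k))) * (vv powi int K * qint (int (Suc k)))
      * gam (Suc k) * ipd (d - k) (component m k) (component m k))"
    unfolding U by (rule ipd_sum_fd_diag) (use component m in auto)
  \<comment> \<open>The powers of v go into the vectors, so that the weights v^k [k+1]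
    \<open>gam k\<close> have value 1 as \<open>regular_of_norms\<close> requires.\<close>
  also have "\<dots> = (\<Sum>k\<le>d. (vv powi int k * qint (int (Suc k)) * gam k)
      * ipd (d - k) (\<lambda>c. q k * component m k c) (\<lambda>c. q k * component m k c))"
  proof (intro sum.cong refl)
    fix k
    have "vv powi int K = vv powi int k * q k"
      unfolding q_def by (subst power_int_add[symmetric]) auto
    then have "(vv powi int K * qint (int (Suc k))) * (q k * gam k)
        = (vv powi int k * qint (int (Suc k)) * gam k) * (q k * q k)"
      by (simp only: mult_ac)
    then show "(vv powi int K * qint (int (Suc k))) * (vv powi int K * qint (int (Suc k)))
      * gam (Suc k) * ipd (d - k) (component m k) (component m k)
      = (vv powi int k * qint (int (Suc k)) * gam k)
      * ipd (d - k) (\<lambda>c. q k * component m k c) (\<lambda>c. q k * component m k c)"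
      unfolding ipd_scale mult.assoc[of "vv powi int K * qint (int (Suc k))"] qg
      by (simp only: mult.assoc[symmetric])
  qed
  finally have 1: "val0 (\<Sum>k\<le>d. (vv powi int k * qint (int (Suc k)) * gam k)
      * ipd (d - k) (\<lambda>c. q k * component m k c) (\<lambda>c. q k * component m k c)) (\<Sum>c\<in>msegs (Suc d). u c * u c)"
    using val0_ipd[of "Suc d" U u U u] U_val by simp
  \<comment> \<open>For k > K the factor \<open>q k\<close> has a pole, so this says that the
    component of index k vanishes to order at least k - K. The next pairing relies on it.\<close>
  have qr: "regular (q k * component m k b)" if "k \<le> d" "b \<in> msegs (d - k)" for k b
    by (rule regular_of_norms[OF 1])
      (use that component m val0_mult[OF val0_qint val0_gam] in
        \<open>auto simp: graded_laurent[OF component(1)[OF m]] laurent_mult laurent_powi q_def\<close>)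
  have "ipd (Suc d) U (\<lambda>c. \<Sum>k\<le>d. 1 * fd (Suc k) (component m k) c)
      = (\<Sum>k\<le>d. (vv powi int K * qint (int (Suc k))) * 1 * gam (Suc k) * ipd (d - k) (component m k) (component m k))"
    unfolding U by (rule ipd_sum_fd_diag) (use component m in auto)
  also have "\<dots> = (\<Sum>k\<le>d. gam k * ipd (d - k) (\<lambda>c. q k * component m k c) (component m k))"
  proof (intro sum.cong refl)
    fix k
    show "(vv powi int K * qint (int (Suc k))) * 1 * gam (Suc k) * ipd (d - k) (component m k) (component m k)
        = gam k * ipd (d - k) (\<lambda>c. q k * component m k c) (component m k)"
      using ipd_scale[of "d - k" "q k" "component m k" 1 "component m k"] qg[of k] by (simp add: mult_ac)
  qed
  finally have "ipd (Suc d) U (f_tilde m) = (\<Sum>k\<le>d. gam k * ipd (d - k) (\<lambda>c. q k * component m k c) (component m k))"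
    by (simp add: f_tilde[OF m])
  moreover have "val0 (\<Sum>k\<le>d. gam k * ipd (d - k) (\<lambda>c. q k * component m k c) (component m k))
      (\<Sum>k\<le>d. 1 * (\<Sum>b\<in>msegs (d - k). value_at_0 (q k * component m k b) * comp_val m k b))"
    by (intro val0_sum val0_mult val0_gam val0_ipd) (auto intro: regular_val0 qr val0_component[OF m])
  \<comment> \<open>For k = K the factor \<open>q k\<close> is 1 and the component has length 1 at v
    = 0; every other component vanishes there.\<close>
  moreover have "(\<Sum>k\<le>d. 1 * (\<Sum>b\<in>msegs (d - k). value_at_0 (q k * component m k b) * comp_val m k b)) = 1"
  proof -
    have "(\<Sum>b\<in>msegs (d - k). value_at_0 (q k * component m k b) * comp_val m k b) = of_bool (k = K)" if "k \<le> d" for k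
    proof (cases "k = K")
      case True
      then have "value_at_0 (q k * component m k b) = comp_val m k b" for b by (simp add: q_def comp_val_def)
      then show ?thesis using depth(2)[OF m] True by (simp add: K_def power2_eq_square)
    next
      case False
      then have "comp_val m k b = 0" if "b \<in> msegs (d - k)" for b
        using depth(3)[OF m \<open>k \<le> d\<close> that] by (auto simp: K_def)
      then show ?thesis using False by simp
    qed
    then have "(\<Sum>k\<le>d. 1 * (\<Sum>b\<in>msegs (d - k). value_at_0 (q k * component m k b) * comp_val m k b))
        = (\<Sum>k\<le>d. if k = K then 1 else 0)"
      by (intro sum.cong refl) auto
    then show ?thesis using depth(1)[OF m] by (simp add: K_def)
  qed
  ultimately have "val0 (ipd (Suc d) U (f_tilde m)) 1" by simp
  moreover have "val0 (ipd (Suc d) U (f_tilde m)) (\<Sum>c\<in>msegs (Suc d). u c * ft_val m c)"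
    by (intro val0_ipd U_val val0_f_tilde[OF m])
  ultimately have "(\<Sum>c\<in>msegs (Suc d). u c * ft_val m c) = 1" by (rule val0_unique[symmetric])
  then have prod: "ft_val m (succ_mseg m) * u (succ_mseg m) = 1"
    using sum_ft_val[OF m, of u] by (simp add: mult.commute)
  moreover have "0 \<le> u (succ_mseg m)" unfolding u_def by (intro sum_nonneg) simp
  ultimately show "ft_val m (succ_mseg m) = 1" by (auto simp: zmult_eq_1_iff)
  have "u (succ_mseg m) \<noteq> 0" using prod by auto
  then obtain l where "l \<in> {1..len (succ_mseg m)}" "(of_bool (good (succ_mseg m) l) :: int) \<noteq> 0"
    unfolding u_def by (rule sum.not_neutral_contains_not_neutral)
  then have "1 \<le> l" "good (succ_mseg m) l" by auto
  then show "\<exists>l\<ge>1. can_up l m \<and> SS m l = - ep m \<and> succ_mseg m = up l m"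
    unfolding good_def using can_up_dn[of l "succ_mseg m"] up_dn[of l "succ_mseg m"] by metis
qed

text \<open>The depth, hence epsilon, grows by exactly one. Had the minimum been attained at some k
  < l, then S_k would drop by 2 and epsilon would grow by 2.\<close>

lemma succ_mseg_eq_up:
  assumes m: "m \<in> msegs d"
  shows "succ_mseg m = up (first m) m"
proof -
  obtain l where l: "1 \<le> l" "can_up l m" "SS m l = - ep m" "succ_mseg m = up l m"
    using succ_mseg_eq_up_aux(2)[OF m] by blast
  have ep: "ep (succ_mseg m) = ep m + 1"
    using depth_eq_ep[OF succ_mseg(1)[OF m]] depth_eq_ep[OF m] depth_succ_mseg[OF m] by simp
  have "first m = l"
  proof (rule first_eqI)
    fix k assume k: "1 \<le> k" "k < l"
    show "SS m k \<noteq> - ep m"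
      using SS_up[OF l(1,2) k(1)] ep_ge[OF k(1), of "succ_mseg m"] k(2) l(4) ep by auto
  qed (use l in auto)
  with l show ?thesis by simp
qed

lemma f_tilde_congruent:
  assumes m: "m \<in> msegs d"
  obtains P where "f_tilde m c - ubasis (up (first m) m) c = vv * ev P"
proof (cases "c \<in> msegs (Suc d)")
  case True
  have "val0 (ubasis (succ_mseg m) c) (of_bool (c = succ_mseg m))" by (simp add: ubasis_def)
  then have "val0 (f_tilde m c - ubasis (succ_mseg m) c) (ft_val m c - of_bool (c = succ_mseg m))"
    by (intro val0_diff val0_f_tilde[OF m True])
  moreover have "ft_val m c - of_bool (c = succ_mseg m) = 0"
    using succ_mseg(3)[OF m True] succ_mseg_eq_up_aux(1)[OF m] by auto
  moreover have "laurent (f_tilde m c - ubasis (succ_mseg m) c)"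
    by (intro laurent_diff graded_laurent[OF graded_f_tilde[OF m]]) (simp add: ubasis_def)
  ultimately obtain P where P: "f_tilde m c - ubasis (succ_mseg m) c = ev P" "coeff P 0 = 0"
    using laurent_val0_ev by metis
  then obtain P' where "P = pCons 0 P'" by (cases P) auto
  with P that show ?thesis by (simp add: succ_mseg_eq_up[OF m])
next
  case False
  then have "f_tilde m c = 0" "ubasis (succ_mseg m) c = 0"
    using graded_eq_0[OF graded_f_tilde[OF m]] succ_mseg(1)[OF m] by (auto simp: ubasis_def)
  then show ?thesis using that[of 0] by (simp add: succ_mseg_eq_up[OF m])
qed

end

section \<open>Representations over a finite field\<close>

lemma Idx_iff: "(s, r, j) \<in> Idx m \<longleftrightarrow> r < count m s \<and> j < fst s"
  by (auto simp: Idx_def simp flip: count_greater_zero_iff)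

lemma finite_Idx [simp]: "finite (Idx m)"
proof -
  have "Idx m = (SIGMA s:set_mset m. {..<count m s} \<times> {..<fst s})"
    by (auto simp: Idx_def)
  then show ?thesis by simp
qed

lemma vertex_simp: "vertex n ((l, h), r, j) = nat ((int h - int j) mod int n)"
  by (simp add: vertex_def)

locale finite_field = field R for R :: "nat ring" (structure) +
  assumes finite_carrier: "finite (carrier R)"
begin

declare split_paired_All [simp del] split_paired_Ex [simp del]

definition unit :: "idx \<Rightarrow> idx \<Rightarrow> nat" where
  "unit x = (\<lambda>y. if y = x then \<one> else \<zero>)"

lemma VecI: "(\<And>x. x \<in> Idx m \<Longrightarrow> f x \<in> carrier R) \<Longrightarrow> (\<And>x. x \<notin> Idx m \<Longrightarrow> f x = \<zero>) \<Longrightarrow> f \<in> Vec R m"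
  by (simp add: Vec_def)

lemma Vec_closed: "f \<in> Vec R m \<Longrightarrow> f x \<in> carrier R"
  unfolding Vec_def by (cases "x \<in> Idx m") (blast, metis (mono_tags, lifting) mem_Collect_eq zero_closed)

lemma Vec_outside: "f \<in> Vec R m \<Longrightarrow> x \<notin> Idx m \<Longrightarrow> f x = \<zero>"
  unfolding Vec_def by blast

lemma vzero_Vec [simp]: "vzero R \<in> Vec R m"
  by (simp add: Vec_def vzero_def)

lemma vadd_Vec [simp]: "f \<in> Vec R m \<Longrightarrow> g \<in> Vec R m \<Longrightarrow> vadd R f g \<in> Vec R m"
  by (rule VecI) (simp_all add: vadd_def Vec_outside Vec_closed[of f] Vec_closed[of g])

lemma vsmult_Vec [simp]: "a \<in> carrier R \<Longrightarrow> f \<in> Vec R m \<Longrightarrow> vsmult R a f \<in> Vec R m"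
  by (rule VecI) (simp_all add: vsmult_def Vec_outside Vec_closed[of f])

lemma Xop_Vec [simp]: "f \<in> Vec R m \<Longrightarrow> Xop R m f \<in> Vec R m"
  by (rule VecI) (auto simp: Xop_def Vec_closed[of f] split: prod.splits)

lemma unit_Vec [simp]: "x \<in> Idx m \<Longrightarrow> unit x \<in> Vec R m"
  by (rule VecI) (auto simp: unit_def)

lemma vsmult_zero: "f \<in> Vec R m \<Longrightarrow> vsmult R \<zero> f = vzero R"
  by (simp add: vsmult_def vzero_def Vec_closed[of f])

lemma vadd_zero: "f \<in> Vec R m \<Longrightarrow> vadd R f (vzero R) = f"
  by (simp add: vadd_def vzero_def Vec_closed[of f])

text \<open>Induction on the support. The condition \<open>f x = \<zero>\<close> in the step lets
  facts about the coordinates of the sum pass to \<open>f\<close> and \<open>x\<close>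
  separately.\<close>

lemma Vec_induct [consumes 1, case_names zero step]:
  assumes "f \<in> Vec R m" and "P (vzero R)"
    and step: "\<And>f x a. f \<in> Vec R m \<Longrightarrow> P f \<Longrightarrow> x \<in> Idx m \<Longrightarrow> f x = \<zero> \<Longrightarrow> a \<in> carrier R \<Longrightarrow> a \<noteq> \<zero>
      \<Longrightarrow> P (vadd R (vsmult R a (unit x)) f)"
  shows "P f"
proof -
  have "finite {x. f x \<noteq> \<zero>}"
    using Vec_outside[OF assms(1)] by (intro finite_subset[OF _ finite_Idx[of m]]) auto
  then show ?thesis using assms(1)
  proof (induction "{x. f x \<noteq> \<zero>}" arbitrary: f rule: finite_induct)
    case empty
    then have "f = vzero R" by (auto simp: vzero_def)
    then show ?case using assms(2) by simp
  next
    case (insert x S)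
    define g where "g = f(x := \<zero>)"
    have S: "S = {x. g x \<noteq> \<zero>}" using insert.hyps by (auto simp: g_def)
    have x: "f x \<noteq> \<zero>" using insert.hyps(4) by auto
    then have "x \<in> Idx m" using Vec_outside[OF insert.prems] by blast
    moreover have g: "g \<in> Vec R m" using Vec_closed[OF insert.prems] Vec_outside[OF insert.prems] by (auto simp: g_def intro!: VecI)
    moreover have "f = vadd R (vsmult R (f x) (unit x)) g"
      by (rule ext) (simp add: vadd_def vsmult_def unit_def g_def Vec_closed[OF insert.prems])
    ultimately show ?case
      using step[of g x "f x"] insert.hyps(3)[OF S g] x Vec_closed[OF insert.prems] by (simp add: g_def)
  qed
qed

lemma finite_Vec: "finite (Vec R m)"
proof (rule finite_subset)
  show "Vec R m \<subseteq> (\<lambda>f x. if x \<in> Idx m then f x else \<zero>) ` (Idx m \<rightarrow>\<^sub>E carrier R)"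
  proof
    fix f assume f: "f \<in> Vec R m"
    then have "f = (\<lambda>x. if x \<in> Idx m then restrict f (Idx m) x else \<zero>)"
      by (auto simp: Vec_outside)
    with Vec_closed[OF f] show "f \<in> (\<lambda>f x. if x \<in> Idx m then f x else \<zero>) ` (Idx m \<rightarrow>\<^sub>E carrier R)"
      by (intro image_eqI[of _ _ "restrict f (Idx m)"]) auto
  qed
qed (intro finite_imageI finite_PiE finite_Idx finite_carrier)

lemma card_supported:
  assumes "A \<subseteq> Idx m"
  shows "card {f \<in> Vec R m. \<forall>x. f x \<noteq> \<zero> \<longrightarrow> x \<in> A} = card (carrier R) ^ card A"
proof -
  have A: "finite A" using finite_subset[OF assms finite_Idx] .
  have "bij_betw (\<lambda>f x. if x \<in> A then f x else \<zero>) (A \<rightarrow>\<^sub>E carrier R)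
      {f \<in> Vec R m. \<forall>x. f x \<noteq> \<zero> \<longrightarrow> x \<in> A}"
  proof (rule bij_betw_byWitness[where f' = "\<lambda>f. restrict f A"])
    show "(\<lambda>f x. if x \<in> A then f x else \<zero>) ` (A \<rightarrow>\<^sub>E carrier R)
        \<subseteq> {f \<in> Vec R m. \<forall>x. f x \<noteq> \<zero> \<longrightarrow> x \<in> A}"
      using assms by (auto intro!: VecI split: if_splits)
    show "\<forall>f\<in>{f \<in> Vec R m. \<forall>x. f x \<noteq> \<zero> \<longrightarrow> x \<in> A}.
        (\<lambda>x. if x \<in> A then restrict f A x else \<zero>) = f"
      by (clarsimp simp: fun_eq_iff) metis
    show "(\<lambda>f. restrict f A) ` {f \<in> Vec R m. \<forall>x. f x \<noteq> \<zero> \<longrightarrow> x \<in> A} \<subseteq> A \<rightarrow>\<^sub>E carrier R"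
      using Vec_closed by auto
  qed (auto simp: fun_eq_iff PiE_def extensional_def)
  then have "card {f \<in> Vec R m. \<forall>x. f x \<noteq> \<zero> \<longrightarrow> x \<in> A} = card (A \<rightarrow>\<^sub>E carrier R)"
    by (rule bij_betw_same_card[symmetric])
  then show ?thesis using A by (simp add: card_PiE)
qed

lemma card_carrier: "1 < card (carrier R)"
proof -
  have "card {\<zero>, \<one>} \<le> card (carrier R)"
    using finite_carrier by (intro card_mono) auto
  then show ?thesis by simp
qed

lemma morphD:
  assumes "morph R n b c \<phi>"
  shows "\<And>f. f \<in> Vec R b \<Longrightarrow> \<phi> f \<in> Vec R c"
    and "\<And>f g. f \<in> Vec R b \<Longrightarrow> g \<in> Vec R b \<Longrightarrow> \<phi> (vadd R f g) = vadd R (\<phi> f) (\<phi> g)"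
    and "\<And>a f. a \<in> carrier R \<Longrightarrow> f \<in> Vec R b \<Longrightarrow> \<phi> (vsmult R a f) = vsmult R a (\<phi> f)"
    and "\<And>t f. f \<in> Vec R b \<Longrightarrow> homog R n t f \<Longrightarrow> homog R n t (\<phi> f)"
    and "\<And>f. f \<in> Vec R b \<Longrightarrow> \<phi> (Xop R b f) = Xop R c (\<phi> f)"
  using assms unfolding morph_def by blast+

lemma morph_zero: "morph R n b c \<phi> \<Longrightarrow> \<phi> (vzero R) = vzero R"
  using morphD(1,3)[of n b c \<phi>] vsmult_zero[of "vzero R" b] vsmult_zero[of "\<phi> (vzero R)" c]
  by (metis vzero_Vec zero_closed)

lemma homog_unit: "homog R n (vertex n x) (unit x)"
  by (auto simp: homog_def unit_def)

text \<open>Let g2 be the part of g outside degree t. Its image vanishes in degree t, and being the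
  difference of the images of g and of the degree t part it also vanishes elsewhere; injectivity
  gives g2 = 0.\<close>

lemma inj_morph_reflects_homog:
  assumes \<phi>: "morph R n b c \<phi>" "inj_on \<phi> (Vec R b)"
    and g: "g \<in> Vec R b" "homog R n t (\<phi> g)"
  shows "homog R n t g"
proof -
  define g1 where "g1 x = (if vertex n x = t then g x else \<zero>)" for x
  define g2 where "g2 x = (if vertex n x = t then \<zero> else g x)" for x
  have V: "g1 \<in> Vec R b" "g2 \<in> Vec R b"
    using Vec_closed[OF g(1)] Vec_outside[OF g(1)] by (auto simp: g1_def g2_def intro!: VecI)
  have sum: "g = vadd R g1 g2"
    using Vec_closed[OF g(1)] by (auto simp: vadd_def g1_def g2_def)
  \<comment> \<open>\<open>morph\<close> speaks of homogeneous vectors only, so this mixed vector is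
    handled by adding up basis vectors.\<close>
  have off: "\<forall>x. vertex n x = t \<longrightarrow> \<phi> f x = \<zero>" if "f \<in> Vec R b" "\<forall>x. vertex n x = t \<longrightarrow> f x = \<zero>" for f
    using that
  proof (induction rule: Vec_induct)
    case zero
    then show ?case using morph_zero[OF \<phi>(1)] by (simp add: vzero_def)
  next
    case (step f x a)
    have pt: "vadd R (vsmult R a (unit x)) f y = (if y = x then a else f y)" for y
      using step.hyps Vec_closed[OF step.hyps(1)] by (simp add: vadd_def vsmult_def unit_def)
    then have x: "vertex n x \<noteq> t" using step.prems step.hyps(5) by metis
    have "\<forall>y. vertex n y = t \<longrightarrow> f y = \<zero>" using step.prems pt x by metis
    with step.IH have IH: "\<forall>y. vertex n y = t \<longrightarrow> \<phi> f y = \<zero>" by blast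
    have "homog R n (vertex n x) (\<phi> (unit x))"
      using morphD(4)[OF \<phi>(1)] homog_unit step.hyps by simp
    then have "\<forall>y. vertex n y = t \<longrightarrow> \<phi> (unit x) y = \<zero>" using x unfolding homog_def by metis
    moreover have "\<phi> (vadd R (vsmult R a (unit x)) f) = vadd R (vsmult R a (\<phi> (unit x))) (\<phi> f)"
      using step.hyps by (simp add: morphD[OF \<phi>(1)])
    ultimately show ?case using IH step.hyps by (simp add: vadd_def vsmult_def)
  qed
  have g1: "homog R n t g1" by (auto simp: homog_def g1_def)
  have "\<phi> g2 x = \<zero>" for x
  proof (cases "vertex n x = t")
    case True
    then show ?thesis using off[OF V(2)] by (simp add: g2_def)
  next
    case False
    then have "\<phi> g x = \<zero>" "\<phi> g1 x = \<zero>"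
      using g(2) morphD(4)[OF \<phi>(1) V(1) g1] by (auto simp: homog_def)
    moreover have "\<phi> g x = \<phi> g1 x \<oplus> \<phi> g2 x"
      unfolding sum morphD(2)[OF \<phi>(1) V] by (simp add: vadd_def)
    ultimately show ?thesis using Vec_closed[OF morphD(1)[OF \<phi>(1) V(2)], of x] by simp
  qed
  then have "\<phi> g2 = \<phi> (vzero R)" unfolding morph_zero[OF \<phi>(1)] by (auto simp: vzero_def)
  then have "g2 = vzero R" using \<phi>(2) V by (auto dest: inj_onD)
  then show ?thesis using sum g1 vadd_zero[OF V(1)] by simp
qed

lemma Xop_funpow:
  "f \<in> Vec R m \<Longrightarrow> (Xop R m ^^ k) f (s, r, j) = (if (s, r, j) \<in> Idx m \<and> k \<le> j then f (s, r, j - k) else \<zero>)"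
proof (induction k arbitrary: j)
  case 0
  then show ?case by (simp add: Vec_outside)
next
  case (Suc k)
  show ?case
  proof (cases j)
    case (Suc i)
    then show ?thesis using Suc.IH[OF Suc.prems, of i] by (auto simp: Xop_def Idx_iff)
  qed (simp add: Xop_def)
qed

text \<open>A basis of the degree t part of the kernel of X intersected with the image of X^k: the
  last basis vectors of the segments longer than k.\<close>

definition bottoms :: "nat \<Rightarrow> mseg \<Rightarrow> nat \<Rightarrow> nat \<Rightarrow> idx set" where
  "bottoms n m t k = {x \<in> Idx m. (case x of (s, r, j) \<Rightarrow> Suc j = fst s \<and> k \<le> j) \<and> vertex n x = t}"

text \<open>The set on the left refers only to the submodule \<phi>(b) of c, so its size does not
  depend on the parametrization; transported back along \<phi> it is spanned by
  \<open>bottoms\<close>.\<close>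

lemma card_socle_layer:
  assumes \<phi>: "morph R n b c \<phi>" "inj_on \<phi> (Vec R b)"
  shows "card {f \<in> \<phi> ` Vec R b. homog R n t f \<and> Xop R c f = vzero R
      \<and> (\<exists>g\<in>\<phi> ` Vec R b. f = (Xop R c ^^ k) g)} = card (carrier R) ^ card (bottoms n b t k)"
proof -
  have pow: "\<phi> ((Xop R b ^^ k) g) = (Xop R c ^^ k) (\<phi> g) \<and> (Xop R b ^^ k) g \<in> Vec R b"
    if "g \<in> Vec R b" for g
    using that by (induction k) (simp_all add: morphD[OF \<phi>(1)])
  define S where "S = {f \<in> Vec R b. homog R n t f \<and> Xop R b f = vzero R \<and> (\<exists>g\<in>Vec R b. f = (Xop R b ^^ k) g)}"
  have "S = {f \<in> Vec R b. \<forall>x. f x \<noteq> \<zero> \<longrightarrow> x \<in> bottoms n b t k}"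
  proof (intro Set.set_eqI iffI)
    fix f assume "f \<in> S"
    then obtain g where f: "f \<in> Vec R b" "homog R n t f" "Xop R b f = vzero R" "g \<in> Vec R b"
      "f = (Xop R b ^^ k) g" by (auto simp: S_def)
    have "x \<in> bottoms n b t k" if x: "f x \<noteq> \<zero>" for x
    proof -
      obtain s r j where sr: "x = (s, r, j)" by (cases x)
      have "x \<in> Idx b" using x Vec_outside f(1) by blast
      moreover have "k \<le> j" using x f(5) Xop_funpow[OF f(4), of k s r j] sr by (auto split: if_splits)
      moreover have "Suc j = fst s"
      proof (rule ccontr)
        assume "Suc j \<noteq> fst s"
        then have "(s, r, Suc j) \<in> Idx b" using \<open>x \<in> Idx b\<close> sr by (simp add: Idx_iff)
        then have "Xop R b f (s, r, Suc j) = f x" by (simp add: Xop_def sr)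
        then show False using x f(3) by (simp add: vzero_def)
      qed
      moreover have "vertex n x = t" using f(2) x by (simp add: homog_def)
      ultimately show ?thesis by (simp add: bottoms_def sr)
    qed
    then show "f \<in> {f \<in> Vec R b. \<forall>x. f x \<noteq> \<zero> \<longrightarrow> x \<in> bottoms n b t k}" using f(1) by blast
  next
    fix f assume "f \<in> {f \<in> Vec R b. \<forall>x. f x \<noteq> \<zero> \<longrightarrow> x \<in> bottoms n b t k}"
    then have f: "f \<in> Vec R b" and sup: "\<And>x. f x \<noteq> \<zero> \<Longrightarrow> x \<in> bottoms n b t k" by auto
    have "homog R n t f" using sup by (auto simp: homog_def bottoms_def)
    moreover have "Xop R b f = vzero R"
      using sup by (fastforce simp: Xop_def vzero_def fun_eq_iff Idx_iff bottoms_def)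
    moreover have "\<exists>g\<in>Vec R b. f = (Xop R b ^^ k) g"
    proof
      define g where "g = (\<lambda>(s, r, j). if (s, r, j) \<in> Idx b then f (s, r, j + k) else \<zero>)"
      show g: "g \<in> Vec R b" using Vec_closed[OF f] by (auto simp: g_def intro!: VecI split: prod.splits)
      show "f = (Xop R b ^^ k) g"
      proof
        fix x :: idx
        obtain s r j where sr: "x = (s, r, j)" by (cases x)
        have "f x = \<zero>" if "\<not> k \<le> j \<or> x \<notin> Idx b" using sup[of x] that sr by (auto simp: bottoms_def)
        then show "f x = (Xop R b ^^ k) g x"
          unfolding sr Xop_funpow[OF g] by (auto simp: g_def Idx_iff)
      qed
    qed
    ultimately show "f \<in> S" using f by (simp add: S_def)
  qed
  then have "card S = card (carrier R) ^ card (bottoms n b t k)"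
    using card_supported[of "bottoms n b t k" b] by (auto simp: bottoms_def)
  moreover have "{f \<in> \<phi> ` Vec R b. homog R n t f \<and> Xop R c f = vzero R
      \<and> (\<exists>g\<in>\<phi> ` Vec R b. f = (Xop R c ^^ k) g)} = \<phi> ` S"
  proof -
    have "homog R n t (\<phi> f) \<longleftrightarrow> homog R n t f" if "f \<in> Vec R b" for f
      using inj_morph_reflects_homog[OF \<phi> that] morphD(4)[OF \<phi>(1) that] by blast
    moreover have "Xop R c (\<phi> f) = vzero R \<longleftrightarrow> Xop R b f = vzero R" if "f \<in> Vec R b" for f
      using morphD(5)[OF \<phi>(1) that] morph_zero[OF \<phi>(1)] inj_onD[OF \<phi>(2)] that Xop_Vec vzero_Vec
      by metis
    moreover have "\<phi> f = (Xop R c ^^ k) (\<phi> g) \<longleftrightarrow> f = (Xop R b ^^ k) g"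
      if "f \<in> Vec R b" "g \<in> Vec R b" for f g
      using pow[OF that(2)] inj_onD[OF \<phi>(2)] that(1) by metis
    ultimately show ?thesis unfolding S_def by blast
  qed
  moreover have "card (\<phi> ` S) = card S"
    using \<phi>(2) by (intro card_image inj_on_subset[OF \<phi>(2)]) (auto simp: S_def)
  ultimately show ?thesis by simp
qed

text \<open>A segment is determined by its length and its bottom vertex, so differences of
  consecutive \<open>bottoms\<close> at a vertex are multiplicities.\<close>

lemma count_eq_bottoms:
  assumes m: "valid_mseg n m" and l: "1 \<le> l" and h: "h < n"
  shows "card (bottoms n m (nat ((int h - int (l - 1)) mod int n)) (l - 1))
    = count m (l, h) + card (bottoms n m (nat ((int h - int (l - 1)) mod int n)) l)"
proof -
  define t where "t = nat ((int h - int (l - 1)) mod int n)"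
  define C where "C = (\<lambda>r. ((l, h), r, l - 1)) ` {..<count m (l, h)}"
  have "bottoms n m t (l - 1) = C \<union> bottoms n m t l"
  proof (intro Set.set_eqI iffI)
    fix x assume x: "x \<in> bottoms n m t (l - 1)"
    obtain L h' r j where sr: "x = ((L, h'), r, j)" by (cases x) auto
    have xx: "r < count m (L, h')" "Suc j = L" "l - 1 \<le> j" "vertex n x = t"
      using x sr by (auto simp: bottoms_def Idx_iff)
    show "x \<in> C \<union> bottoms n m t l"
    proof (cases "l \<le> j")
      case False
      then have j: "j = l - 1" "L = l" using xx l by auto
      have "(L, h') \<in># m" using xx(1) by (simp flip: count_greater_zero_iff)
      then have "h' < n" using m by (auto simp: valid_mseg_def)
      have "(int h' - int (l - 1)) mod int n = (int h - int (l - 1)) mod int n"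
        using xx(4) h unfolding sr vertex_simp t_def j(1) by (simp add: nat_eq_iff)
      then have "int h' mod int n = int h mod int n"
        by (metis diff_add_cancel mod_add_left_eq)
      then have "h' = h" using h \<open>h' < n\<close> by simp
      then show ?thesis using xx sr j by (simp add: C_def)
    qed (use x sr in \<open>auto simp: bottoms_def\<close>)
  next
    fix x assume "x \<in> C \<union> bottoms n m t l"
    then show "x \<in> bottoms n m t (l - 1)"
      using l by (auto simp: C_def bottoms_def Idx_iff t_def vertex_simp)
  qed
  moreover have "C \<inter> bottoms n m t l = {}" using l by (auto simp: C_def bottoms_def)
  moreover have "finite (bottoms n m t l)" by (simp add: bottoms_def)
  moreover have "card C = count m (l, h)" "finite C"
    unfolding C_def by (subst card_image) (auto simp: inj_on_def)
  ultimately show ?thesis by (simp add: card_Un_disjoint t_def)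
qed

text \<open>The dimensions of the graded pieces of $\ker X \cap X^k U$ determine the type of a
  subrepresentation $U$.\<close>

lemma submodule_type_unique:
  assumes "morph R n b c \<phi>" "inj_on \<phi> (Vec R b)" "\<phi> ` Vec R b = U" "valid_mseg n b"
    and "morph R n b' c \<phi>'" "inj_on \<phi>' (Vec R b')" "\<phi>' ` Vec R b' = U" "valid_mseg n b'"
  shows "b = b'"
proof -
  have "card (bottoms n b t k) = card (bottoms n b' t k)" for t k
  proof -
    have "card (carrier R) ^ card (bottoms n b t k) = card (carrier R) ^ card (bottoms n b' t k)"
      using card_socle_layer[OF assms(1,2)] card_socle_layer[OF assms(5,6)] assms(3,7) by metis
    then show ?thesis using card_carrier by (simp add: power_inject_exp)
  qed
  then have "count b (l, h) = count b' (l, h)" if "1 \<le> l" "h < n" for l h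
    using count_eq_bottoms[OF assms(4) that] count_eq_bottoms[OF assms(8) that] by simp
  moreover have "count m (l, h) = 0" if "\<not> (1 \<le> l \<and> h < n)" "valid_mseg n m" for l h m
    using that by (auto simp: valid_mseg_def not_in_iff[symmetric])
  ultimately have "count b s = count b' s" for s
    using assms(4,8) by (cases s) metis
  then show ?thesis by (rule multiset_eqI)
qed

end

section \<open>Hall numbers for a simple quotient\<close>

locale cyclic_vertex =
  fixes n i :: nat
  assumes n: "2 \<le> n" and i_less: "i < n"
begin

lemma predI_less: "predI n i < n"
  using n by (simp add: predI_def)

lemma predI_neq: "i \<noteq> predI n i"
  using n i_less by (cases i) (auto simp: predI_def mod_if)

lemma predI_mod: "(int (predI n i) - a) mod int n = (int i - 1 - a) mod int n"
proof -
  have "int (i + n - 1) = int i - 1 + int n" using n by simp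
  then show ?thesis
    unfolding predI_def by (simp add: zmod_int mod_diff_left_eq)
qed

sublocale adjacent_vertices n i "predI n i"
  by standard (use i_less predI_less predI_neq in auto)

text \<open>This places (l-1;i-1] as the radical of (l;i]: vector j of the former sits where vector
  j + 1 of the latter does.\<close>

lemma vertex_pred: "vertex n ((l, predI n i), r, j) = vertex n ((l', i), r', Suc j)"
  unfolding vertex_simp predI_mod by (simp add: algebra_simps)

end

text \<open>Representatives of a basis of c modulo the image of X at vertex i, the only part seen by
  maps to the simple module.\<close>

definition heads :: "nat \<Rightarrow> mseg \<Rightarrow> idx set" where
  "heads i c = {x \<in> Idx c. (case x of (s, r, j) \<Rightarrow> snd s = i \<and> j = 0)}"

lemma heads_subset: "heads i c \<subseteq> Idx c"
  by (auto simp: heads_def)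

lemma finite_heads [simp]: "finite (heads i c)"
  using finite_subset[OF heads_subset finite_Idx] .

lemma card_copies: "card (SIGMA s:set_mset m. {..<count m s}) = size m"
  by (simp add: size_multiset_overloaded_eq)

lemma card_heads_filter:
  assumes "\<And>s. P s \<Longrightarrow> snd s = i \<and> 0 < fst s"
  shows "card {x \<in> heads i c. P (fst x)} = size {#s \<in># c. P s#}"
proof -
  define S where "S = (SIGMA s:set_mset {#s \<in># c. P s#}. {..<count {#s \<in># c. P s#} s})"
  define e :: "seg \<times> nat \<Rightarrow> idx" where "e p = (fst p, snd p, 0)" for p
  have "{x \<in> heads i c. P (fst x)} = e ` S"
  proof (intro Set.set_eqI iffI)
    fix x assume x: "x \<in> {x \<in> heads i c. P (fst x)}"
    obtain s r j where "x = (s, r, j)" by (cases x)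
    with x have "x = e (s, r)" "r < count c s" "P s"
      by (auto simp: heads_def Idx_iff e_def)
    moreover from this have "s \<in># c" by (simp flip: count_greater_zero_iff)
    ultimately show "x \<in> e ` S"
      by (intro image_eqI[of _ _ "(s, r)"]) (auto simp: S_def)
  next
    fix x assume "x \<in> e ` S"
    then obtain s r where "x = e (s, r)" "P s" "r < count c s" by (auto simp: S_def)
    then show "x \<in> {x \<in> heads i c. P (fst x)}"
      using assms[of s] by (simp add: heads_def Idx_iff e_def)
  qed
  also have "card (e ` S) = card S"
    by (intro card_image) (auto simp: inj_on_def e_def)
  finally show ?thesis by (simp only: S_def card_copies)
qed

section \<open>Linear forms on the heads and morphisms onto the simple module\<close>

locale hall_vertex = cyclic_vertex n i + finite_field R for n i and R :: "nat ring" (structure)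
begin

definition simple :: mseg where "simple = {#(1, i)#}"
definition z0 :: idx where "z0 = ((1, i), 0, 0)"

lemma Idx_simple: "Idx simple = {z0}"
  by (auto simp: simple_def z0_def Idx_iff split: if_splits)

lemma Xop_simple: "Xop R simple g = (\<lambda>z. \<zero>)"
  by (rule ext) (auto simp: Xop_def Idx_simple z0_def)

lemma vertex_z0: "vertex n z0 = i"
  using i_less by (simp add: z0_def vertex_simp)

text \<open>For j = 0 a linear form on the heads at i. The same coefficients on the j-th vectors of
  the segments serve to extend the form to a coordinate change that commutes with X.\<close>

definition functional :: "mseg \<Rightarrow> (idx \<Rightarrow> nat) \<Rightarrow> nat \<Rightarrow> (idx \<Rightarrow> nat) \<Rightarrow> nat" where
  "functional c \<mu> j f = (\<Oplus>x\<in>heads i c. \<mu> x \<otimes> f (fst x, fst (snd x), j))"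

definition Ker :: "mseg \<Rightarrow> (idx \<Rightarrow> nat) \<Rightarrow> (idx \<Rightarrow> nat) set" where
  "Ker c \<mu> = {f \<in> Vec R c. functional c \<mu> 0 f = \<zero>}"

lemma functional_closed: "\<mu> \<in> Vec R c \<Longrightarrow> f \<in> Vec R c \<Longrightarrow> functional c \<mu> j f \<in> carrier R"
  unfolding functional_def by (intro finsum_closed) (auto simp: Vec_closed[of \<mu>] Vec_closed[of f])

lemma functional_add:
  "\<mu> \<in> Vec R c \<Longrightarrow> f \<in> Vec R c \<Longrightarrow> g \<in> Vec R c \<Longrightarrow> functional c \<mu> j (vadd R f g) = functional c \<mu> j f \<oplus> functional c \<mu> j g"
  unfolding functional_def
  by (subst finsum_addf[symmetric])
    (auto simp: vadd_def Vec_closed[of \<mu>] Vec_closed[of f] Vec_closed[of g] r_distr)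

lemma functional_smult:
  "\<mu> \<in> Vec R c \<Longrightarrow> f \<in> Vec R c \<Longrightarrow> a \<in> carrier R \<Longrightarrow> functional c \<mu> j (vsmult R a f) = a \<otimes> functional c \<mu> j f"
  unfolding functional_def
  by (subst finsum_rdistr)
    (auto simp: vsmult_def Vec_closed[of \<mu>] Vec_closed[of f] m_lcomm)

lemma functional_eq_zero:
  assumes "\<mu> \<in> Vec R c" "\<And>x. x \<in> heads i c \<Longrightarrow> \<mu> x \<noteq> \<zero> \<Longrightarrow> f (fst x, fst (snd x), j) = \<zero>"
    "f \<in> Vec R c"
  shows "functional c \<mu> j f = \<zero>"
proof -
  have "functional c \<mu> j f = (\<Oplus>x\<in>heads i c. \<zero>)"
    unfolding functional_def
  proof (intro finsum_cong' refl)
    fix x assume "x \<in> heads i c"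
    then show "\<mu> x \<otimes> f (fst x, fst (snd x), j) = \<zero>"
      using assms(2)[of x] Vec_closed[OF assms(1), of x] Vec_closed[OF assms(3)]
      by (cases "\<mu> x = \<zero>") simp_all
  qed simp
  then show ?thesis by (simp add: finsum_zero)
qed

lemma functional_remove:
  assumes "\<mu> \<in> Vec R c" "f \<in> Vec R c" "h \<in> heads i c"
  shows "functional c \<mu> j f = \<mu> h \<otimes> f (fst h, fst (snd h), j)
    \<oplus> (\<Oplus>x\<in>heads i c - {h}. \<mu> x \<otimes> f (fst x, fst (snd x), j))"
proof -
  have "heads i c = insert h (heads i c - {h})" using assms(3) by blast
  then show ?thesis
    unfolding functional_def using finsum_insert[of "heads i c - {h}" h "\<lambda>x. \<mu> x \<otimes> f (fst x, fst (snd x), j)"]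
    by (simp add: Vec_closed[OF assms(1)] Vec_closed[OF assms(2)])
qed

lemma heads_expand: "x \<in> heads i c \<Longrightarrow> (fst x, fst (snd x), 0) = x"
  by (auto simp: heads_def)

lemma functional_unit:
  assumes "\<mu> \<in> Vec R c" "h \<in> heads i c"
  shows "functional c \<mu> 0 (unit h) = \<mu> h"
proof -
  have u: "unit h \<in> Vec R c" using assms(2) heads_subset by (intro unit_Vec) blast
  have "(\<Oplus>x\<in>heads i c - {h}. \<mu> x \<otimes> unit h (fst x, fst (snd x), 0)) = (\<Oplus>x\<in>heads i c - {h}. \<zero>)"
  proof (intro finsum_cong' refl)
    fix x assume "x \<in> heads i c - {h}"
    then show "\<mu> x \<otimes> unit h (fst x, fst (snd x), 0) = \<zero>"
      using heads_expand[of x c] by (simp add: unit_def Vec_closed[OF assms(1)])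
  qed simp
  then show ?thesis
    unfolding functional_remove[OF assms(1) u assms(2)] heads_expand[OF assms(2)]
    by (simp add: unit_def finsum_zero Vec_closed[OF assms(1)])
qed

text \<open>A morphism onto the simple module kills all basis vectors except the heads at \<open>i\<close>.\<close>

lemma morph_simple:
  assumes c: "valid_mseg n c" and \<psi>: "morph R n c simple \<psi>" and f: "f \<in> Vec R c"
  defines "\<mu> \<equiv> \<lambda>x. if x \<in> heads i c then \<psi> (unit x) z0 else \<zero>"
  shows "\<psi> f z0 = functional c \<mu> 0 f"
proof -
  have \<mu>: "\<mu> \<in> Vec R c"
    using heads_subset Vec_closed[OF morphD(1)[OF \<psi>]] by (intro VecI) (auto simp: \<mu>_def subset_iff)
  have unit: "\<psi> (unit x) z0 = functional c \<mu> 0 (unit x)" if x: "x \<in> Idx c" for x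
  proof (cases "x \<in> heads i c")
    case True
    then show ?thesis using functional_unit[OF \<mu>] by (simp add: \<mu>_def)
  next
    case False
    obtain s r j where sr: "x = (s, r, j)" by (cases x)
    have "\<psi> (unit x) z0 = \<zero>"
    proof (cases j)
      case 0
      have "s \<in># c" using x sr by (simp add: Idx_def)
      then have "snd s < n" using c by (auto simp: valid_mseg_def)
      then have "vertex n x = snd s" by (cases s) (simp add: sr 0 vertex_simp)
      then have "vertex n z0 \<noteq> vertex n x" using False x 0 sr by (auto simp: heads_def vertex_z0)
      then show ?thesis
        using morphD(4)[OF \<psi> unit_Vec[OF x] homog_unit] by (auto simp: homog_def)
    next
      case (Suc j')
      have x': "(s, r, j') \<in> Idx c" using x sr Suc by (simp add: Idx_iff)
      have "unit x = Xop R c (unit (s, r, j'))"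
      proof
        fix y :: idx
        obtain s' r' k where y: "y = (s', r', k)" by (cases y)
        show "unit x y = Xop R c (unit (s, r, j')) y"
          using x by (cases k) (auto simp: unit_def Xop_def y sr Suc)
      qed
      then have "\<psi> (unit x) = Xop R simple (\<psi> (unit (s, r, j')))"
        using morphD(5)[OF \<psi> unit_Vec[OF x']] by simp
      then show ?thesis by (simp add: Xop_def z0_def)
    qed
    moreover have "functional c \<mu> 0 (unit x) = \<zero>"
      using False by (intro functional_eq_zero \<mu> unit_Vec x) (auto simp: heads_expand unit_def)
    ultimately show ?thesis by simp
  qed
  show ?thesis using f
  proof (induction rule: Vec_induct)
    case zero
    have "functional c \<mu> 0 (vzero R) = \<zero>" by (intro functional_eq_zero \<mu> vzero_Vec) (simp add: vzero_def)
    then show ?case unfolding morph_zero[OF \<psi>] by (simp add: vzero_def)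
  next
    case (step f x a)
    then have "\<psi> (vadd R (vsmult R a (unit x)) f) = vadd R (vsmult R a (\<psi> (unit x))) (\<psi> f)"
      by (simp add: morphD[OF \<psi>])
    then show ?case
      using step.hyps step.IH unit by (simp add: functional_add[OF \<mu>] functional_smult[OF \<mu>]) (simp add: vadd_def vsmult_def)
  qed
qed

text \<open>Every linear form on the heads gives a morphism: the image of X has no coordinates at
  heads, and X is zero on the simple module.\<close>

lemma morph_of_functional:
  assumes c: "valid_mseg n c" and \<mu>: "\<mu> \<in> Vec R c" and h: "h \<in> heads i c" "\<mu> h \<noteq> \<zero>"
  defines "\<psi> \<equiv> \<lambda>f z. if z = z0 then functional c \<mu> 0 f else \<zero>"
  shows "morph R n c simple \<psi>" "\<psi> ` Vec R c = Vec R simple" "{f \<in> Vec R c. \<psi> f = vzero R} = Ker c \<mu>"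
proof -
  have V: "\<psi> f \<in> Vec R simple" if "f \<in> Vec R c" for f
    using functional_closed[OF \<mu> that] by (intro VecI) (auto simp: \<psi>_def Idx_simple)
  have vtx: "vertex n x = i" if "x \<in> heads i c" for x
    using that i_less by (auto simp: heads_def vertex_simp)
  have "homog R n t (\<psi> f)" if "f \<in> Vec R c" "homog R n t f" for t f
  proof (cases "t = i")
    case True
    then show ?thesis by (auto simp: homog_def \<psi>_def vertex_z0)
  next
    case False
    have "f x = \<zero>" if "x \<in> heads i c" for x
      using vtx[OF that] False \<open>homog R n t f\<close> by (auto simp: homog_def)
    then have "functional c \<mu> 0 f = \<zero>" by (intro functional_eq_zero \<mu> that) (simp add: heads_expand)
    then show ?thesis by (auto simp: homog_def \<psi>_def)
  qed
  moreover have "\<psi> (Xop R c f) = Xop R simple (\<psi> f)" if "f \<in> Vec R c" for f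
  proof -
    have z: "functional c \<mu> 0 (Xop R c f) = \<zero>"
      by (intro functional_eq_zero \<mu> Xop_Vec that) (simp add: Xop_def)
    show ?thesis unfolding Xop_simple \<psi>_def z by simp
  qed
  moreover have "\<psi> (vadd R f g) = vadd R (\<psi> f) (\<psi> g)" if "f \<in> Vec R c" "g \<in> Vec R c" for f g
    unfolding \<psi>_def functional_add[OF \<mu> that] by (rule ext) (simp add: vadd_def)
  moreover have "\<psi> (vsmult R a f) = vsmult R a (\<psi> f)" if "f \<in> Vec R c" "a \<in> carrier R" for f a
    unfolding \<psi>_def functional_smult[OF \<mu> that] using that by (intro ext) (simp add: vsmult_def)
  ultimately show "morph R n c simple \<psi>"
    unfolding morph_def using V by blast
  show "{f \<in> Vec R c. \<psi> f = vzero R} = Ker c \<mu>"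
    by (auto simp: Ker_def \<psi>_def vzero_def fun_eq_iff)
  show "\<psi> ` Vec R c = Vec R simple"
  proof
    show "\<psi> ` Vec R c \<subseteq> Vec R simple" using V by auto
    show "Vec R simple \<subseteq> \<psi> ` Vec R c"
    proof
      fix g assume g: "g \<in> Vec R simple"
      have u: "unit h \<in> Vec R c" using h(1) heads_subset by (intro unit_Vec) blast
      have \<mu>h: "\<mu> h \<in> Units R" using h(2) Vec_closed[OF \<mu>] field_Units by simp
      define a where "a = g z0 \<otimes> inv (\<mu> h)"
      have a: "a \<in> carrier R" using \<mu>h Vec_closed[OF g] by (simp add: a_def)
      have "functional c \<mu> 0 (vsmult R a (unit h)) = a \<otimes> \<mu> h"
        by (simp add: functional_smult[OF \<mu> u a] functional_unit[OF \<mu> h(1)])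
      also have "\<dots> = g z0" using \<mu>h Vec_closed[OF g] by (simp add: a_def m_assoc Units_l_inv Units_closed)
      finally have "\<psi> (vsmult R a (unit h)) = g"
        using Vec_outside[OF g] by (auto simp: fun_eq_iff \<psi>_def Idx_simple)
      then show "g \<in> \<psi> ` Vec R c" using a u by (metis imageI vsmult_Vec)
    qed
  qed
qed

end

context finite_field
begin

lemma vadd_apply: "vadd R f g x = f x \<oplus> g x"
  by (simp add: vadd_def)

lemma vsmult_apply: "vsmult R a f x = a \<otimes> f x"
  by (simp add: vsmult_def)

lemma morph_compose:
  "morph R n b c \<phi> \<Longrightarrow> morph R n c d \<psi> \<Longrightarrow> morph R n b d (\<lambda>f. \<psi> (\<phi> f))"
  unfolding morph_def by simp

text \<open>Injectivity on a finite set gives bijectivity; the inverse is graded by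
  \<open>inj_morph_reflects_homog\<close>.\<close>

lemma morph_inverse:
  assumes \<alpha>: "morph R n c c \<alpha>" "inj_on \<alpha> (Vec R c)"
  shows "morph R n c c (inv_into (Vec R c) \<alpha>)" "inj_on (inv_into (Vec R c) \<alpha>) (Vec R c)"
    and "\<And>f. f \<in> Vec R c \<Longrightarrow> inv_into (Vec R c) \<alpha> f \<in> Vec R c \<and> \<alpha> (inv_into (Vec R c) \<alpha> f) = f"
    and "\<And>f. f \<in> Vec R c \<Longrightarrow> inv_into (Vec R c) \<alpha> (\<alpha> f) = f"
proof -
  define \<beta> where "\<beta> = inv_into (Vec R c) \<alpha>"
  have surj: "\<alpha> ` Vec R c = Vec R c"
    using \<alpha> finite_Vec morphD(1)[OF \<alpha>(1)] by (intro endo_inj_surj) auto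
  have \<beta>: "\<beta> f \<in> Vec R c" "\<alpha> (\<beta> f) = f" if "f \<in> Vec R c" for f
    using that surj unfolding \<beta>_def by (simp_all add: inv_into_into f_inv_into_f)
  have \<beta>\<alpha>: "\<beta> (\<alpha> f) = f" if "f \<in> Vec R c" for f
    unfolding \<beta>_def using \<alpha>(2) that by (rule inv_into_f_f)
  have eq: "\<beta> f = g" if "f \<in> Vec R c" "g \<in> Vec R c" "f = \<alpha> g" for f g
    using \<beta>\<alpha>[OF that(2)] that(3) by simp
  have "\<beta> (vadd R f g) = vadd R (\<beta> f) (\<beta> g)" if "f \<in> Vec R c" "g \<in> Vec R c" for f g
    using that \<beta> by (intro eq) (simp_all add: morphD(2)[OF \<alpha>(1)])
  moreover have "\<beta> (vsmult R a f) = vsmult R a (\<beta> f)" if "f \<in> Vec R c" "a \<in> carrier R" for f a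
    using that \<beta> by (intro eq) (simp_all add: morphD(3)[OF \<alpha>(1)])
  moreover have "\<beta> (Xop R c f) = Xop R c (\<beta> f)" if "f \<in> Vec R c" for f
    using that \<beta> by (intro eq) (simp_all add: morphD(5)[OF \<alpha>(1)])
  moreover have "homog R n t (\<beta> f)" if "f \<in> Vec R c" "homog R n t f" for t f
    by (rule inj_morph_reflects_homog[OF \<alpha>]) (use that \<beta> in simp_all)
  ultimately show "morph R n c c (inv_into (Vec R c) \<alpha>)"
    unfolding morph_def \<beta>_def[symmetric] using \<beta>(1) by blast
  show "inj_on (inv_into (Vec R c) \<alpha>) (Vec R c)"
    unfolding \<beta>_def[symmetric] using \<beta> by (intro inj_onI) metis
  show "\<And>f. f \<in> Vec R c \<Longrightarrow> inv_into (Vec R c) \<alpha> f \<in> Vec R c \<and> \<alpha> (inv_into (Vec R c) \<alpha> f) = f"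
    unfolding \<beta>_def[symmetric] using \<beta> by blast
  show "\<And>f. f \<in> Vec R c \<Longrightarrow> inv_into (Vec R c) \<alpha> (\<alpha> f) = f"
    unfolding \<beta>_def[symmetric] by (rule \<beta>\<alpha>)
qed

end

section \<open>The isomorphism type of the kernel of a linear form\<close>

context hall_vertex
begin

text \<open>The automorphism that turns the functional \<open>\<mu>\<close> into the coordinate at the head of the
  last copy of \<open>(l;i]\<close>, for \<open>l\<close> the least length on which \<open>\<mu>\<close> does not vanish.\<close>

lemma functional_normal_form:
  assumes c: "valid_mseg n c" and \<mu>: "\<mu> \<in> Vec R c" and r1: "r1 < xx c l" "\<mu> ((l, i), r1, 0) \<noteq> \<zero>"
    and min: "\<And>x. x \<in> heads i c \<Longrightarrow> \<mu> x \<noteq> \<zero> \<Longrightarrow> l \<le> fst (fst x)" and l: "1 \<le> l"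
  obtains \<alpha> where "morph R n c c \<alpha>" "inj_on \<alpha> (Vec R c)"
    "\<And>f. f \<in> Vec R c \<Longrightarrow> \<alpha> f ((l, i), xx c l - 1, 0) = functional c \<mu> 0 f"
proof -
  define q where "q = xx c l - 1"
  have q: "q < count c (l, i)" using r1 by (simp add: q_def xx_def)
  have h: "((l, i), r1, 0) \<in> heads i c" using r1 l by (simp add: heads_def Idx_iff xx_def)
  \<comment> \<open>Copy \<open>q\<close> receives the values of the functional, level by level, and
    the old coordinates of copy \<open>q\<close> are saved in copy \<open>r1\<close>. What copy
    \<open>r1\<close> held can be recovered from the functional because \<mu> is nonzero
    there.\<close>
  define \<alpha> where "\<alpha> f = (\<lambda>(s, r, j). if s = (l, i) \<and> r = q \<and> j < l then functional c \<mu> j f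
      else if s = (l, i) \<and> r = r1 then f ((l, i), q, j) else f (s, r, j))" for f
  have V: "\<alpha> f \<in> Vec R c" if f: "f \<in> Vec R c" for f
  proof (rule VecI)
    fix x assume "x \<in> Idx c"
    then show "\<alpha> f x \<in> carrier R"
      using functional_closed[OF \<mu> f] Vec_closed[OF f] by (cases x) (simp add: \<alpha>_def)
  next
    fix x assume x: "x \<notin> Idx c"
    obtain s r j where sr: "x = (s, r, j)" by (cases x)
    show "\<alpha> f x = \<zero>"
      using x q r1 unfolding sr by (auto simp: \<alpha>_def Idx_iff xx_def intro!: Vec_outside[OF f])
  qed
  have vtx: "vertex n (fst x, fst (snd x), j) = vertex n ((l, i), r, j)" if "x \<in> heads i c" for x r j
    using that by (cases x) (auto simp: heads_def vertex_simp)
  have hom: "homog R n t (\<alpha> f)" if f: "f \<in> Vec R c" "homog R n t f" for t f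
    unfolding homog_def
  proof (intro allI impI)
    fix x assume x: "\<alpha> f x \<noteq> \<zero>"
    obtain s r j where sr: "x = (s, r, j)" by (cases x)
    show "vertex n x = t"
    proof (rule ccontr)
      assume t: "vertex n x \<noteq> t"
      have v: "f y = \<zero>" if "vertex n y \<noteq> t" for y using f(2) that by (auto simp: homog_def)
      have "functional c \<mu> j f = \<zero>" if "s = (l, i)"
        by (intro functional_eq_zero \<mu> f v) (use t that vtx[of _ j r] in \<open>simp add: sr\<close>)
      moreover have "f ((l, i), q, j) = \<zero>" if "s = (l, i)"
        using v t that by (simp add: sr vertex_simp)
      ultimately show False using x t v[OF t] by (auto simp: \<alpha>_def sr split: if_splits)
    qed
  qed
  have X: "\<alpha> (Xop R c f) = Xop R c (\<alpha> f)" if f: "f \<in> Vec R c" for f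
  proof
    fix x :: idx
    obtain s r j where sr: "x = (s, r, j)" by (cases x)
    \<comment> \<open>By minimality of \<open>l\<close>, every segment with nonzero coefficient has
      length at least \<open>l\<close>; so for j < l its vector j exists, and X shifts the
      functional by one level.\<close>
    have "functional c \<mu> j (Xop R c f) = (if j = 0 then \<zero> else functional c \<mu> (j - 1) f)" if "j < l"
    proof (cases j)
      case 0
      then show ?thesis by (simp, intro functional_eq_zero \<mu> Xop_Vec f) (simp add: Xop_def)
    next
      case (Suc k)
      have "functional c \<mu> (Suc k) (Xop R c f) = functional c \<mu> k f"
        unfolding functional_def
      proof (intro finsum_cong' refl)
        fix y assume y: "y \<in> heads i c"
        show "\<mu> y \<otimes> Xop R c f (fst y, fst (snd y), Suc k) = \<mu> y \<otimes> f (fst y, fst (snd y), k)"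
        proof (cases "\<mu> y = \<zero>")
          case True
          then show ?thesis using Vec_closed[OF f] Vec_closed[OF Xop_Vec[OF f]] by simp
        next
          case False
          then have "(fst y, fst (snd y), Suc k) \<in> Idx c"
            using y min[OF y] that Suc by (cases y) (auto simp: heads_def Idx_iff)
          then show ?thesis by (simp add: Xop_def)
        qed
      qed (simp add: Vec_closed[OF \<mu>] Vec_closed[OF f])
      then show ?thesis by (simp add: Suc)
    qed
    moreover have "Xop R c f ((l, i), q, j) = (if r1 < count c (l, i) \<and> j < l \<and> 1 \<le> j then f ((l, i), q, j - 1) else \<zero>)"
      using q r1 by (simp add: Xop_def Idx_iff xx_def)
    ultimately show "\<alpha> (Xop R c f) x = Xop R c (\<alpha> f) x"
      using q by (auto simp: \<alpha>_def sr Xop_def Idx_iff)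
  qed
  have add: "\<alpha> (vadd R f g) = vadd R (\<alpha> f) (\<alpha> g)" if "f \<in> Vec R c" "g \<in> Vec R c" for f g
  proof
    fix x :: idx
    show "\<alpha> (vadd R f g) x = vadd R (\<alpha> f) (\<alpha> g) x"
    proof -
      obtain s r j where sr: "x = (s, r, j)" by (cases x)
      have *: "\<alpha> h x = (if s = (l, i) \<and> r = q \<and> j < l then functional c \<mu> j h
          else if s = (l, i) \<and> r = r1 then h ((l, i), q, j) else h (s, r, j))" for h
        unfolding \<alpha>_def sr by simp
      show ?thesis unfolding vadd_apply[of "\<alpha> f"] * functional_add[OF \<mu> that] by (auto simp: vadd_apply)
    qed
  qed
  have sm: "\<alpha> (vsmult R a f) = vsmult R a (\<alpha> f)" if "f \<in> Vec R c" "a \<in> carrier R" for f a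
  proof
    fix x :: idx
    show "\<alpha> (vsmult R a f) x = vsmult R a (\<alpha> f) x"
    proof -
      obtain s r j where sr: "x = (s, r, j)" by (cases x)
      have *: "\<alpha> h x = (if s = (l, i) \<and> r = q \<and> j < l then functional c \<mu> j h
          else if s = (l, i) \<and> r = r1 then h ((l, i), q, j) else h (s, r, j))" for h
        unfolding \<alpha>_def sr by simp
      show ?thesis unfolding vsmult_apply[of _ "\<alpha> f"] * functional_smult[OF \<mu> that] by (auto simp: vsmult_apply)
    qed
  qed
  have "morph R n c c \<alpha>"
    unfolding morph_def using V hom X add sm by blast
  moreover have "inj_on \<alpha> (Vec R c)"
  proof (rule inj_onI)
    fix f g assume f: "f \<in> Vec R c" and g: "g \<in> Vec R c" and eq: "\<alpha> f = \<alpha> g"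
    have other: "f (s, r, j) = g (s, r, j)" if "\<not> (s = (l, i) \<and> r = r1)" for s r j
    proof (cases "s = (l, i) \<and> r = q")
      case False
      then show ?thesis using fun_cong[OF eq, of "(s, r, j)"] that by (auto simp: \<alpha>_def)
    next
      case True
      then have "r1 \<noteq> q" using that by auto
      then show ?thesis using fun_cong[OF eq, of "((l, i), r1, j)"] True by (simp add: \<alpha>_def)
    qed
    have "f ((l, i), r1, j) = g ((l, i), r1, j)" for j
    proof (cases "j < l")
      case False
      then have "((l, i), r1, j) \<notin> Idx c" by (simp add: Idx_iff)
      then show ?thesis using Vec_outside f g by metis
    next
      case True
      \<comment> \<open>All coordinates outside copy \<open>r1\<close> are already known to agree,
        so the functional determines the remaining one after division by \<mu>.\<close>
      define rest where "rest f = (\<Oplus>x\<in>heads i c - {((l, i), r1, 0)}. \<mu> x \<otimes> f (fst x, fst (snd x), j))" for f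
      have "functional c \<mu> j f = functional c \<mu> j g"
        using fun_cong[OF eq, of "((l, i), q, j)"] True by (simp add: \<alpha>_def)
      then have "\<mu> ((l, i), r1, 0) \<otimes> f ((l, i), r1, j) \<oplus> rest f = \<mu> ((l, i), r1, 0) \<otimes> g ((l, i), r1, j) \<oplus> rest g"
        using functional_remove[OF \<mu> f h, of j] functional_remove[OF \<mu> g h, of j] by (simp add: rest_def)
      moreover have "rest f = rest g"
        unfolding rest_def
      proof (intro finsum_cong' refl)
        fix x assume "x \<in> heads i c - {((l, i), r1, 0)}"
        then have "\<not> (fst x = (l, i) \<and> fst (snd x) = r1)" using heads_expand[of x c] by auto
        then show "\<mu> x \<otimes> f (fst x, fst (snd x), j) = \<mu> x \<otimes> g (fst x, fst (snd x), j)"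
          using other by simp
      qed (simp add: Vec_closed[OF \<mu>] Vec_closed[OF g])
      moreover have "rest g \<in> carrier R"
        unfolding rest_def by (intro finsum_closed) (simp add: Vec_closed[OF \<mu>] Vec_closed[OF g])
      ultimately show ?thesis
        using r1(2) Vec_closed[OF \<mu>] Vec_closed[OF f] Vec_closed[OF g] by (simp add: m_lcancel)
    qed
    then show "f = g" using other by (intro ext) (metis prod_cases3)
  qed
  moreover have "\<alpha> f ((l, i), xx c l - 1, 0) = functional c \<mu> 0 f" for f
    using l by (simp add: \<alpha>_def q_def)
  ultimately show ?thesis using that by blast
qed

text \<open>Without its head, the last copy of (l;i] becomes a new last copy, number
  \<open>y\<close>, of (l-1;i-1]. Choosing the last copy keeps the numbering of all others.\<close>

lemma coordinate_kernel:
  assumes c: "valid_mseg n c" and l: "1 \<le> l" "0 < xx c l"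
  obtains \<iota> where "morph R n (dn l c) c \<iota>" "inj_on \<iota> (Vec R (dn l c))"
    "\<iota> ` Vec R (dn l c) = {f \<in> Vec R c. f ((l, i), xx c l - 1, 0) = \<zero>}"
proof -
  define q where "q = xx c l - 1"
  define s' where "s' = (l - 1, predI n i)"
  define y where "y = count c s'"
  have neq: "s' \<noteq> (l, i)" "(l, i) \<noteq> s'" by (auto simp: s'_def)
  have cnt: "count c (l, i) = Suc q" using l by (simp add: q_def xx_def)
  have cnt_dn: "count (dn l c) s = (if s = (l, i) then q else if s = s' \<and> l \<noteq> 1 then Suc y else count c s)" for s
    using l neq cnt by (auto simp: dn_def s'_def y_def)
  have cnt_le: "r < count c s" if "r < count (dn l c) s" "\<not> (s = s' \<and> r = y)" for r s
  proof (cases "s = (l, i)")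
    case True
    then show ?thesis using that(1) cnt unfolding cnt_dn by simp
  next
    case False
    then show ?thesis using that unfolding cnt_dn by (auto simp: y_def split: if_splits)
  qed
  \<comment> \<open>For l = 1 the shortened segment has length 0: it does not occur in a valid
    multisegment and carries no basis vectors.\<close>
  have y0: "y = 0" if "l = 1"
    using c that by (auto simp: y_def s'_def valid_mseg_def not_in_iff[symmetric])
  define \<iota> :: "(idx \<Rightarrow> nat) \<Rightarrow> idx \<Rightarrow> nat" where "\<iota> f = (\<lambda>(s, r, j). if s = (l, i) \<and> r = q then (if j = 0 then \<zero> else f (s', y, j - 1))
      else if s = s' \<and> r = y then \<zero> else f (s, r, j))" for f
  have V: "\<iota> f \<in> Vec R c" if f: "f \<in> Vec R (dn l c)" for f
  proof (rule VecI)
    fix x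
    show "\<iota> f x \<in> carrier R" by (cases x) (simp add: \<iota>_def Vec_closed[OF f])
    assume x: "x \<notin> Idx c"
    obtain s r j where sr: "x = (s, r, j)" by (cases x)
    have "(s, r, j) \<notin> Idx (dn l c)" if "\<not> (s = s' \<and> r = y)"
      using x cnt_le[OF _ that] unfolding sr Idx_iff by blast
    moreover have "(s', y, j - 1) \<notin> Idx (dn l c)" if "s = (l, i)" "r = q" "j \<noteq> 0"
      using x that unfolding sr Idx_iff cnt_dn by (auto simp: cnt s'_def)
    ultimately show "\<iota> f x = \<zero>"
      unfolding sr \<iota>_def by (auto intro: Vec_outside[OF f])
  qed
  have hom: "homog R n t (\<iota> f)" if f: "f \<in> Vec R (dn l c)" "homog R n t f" for t f
    unfolding homog_def
  proof (intro allI impI)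
    fix x assume x: "\<iota> f x \<noteq> \<zero>"
    obtain s r j where sr: "x = (s, r, j)" by (cases x)
    show "vertex n x = t"
    proof (cases "s = (l, i) \<and> r = q")
      case True
      then obtain k where "j = Suc k" "f (s', y, k) \<noteq> \<zero>" using x by (cases j) (auto simp: \<iota>_def sr)
      then show ?thesis
        using f(2) True vertex_pred[of "l - 1" y k l q] by (auto simp: homog_def sr s'_def)
    next
      case False
      then have "f x \<noteq> \<zero>" using x by (auto simp: \<iota>_def sr split: if_splits)
      then show ?thesis using f(2) by (auto simp: homog_def)
    qed
  qed
  have X: "\<iota> (Xop R (dn l c) f) = Xop R c (\<iota> f)" if f: "f \<in> Vec R (dn l c)" for f
  proof
    fix x :: idx
    obtain s r j where sr: "x = (s, r, j)" by (cases x)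
    consider "s = (l, i)" "r = q" | "s = s'" "r = y" "\<not> (s = (l, i) \<and> r = q)"
      | "\<not> (s = (l, i) \<and> r = q)" "\<not> (s = s' \<and> r = y)" by blast
    then show "\<iota> (Xop R (dn l c) f) x = Xop R c (\<iota> f) x"
    proof cases
      case 1
      show ?thesis
      proof (cases j)
        case (Suc k)
        show ?thesis
        proof (cases k)
          case (Suc k')
          have "(s', y, k) \<in> Idx (dn l c) \<longleftrightarrow> j < l"
            using \<open>j = Suc k\<close> Suc unfolding Idx_iff cnt_dn by (auto simp: s'_def)
          then show ?thesis using 1 \<open>j = Suc k\<close> Suc by (simp add: \<iota>_def sr Xop_def Idx_iff cnt)
        qed (use 1 Suc in \<open>simp add: \<iota>_def sr Xop_def\<close>)
      qed (use 1 in \<open>simp add: \<iota>_def sr Xop_def\<close>)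
    next
      case 2
      then show ?thesis using neq by (simp add: \<iota>_def sr Xop_def)
    next
      case 3
      have "(s, r, j) \<in> Idx (dn l c) \<longleftrightarrow> (s, r, j) \<in> Idx c"
        using 3 unfolding Idx_iff cnt_dn by (auto simp: y_def cnt y0)
      moreover have "\<iota> h (s, r, k) = h (s, r, k)" for h k
        unfolding \<iota>_def prod.case by (simp only: 3 if_False)
      ultimately show ?thesis by (simp add: sr Xop_def)
    qed
  qed
  have add: "\<iota> (vadd R f g) = vadd R (\<iota> f) (\<iota> g)" for f g
  proof
    fix x :: idx
    show "\<iota> (vadd R f g) x = vadd R (\<iota> f) (\<iota> g) x"
      by (cases x) (auto simp: \<iota>_def vadd_apply)
  qed
  have sm: "\<iota> (vsmult R a f) = vsmult R a (\<iota> f)" if "a \<in> carrier R" for f a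
  proof
    fix x :: idx
    show "\<iota> (vsmult R a f) x = vsmult R a (\<iota> f) x"
      using that by (cases x) (auto simp: \<iota>_def vsmult_apply)
  qed
  have m: "morph R n (dn l c) c \<iota>"
    unfolding morph_def using V hom X add sm by blast
  have surj: "\<exists>f\<in>Vec R (dn l c). \<iota> f = g" if g: "g \<in> Vec R c" "g ((l, i), q, 0) = \<zero>" for g
  proof
    define f where "f = (\<lambda>(s, r, j). if s = (l, i) \<and> r = q then \<zero>
        else if s = s' \<and> r = y then g ((l, i), q, Suc j) else g (s, r, j))"
    show "f \<in> Vec R (dn l c)"
    proof (rule VecI)
      fix x
      show "f x \<in> carrier R" by (cases x) (simp add: f_def Vec_closed[OF g(1)])
      assume x: "x \<notin> Idx (dn l c)"
      obtain s r j where sr: "x = (s, r, j)" by (cases x)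
      have "((l, i), q, Suc j) \<notin> Idx c" if "s = s'" "r = y"
        using x that neq unfolding sr Idx_iff cnt_dn by (auto simp: s'_def)
      moreover have "(s, r, j) \<notin> Idx c" if "\<not> (s = (l, i) \<and> r = q)" "\<not> (s = s' \<and> r = y)"
        using x that unfolding sr Idx_iff cnt_dn by (auto simp: y_def cnt y0 split: if_splits)
      ultimately show "f x = \<zero>"
        unfolding sr f_def by (auto intro: Vec_outside[OF g(1)])
    qed
    show "\<iota> f = g"
    proof
      fix x :: idx
      obtain s r j where sr: "x = (s, r, j)" by (cases x)
      have "g (s', y, j) = \<zero>" by (rule Vec_outside[OF g(1)]) (simp add: Idx_iff y_def)
      then show "\<iota> f x = g x"
        using g(2) neq by (cases j) (auto simp: \<iota>_def f_def sr)
    qed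
  qed
  have "inj_on \<iota> (Vec R (dn l c))"
  proof (rule inj_onI, rule ext)
    fix f g and x :: idx assume f: "f \<in> Vec R (dn l c)" and g: "g \<in> Vec R (dn l c)" and eq: "\<iota> f = \<iota> g"
    obtain s r j where sr: "x = (s, r, j)" by (cases x)
    consider "s = (l, i)" "r = q" | "s = s'" "r = y"
      | "\<not> (s = (l, i) \<and> r = q)" "\<not> (s = s' \<and> r = y)" by blast
    then show "f x = g x"
    proof cases
      case 1
      then have "x \<notin> Idx (dn l c)" by (simp add: sr Idx_iff cnt_dn)
      then show ?thesis using Vec_outside f g by metis
    next
      case 2
      then show ?thesis using fun_cong[OF eq, of "((l, i), q, Suc j)"] by (simp add: \<iota>_def sr)
    next
      case 3
      then show ?thesis using fun_cong[OF eq, of x] by (auto simp: \<iota>_def sr)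
    qed
  qed
  moreover have "\<iota> ` Vec R (dn l c) = {f \<in> Vec R c. f ((l, i), xx c l - 1, 0) = \<zero>}"
  proof (intro equalityI subsetI)
    fix g assume "g \<in> \<iota> ` Vec R (dn l c)"
    then show "g \<in> {f \<in> Vec R c. f ((l, i), xx c l - 1, 0) = \<zero>}"
      using V by (auto simp: \<iota>_def q_def)
  next
    fix g assume "g \<in> {f \<in> Vec R c. f ((l, i), xx c l - 1, 0) = \<zero>}"
    then show "g \<in> \<iota> ` Vec R (dn l c)" using surj[of g] by (auto simp: q_def)
  qed
  ultimately show ?thesis using m that by blast
qed

text \<open>The embedding of the coordinate hyperplane is composed with the inverse of the
  automorphism that makes the form a coordinate.\<close>

lemma Ker_type:
  assumes c: "valid_mseg n c" and \<mu>: "\<mu> \<in> Vec R c" and r1: "r1 < xx c l" "\<mu> ((l, i), r1, 0) \<noteq> \<zero>"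
    and min: "\<And>x. x \<in> heads i c \<Longrightarrow> \<mu> x \<noteq> \<zero> \<Longrightarrow> l \<le> fst (fst x)" and l: "1 \<le> l"
  obtains \<phi> where "morph R n (dn l c) c \<phi>" "inj_on \<phi> (Vec R (dn l c))" "\<phi> ` Vec R (dn l c) = Ker c \<mu>"
proof -
  have x: "0 < xx c l" using r1 by simp
  obtain \<alpha> where \<alpha>: "morph R n c c \<alpha>" "inj_on \<alpha> (Vec R c)"
    "\<And>f. f \<in> Vec R c \<Longrightarrow> \<alpha> f ((l, i), xx c l - 1, 0) = functional c \<mu> 0 f"
    using functional_normal_form[OF assms] by blast
  obtain \<iota> where \<iota>: "morph R n (dn l c) c \<iota>" "inj_on \<iota> (Vec R (dn l c))"
    "\<iota> ` Vec R (dn l c) = {f \<in> Vec R c. f ((l, i), xx c l - 1, 0) = \<zero>}"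
    using coordinate_kernel[OF c l x] by blast
  define \<beta> where "\<beta> = inv_into (Vec R c) \<alpha>"
  note \<beta> = morph_inverse[OF \<alpha>(1,2), folded \<beta>_def]
  have "\<beta> ` {f \<in> Vec R c. f ((l, i), xx c l - 1, 0) = \<zero>} = Ker c \<mu>"
  proof (intro equalityI subsetI)
    fix g assume "g \<in> \<beta> ` {f \<in> Vec R c. f ((l, i), xx c l - 1, 0) = \<zero>}"
    then obtain f where "f \<in> Vec R c" "f ((l, i), xx c l - 1, 0) = \<zero>" "g = \<beta> f" by blast
    then show "g \<in> Ker c \<mu>" using \<beta>(3)[of f] \<alpha>(3)[of g] by (simp add: Ker_def)
  next
    fix g assume "g \<in> Ker c \<mu>"
    then have g: "g \<in> Vec R c" "functional c \<mu> 0 g = \<zero>" by (auto simp: Ker_def)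
    then have "\<alpha> g \<in> {f \<in> Vec R c. f ((l, i), xx c l - 1, 0) = \<zero>}"
      using \<alpha>(3) morphD(1)[OF \<alpha>(1)] by simp
    then show "g \<in> \<beta> ` {f \<in> Vec R c. f ((l, i), xx c l - 1, 0) = \<zero>}"
      using \<beta>(4)[OF g(1)] by (intro image_eqI[of g \<beta> "\<alpha> g"]) simp_all
  qed
  then have "(\<lambda>f. \<beta> (\<iota> f)) ` Vec R (dn l c) = Ker c \<mu>"
    unfolding \<iota>(3)[symmetric] by (simp add: image_image)
  moreover have "inj_on (\<lambda>f. \<beta> (\<iota> f)) (Vec R (dn l c))"
    using comp_inj_on[OF \<iota>(2), of \<beta>] inj_on_subset[OF \<beta>(2)] \<iota>(3) by (auto simp: o_def)
  ultimately show ?thesis using that morph_compose[OF \<iota>(1) \<beta>(1)] by blast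
qed

end

context adjacent_vertices
begin

lemma dn_inj: "1 \<le> l \<Longrightarrow> 1 \<le> l' \<Longrightarrow> 0 < xx c l \<Longrightarrow> 0 < xx c l' \<Longrightarrow> dn l c = dn l' c \<Longrightarrow> l = l'"
  using xx_dn[of l c l] xx_dn[of l' c l] by (cases "l = l'") auto

end

section \<open>Counting kernels\<close>

context hall_vertex
begin

text \<open>The nonzero forms are sorted by the least length on which they do not vanish, because
  this length alone determines the type of the kernel.\<close>

definition Lam :: "mseg \<Rightarrow> nat \<Rightarrow> (idx \<Rightarrow> nat) set" where
  "Lam c l = {\<mu> \<in> Vec R c. (\<forall>x. \<mu> x \<noteq> \<zero> \<longrightarrow> x \<in> heads i c \<and> l \<le> fst (fst x))
    \<and> (\<exists>x. \<mu> x \<noteq> \<zero> \<and> fst (fst x) = l)}"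

lemma card_Lam:
  assumes "1 \<le> l"
  shows "card (Lam c l) = card (carrier R) ^ (size {#s \<in># c. snd s = i \<and> l < fst s#} + xx c l)
    - card (carrier R) ^ size {#s \<in># c. snd s = i \<and> l < fst s#}"
proof -
  define W where "W P = {f \<in> Vec R c. \<forall>x. f x \<noteq> \<zero> \<longrightarrow> x \<in> {x \<in> heads i c. P (fst x)}}" for P
  have W: "card (W P) = card (carrier R) ^ size {#s \<in># c. P s#}" if "\<And>s. P s \<Longrightarrow> snd s = i \<and> 0 < fst s" for P
    unfolding W_def using card_supported[of "{x \<in> heads i c. P (fst x)}" c] heads_subset
      card_heads_filter[OF that] by auto
  define ge :: "seg \<Rightarrow> bool" where "ge s \<longleftrightarrow> snd s = i \<and> l \<le> fst s" for s
  define gt :: "seg \<Rightarrow> bool" where "gt s \<longleftrightarrow> snd s = i \<and> l < fst s" for s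
  have hs: "snd (fst x) = i" if "x \<in> heads i c" for x using that by (auto simp: heads_def)
  have "W ge = {f \<in> Vec R c. \<forall>x. f x \<noteq> \<zero> \<longrightarrow> x \<in> heads i c \<and> l \<le> fst (fst x)}"
    and "W gt = {f \<in> Vec R c. \<forall>x. f x \<noteq> \<zero> \<longrightarrow> x \<in> heads i c \<and> l < fst (fst x)}"
    unfolding W_def ge_def gt_def using hs by blast+
  moreover have "l < fst (fst x) \<longleftrightarrow> fst (fst x) \<noteq> l" if "l \<le> fst (fst x)" for x :: idx
    using that by linarith
  ultimately have "Lam c l = W ge - W gt"
    unfolding Lam_def by blast
  moreover have "W gt \<subseteq> W ge" by (auto simp: W_def gt_def ge_def)
  moreover have "finite (W gt)" using finite_Vec by (auto simp: W_def)
  ultimately have "card (Lam c l) = card (W ge) - card (W gt)" by (simp add: card_Diff_subset)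
  moreover have "card (W ge) = card (carrier R) ^ size {#s \<in># c. ge s#}"
    using assms by (intro W) (auto simp: ge_def)
  moreover have "card (W gt) = card (carrier R) ^ size {#s \<in># c. gt s#}"
    using assms by (intro W) (auto simp: gt_def)
  moreover have "size {#s \<in># c. ge s#} = size {#s \<in># c. gt s#} + xx c l"
    unfolding ge_def gt_def size_filter_ge xx_def by simp
  ultimately show ?thesis by (simp add: gt_def)
qed

lemma Ker_eq_iff:
  assumes \<mu>: "\<mu> \<in> Lam c l" and \<nu>: "\<nu> \<in> Lam c l"
  shows "Ker c \<nu> = Ker c \<mu> \<longleftrightarrow> (\<exists>a\<in>carrier R - {\<zero>}. \<nu> = vsmult R a \<mu>)"
proof
  have V: "\<mu> \<in> Vec R c" "\<nu> \<in> Vec R c" using \<mu> \<nu> by (auto simp: Lam_def)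
  obtain h where h: "\<mu> h \<noteq> \<zero>" "h \<in> heads i c" using \<mu> by (auto simp: Lam_def)
  have unit_V: "unit x \<in> Vec R c" if "x \<in> heads i c" for x
    using that heads_subset by (intro unit_Vec) blast
  note cl = Vec_closed[OF V(1)] Vec_closed[OF V(2)]
  {
    assume K: "Ker c \<nu> = Ker c \<mu>"
    have \<mu>h: "\<mu> h \<in> Units R" using h(1) cl field_Units by simp
    have rel: "\<nu> x \<otimes> \<mu> h = \<nu> h \<otimes> \<mu> x" if x: "x \<in> heads i c" for x
    proof -
      \<comment> \<open>The test vector \<mu>(h) e_x - \<mu>(x) e_h lies in the kernel of \<mu>,
        hence in that of \<nu>; this makes the two forms proportional.\<close>
      define f where "f = vadd R (vsmult R (\<mu> h) (unit x)) (vsmult R (\<ominus> \<mu> x) (unit h))"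
      have f: "f \<in> Vec R c" using unit_V x h(2) cl by (simp add: f_def)
      have val: "functional c \<kappa> 0 f = \<mu> h \<otimes> \<kappa> x \<oplus> (\<ominus> \<mu> x) \<otimes> \<kappa> h" if "\<kappa> \<in> Vec R c" for \<kappa>
        using unit_V[OF x] unit_V[OF h(2)] cl that
        by (simp add: f_def functional_add functional_smult functional_unit x h(2))
      have "functional c \<mu> 0 f = \<zero>"
      proof -
        have "(\<ominus> \<mu> x) \<otimes> \<mu> h = \<ominus> (\<mu> h \<otimes> \<mu> x)" using cl by (simp add: l_minus m_comm[of "\<mu> x"])
        then show ?thesis unfolding val[OF V(1)] using cl by (simp add: r_neg)
      qed
      then have "f \<in> Ker c \<nu>" using f K by (simp add: Ker_def)
      then have "\<mu> h \<otimes> \<nu> x \<oplus> (\<ominus> \<mu> x) \<otimes> \<nu> h = \<zero>" using val[OF V(2)] by (simp add: Ker_def)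
      then have "\<mu> h \<otimes> \<nu> x = \<mu> x \<otimes> \<nu> h"
        using cl by (metis a_inv_closed l_minus m_closed minus_equality minus_minus a_comm)
      then show ?thesis using cl by (simp add: m_comm)
    qed
    define a where "a = \<nu> h \<otimes> inv (\<mu> h)"
    have a: "a \<in> carrier R" using \<mu>h cl by (simp add: a_def)
    have "\<nu> x = a \<otimes> \<mu> x" for x
    proof (cases "x \<in> heads i c")
      case True
      have "\<nu> x = \<nu> x \<otimes> \<mu> h \<otimes> inv (\<mu> h)" using \<mu>h cl by (simp add: m_assoc)
      also have "\<dots> = a \<otimes> \<mu> x" unfolding rel[OF True] using \<mu>h cl by (simp add: a_def m_ac)
      finally show ?thesis .
    next
      case False
      then have "\<mu> x = \<zero>" "\<nu> x = \<zero>" using \<mu> \<nu> by (auto simp: Lam_def)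
      then show ?thesis using a by simp
    qed
    then have eq: "\<nu> = vsmult R a \<mu>" by (simp add: fun_eq_iff vsmult_def)
    moreover have "a \<noteq> \<zero>"
    proof
      assume "a = \<zero>"
      then have "\<nu> = vzero R" using eq vsmult_zero[OF V(1)] by simp
      then show False using \<nu> by (auto simp: Lam_def vzero_def)
    qed
    ultimately show "\<exists>a\<in>carrier R - {\<zero>}. \<nu> = vsmult R a \<mu>" using a by blast
  next
    assume "\<exists>a\<in>carrier R - {\<zero>}. \<nu> = vsmult R a \<mu>"
    then obtain a where a: "a \<in> carrier R" "a \<noteq> \<zero>" "\<nu> = vsmult R a \<mu>" by blast
    have "functional c \<nu> 0 f = \<zero> \<longleftrightarrow> functional c \<mu> 0 f = \<zero>" if f: "f \<in> Vec R c" for f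
    proof -
      have "functional c \<nu> 0 f = a \<otimes> functional c \<mu> 0 f"
        unfolding functional_def using a Vec_closed[OF f] cl
        by (subst finsum_rdistr) (auto simp: vsmult_def m_assoc)
      then show ?thesis using a functional_closed[OF V(1) f] integral by auto
    qed
    then show "Ker c \<nu> = Ker c \<mu>" by (auto simp: Ker_def)
  }
qed

text \<open>By \<open>Ker_eq_iff\<close> the fibres of the kernel map are orbits of the nonzero
  scalars, with q - 1 elements each.\<close>

lemma card_Ker_image:
  "card (Ker c ` Lam c l) * (card (carrier R) - 1) = card (Lam c l)"
proof -
  have fin: "finite (Lam c l)" using finite_Vec by (auto simp: Lam_def)
  have fibre: "card {\<nu> \<in> Lam c l. Ker c \<nu> = U} = card (carrier R) - 1" if "U \<in> Ker c ` Lam c l" for U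
  proof -
    from that obtain \<mu> where \<mu>: "\<mu> \<in> Lam c l" and U: "U = Ker c \<mu>" by blast
    have V: "\<mu> \<in> Vec R c" using \<mu> by (auto simp: Lam_def)
    note cl = Vec_closed[OF V]
    have "vsmult R a \<mu> \<in> Lam c l" if "a \<in> carrier R" "a \<noteq> \<zero>" for a
    proof -
      have "a \<otimes> \<mu> x = \<zero> \<longleftrightarrow> \<mu> x = \<zero>" for x using that cl by (simp add: integral_iff)
      then show ?thesis using \<mu> that by (simp add: Lam_def vsmult_apply)
    qed
    then have "{\<nu> \<in> Lam c l. Ker c \<nu> = U} = (\<lambda>a. vsmult R a \<mu>) ` (carrier R - {\<zero>})"
      using Ker_eq_iff[OF \<mu>] unfolding U by blast
    also have "card \<dots> = card (carrier R - {\<zero>})"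
    proof (intro card_image inj_onI)
      fix a b assume ab: "a \<in> carrier R - {\<zero>}" "b \<in> carrier R - {\<zero>}" "vsmult R a \<mu> = vsmult R b \<mu>"
      obtain x where "\<mu> x \<noteq> \<zero>" using \<mu> by (auto simp: Lam_def)
      moreover have "a \<otimes> \<mu> x = b \<otimes> \<mu> x" using fun_cong[OF ab(3)] by (simp add: vsmult_apply)
      ultimately show "a = b" using ab cl by (simp add: m_rcancel)
    qed
    finally show ?thesis using finite_carrier by (simp add: card_Diff_singleton)
  qed
  have "card (Lam c l) = (\<Sum>\<mu>\<in>Lam c l. 1)" by simp
  also have "\<dots> = (\<Sum>U\<in>Ker c ` Lam c l. \<Sum>\<nu>\<in>{\<nu> \<in> Lam c l. Ker c \<nu> = U}. 1)"
    by (rule sum.image_gen[OF fin])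
  also have "\<dots> = (\<Sum>U\<in>Ker c ` Lam c l. card (carrier R) - 1)"
    using fibre by (intro sum.cong) auto
  finally show ?thesis by simp
qed

lemma Lam_type:
  assumes c: "valid_mseg n c" and \<mu>: "\<mu> \<in> Lam c l"
  obtains \<phi> where "1 \<le> l" "0 < xx c l" "morph R n (dn l c) c \<phi>" "inj_on \<phi> (Vec R (dn l c))"
    "\<phi> ` Vec R (dn l c) = Ker c \<mu>"
proof -
  obtain x where x: "\<mu> x \<noteq> \<zero>" "fst (fst x) = l" "x \<in> heads i c" using \<mu> by (auto simp: Lam_def)
  then have r: "x = ((l, i), fst (snd x), 0)" "fst (snd x) < count c (l, i)" "0 < l"
    by (cases x; auto simp: heads_def Idx_iff)+
  have \<mu>x: "\<mu> ((l, i), fst (snd x), 0) \<noteq> \<zero>" using x(1) r(1) by metis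
  obtain \<phi> where "morph R n (dn l c) c \<phi>" "inj_on \<phi> (Vec R (dn l c))" "\<phi> ` Vec R (dn l c) = Ker c \<mu>"
    by (rule Ker_type[of c \<mu> "fst (snd x)" l]) (use \<mu> \<mu>x r c in \<open>auto simp: Lam_def xx_def\<close>)
  moreover have "1 \<le> l" "0 < xx c l" using r(2,3) unfolding xx_def by linarith+
  ultimately show ?thesis using that by blast
qed

text \<open>The kernel of a morphism onto the simple module is the kernel of a form in some
  \<open>Lam c l\<close> and has type \<open>dn l c\<close>; \<open>submodule_type_unique\<close>
  excludes every other type.\<close>

lemma hall_count_eq:
  assumes b: "valid_mseg n b" and c: "valid_mseg n c"
  shows "hall_count R n simple b c = card (\<Union>l\<in>{l. 1 \<le> l \<and> 0 < xx c l \<and> dn l c = b}. Ker c ` Lam c l)"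
proof -
  have "{U. \<exists>\<phi> \<psi>. morph R n b c \<phi> \<and> inj_on \<phi> (Vec R b) \<and> \<phi> ` Vec R b = U \<and>
      morph R n c simple \<psi> \<and> \<psi> ` Vec R c = Vec R simple \<and> {f \<in> Vec R c. \<psi> f = vzero R} = U}
    = (\<Union>l\<in>{l. 1 \<le> l \<and> 0 < xx c l \<and> dn l c = b}. Ker c ` Lam c l)"
  proof (intro equalityI subsetI)
    fix U assume "U \<in> {U. \<exists>\<phi> \<psi>. morph R n b c \<phi> \<and> inj_on \<phi> (Vec R b) \<and> \<phi> ` Vec R b = U \<and>
      morph R n c simple \<psi> \<and> \<psi> ` Vec R c = Vec R simple \<and> {f \<in> Vec R c. \<psi> f = vzero R} = U}"
    then obtain \<phi> \<psi> where \<phi>: "morph R n b c \<phi>" "inj_on \<phi> (Vec R b)" "\<phi> ` Vec R b = U"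
      and \<psi>: "morph R n c simple \<psi>" "\<psi> ` Vec R c = Vec R simple" "{f \<in> Vec R c. \<psi> f = vzero R} = U"
      by blast
    define \<mu> where "\<mu> = (\<lambda>x. if x \<in> heads i c then \<psi> (unit x) z0 else \<zero>)"
    have \<mu>: "\<mu> \<in> Vec R c"
      using heads_subset Vec_closed[OF morphD(1)[OF \<psi>(1)]] by (intro VecI) (auto simp: \<mu>_def subset_iff)
    have \<psi>\<mu>: "\<psi> f z0 = functional c \<mu> 0 f" if "f \<in> Vec R c" for f
      unfolding \<mu>_def by (rule morph_simple[OF c \<psi>(1) that])
    have U: "U = Ker c \<mu>"
    proof -
      have "\<psi> f = vzero R \<longleftrightarrow> functional c \<mu> 0 f = \<zero>" if f: "f \<in> Vec R c" for f
        using \<psi>\<mu>[OF f] Vec_outside[OF morphD(1)[OF \<psi>(1) f]]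
        by (auto simp: vzero_def fun_eq_iff[of "\<psi> f"] Idx_simple) (metis singletonD)
      then show ?thesis unfolding \<psi>(3)[symmetric] Ker_def by blast
    qed
    have "unit z0 \<in> \<psi> ` Vec R c"
      using \<psi>(2) unit_Vec[of z0 simple] by (simp add: Idx_simple)
    then obtain f where "f \<in> Vec R c" "\<psi> f = unit z0" by (metis imageE)
    then have "functional c \<mu> 0 f \<noteq> \<zero>" using \<psi>\<mu>[of f] one_not_zero by (simp add: unit_def)
    then obtain x where x: "x \<in> heads i c" "\<mu> x \<noteq> \<zero>"
      using functional_eq_zero[OF \<mu>, of f 0] \<open>f \<in> Vec R c\<close> by blast
    define l where "l = Min ((\<lambda>x. fst (fst x)) ` {x \<in> heads i c. \<mu> x \<noteq> \<zero>})"
    have "l \<in> (\<lambda>x. fst (fst x)) ` {x \<in> heads i c. \<mu> x \<noteq> \<zero>}"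
      unfolding l_def using x by (intro Min_in) auto
    moreover have "l \<le> fst (fst x)" if "x \<in> heads i c" "\<mu> x \<noteq> \<zero>" for x
      unfolding l_def using that by (intro Min_le) auto
    moreover have "\<mu> x \<noteq> \<zero> \<Longrightarrow> x \<in> heads i c" for x
      by (rule ccontr) (simp add: \<mu>_def)
    ultimately have Lam: "\<mu> \<in> Lam c l" using \<mu> by (auto simp: Lam_def)
    from c Lam obtain \<phi>' where \<phi>': "1 \<le> l" "0 < xx c l" "morph R n (dn l c) c \<phi>'"
      "inj_on \<phi>' (Vec R (dn l c))" "\<phi>' ` Vec R (dn l c) = Ker c \<mu>" by (rule Lam_type)
    have "valid_mseg n (dn l c)" using valid_dn[OF \<phi>'(1,2)] c by simp
    then have "b = dn l c"
      using submodule_type_unique[OF \<phi> b \<phi>'(3,4)] \<phi>'(5) U by simp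
    then show "U \<in> (\<Union>l\<in>{l. 1 \<le> l \<and> 0 < xx c l \<and> dn l c = b}. Ker c ` Lam c l)"
      using Lam U \<phi>' by blast
  next
    fix U assume "U \<in> (\<Union>l\<in>{l. 1 \<le> l \<and> 0 < xx c l \<and> dn l c = b}. Ker c ` Lam c l)"
    then obtain l \<mu> where l: "dn l c = b" and \<mu>: "\<mu> \<in> Lam c l" and U: "U = Ker c \<mu>" by blast
    from c \<mu> obtain \<phi> where \<phi>: "1 \<le> l" "0 < xx c l" "morph R n (dn l c) c \<phi>"
      "inj_on \<phi> (Vec R (dn l c))" "\<phi> ` Vec R (dn l c) = Ker c \<mu>" by (rule Lam_type)
    obtain h where "h \<in> heads i c" "\<mu> h \<noteq> \<zero>" using \<mu> by (auto simp: Lam_def)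
    moreover have "\<mu> \<in> Vec R c" using \<mu> by (simp add: Lam_def)
    ultimately have \<psi>: "\<exists>\<psi>. morph R n c simple \<psi> \<and> \<psi> ` Vec R c = Vec R simple
        \<and> {f \<in> Vec R c. \<psi> f = vzero R} = Ker c \<mu>"
      using morph_of_functional[OF c] by blast
    show "U \<in> {U. \<exists>\<phi> \<psi>. morph R n b c \<phi> \<and> inj_on \<phi> (Vec R b) \<and> \<phi> ` Vec R b = U \<and>
      morph R n c simple \<psi> \<and> \<psi> ` Vec R c = Vec R simple \<and> {f \<in> Vec R c. \<psi> f = vzero R} = U}"
      using \<psi> \<phi>(3-5)[unfolded l] U by blast
  qed
  then show ?thesis by (simp add: hall_count_def)
qed

lemma hall_count_dn:
  assumes c: "valid_mseg n c" and l: "1 \<le> l" "0 < xx c l"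
  shows "hall_count R n simple (dn l c) c * (card (carrier R) - 1)
    = card (carrier R) ^ (size {#s \<in># c. snd s = i \<and> l < fst s#} + xx c l)
    - card (carrier R) ^ size {#s \<in># c. snd s = i \<and> l < fst s#}"
proof -
  have "{l'. 1 \<le> l' \<and> 0 < xx c l' \<and> dn l' c = dn l c} = {l}"
    using l dn_inj[of _ l c] by auto
  then show ?thesis
    using hall_count_eq[of "dn l c" c] valid_dn[OF l] c card_Ker_image[of c l] card_Lam[OF l(1)] by simp
qed

lemma hall_count_zero:
  "valid_mseg n b \<Longrightarrow> valid_mseg n c \<Longrightarrow> (\<And>l. 1 \<le> l \<Longrightarrow> 0 < xx c l \<Longrightarrow> dn l c \<noteq> b)
    \<Longrightarrow> hall_count R n simple b c = 0"
proof -
  assume b: "valid_mseg n b" and c: "valid_mseg n c"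
    and "\<And>l. 1 \<le> l \<Longrightarrow> 0 < xx c l \<Longrightarrow> dn l c \<noteq> b"
  then have "{l. 1 \<le> l \<and> 0 < xx c l \<and> dn l c = b} = {}" by blast
  then show ?thesis unfolding hall_count_eq[OF b c] by (simp only: image_empty Union_empty card.empty)
qed

end

section \<open>Prime fields and Hall polynomials\<close>

definition prime_field :: "nat \<Rightarrow> nat ring" where
  "prime_field p = \<lparr>carrier = {..<p}, mult = (\<lambda>a b. a * b mod p), one = 1, zero = 0,
    add = (\<lambda>a b. (a + b) mod p)\<rparr>"

lemma field_prime_field:
  assumes "prime p" shows "field (prime_field p)"
proof -
  have p: "1 < p" using assms prime_gt_1_nat by simp
  have "cring (prime_field p)"
  proof (intro cringI abelian_groupI comm_monoidI)
    fix a assume "a \<in> carrier (prime_field p)"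
    then have "a < p" by (simp add: prime_field_def)
    then show "\<exists>b\<in>carrier (prime_field p). b \<oplus>\<^bsub>prime_field p\<^esub> a = \<zero>\<^bsub>prime_field p\<^esub>"
      by (intro bexI[of _ "(p - a) mod p"]) (auto simp: prime_field_def mod_simps)
  qed (use p in \<open>auto simp: prime_field_def mod_simps algebra_simps\<close>)
  then show ?thesis
  proof (rule cring.cring_fieldI2)
    show "\<zero>\<^bsub>prime_field p\<^esub> \<noteq> \<one>\<^bsub>prime_field p\<^esub>" by (simp add: prime_field_def)
    fix a assume "a \<in> carrier (prime_field p)" "a \<noteq> \<zero>\<^bsub>prime_field p\<^esub>"
    then have a: "a < p" "a \<noteq> 0" by (auto simp: prime_field_def)
    then have "\<not> p dvd a" by (simp add: nat_dvd_not_less)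
    then have "coprime a p" using assms prime_imp_coprime coprime_commute by blast
    then obtain b y where "a * b = p * y + 1"
      using bezout_nat[OF a(2), of p] by (auto simp: coprime_iff_gcd_eq_1)
    then have "a * b mod p = 1" using p mod_mult_self4[of p y 1] by simp
    then show "\<exists>b\<in>carrier (prime_field p). a \<otimes>\<^bsub>prime_field p\<^esub> b = \<one>\<^bsub>prime_field p\<^esub>"
      using p by (intro bexI[of _ "b mod p"]) (auto simp: prime_field_def mod_simps)
  qed
qed

text \<open>The definite description needs uniqueness: two candidates agree at the orders of all
  prime fields, that is, at infinitely many points.\<close>

lemma hall_poly_eqI:
  assumes "\<And>R :: nat ring. field R \<Longrightarrow> finite (carrier R)
    \<Longrightarrow> poly P (int (card (carrier R))) = int (hall_count R n a b c)"
  shows "hall_poly n a b c = P"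
  unfolding hall_poly_def
proof (rule the_equality)
  fix Q assume Q: "\<forall>R :: nat ring. field R \<and> finite (carrier R) \<longrightarrow>
    poly Q (int (card (carrier R))) = int (hall_count R n a b c)"
  have "poly (Q - P) (int p) = 0" if "prime p" for p
  proof -
    have "finite (carrier (prime_field p))" "card (carrier (prime_field p)) = p"
      by (simp_all add: prime_field_def)
    then show ?thesis
      using Q assms[of "prime_field p"] field_prime_field[OF that] by auto
  qed
  then have "int ` {p. prime p} \<subseteq> {x. poly (Q - P) x = 0}" by auto
  moreover have "infinite (int ` {p :: nat. prime p})"
    using primes_infinite by (subst finite_image_iff) auto
  ultimately have "infinite {x. poly (Q - P) x = 0}" using finite_subset by blast
  then show "Q = P" using poly_roots_finite[of "Q - P"] by auto
qed (use assms in blast)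

context cyclic_vertex
begin

lemma hall_poly_dn:
  assumes c: "valid_mseg n c" and l: "1 \<le> l" "0 < xx c l"
  shows "hall_poly n {#(1, i)#} (dn l c) c
    = monom 1 (size {#s \<in># c. snd s = i \<and> l < fst s#}) * (\<Sum>j<xx c l. monom 1 j)"
proof (rule hall_poly_eqI)
  fix R :: "nat ring" assume R: "field R" "finite (carrier R)"
  interpret field R by fact
  interpret hall_vertex n i R by unfold_locales fact
  define q where "q = int (card (carrier R))"
  define G where "G = size {#s \<in># c. snd s = i \<and> l < fst s#}"
  have q: "1 < q" using card_carrier by (simp add: q_def)
  have "int (hall_count R n simple (dn l c) c) * (q - 1) = q ^ (G + xx c l) - q ^ G"
  proof -
    have "int (card (carrier R) - 1) = q - 1" using card_carrier by (simp add: q_def of_nat_diff)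
    moreover have "card (carrier R) ^ G \<le> card (carrier R) ^ (G + xx c l)"
      using card_carrier by (intro power_increasing) auto
    ultimately show ?thesis
      using arg_cong[OF hall_count_dn[OF c l], of int]
      by (simp add: G_def q_def of_nat_diff del: of_nat_diff_if)
  qed
  also have "\<dots> = q ^ G * (\<Sum>j<xx c l. q ^ j) * (q - 1)"
  proof -
    have "q ^ (G + xx c l) - q ^ G = q ^ G * (q ^ xx c l - 1)"
      by (simp add: power_add right_diff_distrib)
    then show ?thesis unfolding power_diff_1_eq by (simp only: mult_ac)
  qed
  finally show "poly (monom 1 (size {#s \<in># c. snd s = i \<and> l < fst s#}) * (\<Sum>j<xx c l. monom 1 j))
      (int (card (carrier R))) = int (hall_count R n {#(1, i)#} (dn l c) c)"
    using q by (simp add: poly_sum poly_monom simple_def flip: q_def G_def)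
qed

lemma hall_poly_zero:
  assumes "valid_mseg n b" "valid_mseg n c" "\<And>l. 1 \<le> l \<Longrightarrow> 0 < xx c l \<Longrightarrow> dn l c \<noteq> b"
  shows "hall_poly n {#(1, i)#} b c = 0"
proof (rule hall_poly_eqI)
  fix R :: "nat ring" assume R: "field R" "finite (carrier R)"
  interpret field R by fact
  interpret hall_vertex n i R by unfold_locales fact
  show "poly 0 (int (card (carrier R))) = int (hall_count R n {#(1, i)#} b c)"
    using hall_count_zero[OF assms] by (simp add: simple_def)
qed

end

section \<open>Endomorphism algebras and the normalization of the PBW basis\<close>

text \<open>The dimension of Hom(k[s], k[t]): the head of s may go to vector j of t if the vertices
  agree and X to the power of the length of s kills that vector.\<close>

definition hom_dim :: "nat \<Rightarrow> seg \<Rightarrow> seg \<Rightarrow> nat" where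
  "hom_dim n s t = card {j. j < fst t \<and> fst t \<le> j + fst s
    \<and> (int (snd t) - int j) mod int n = int (snd s) mod int n}"

interpretation rat_mat: vector_space "\<lambda>(c::rat) (M :: 'a \<Rightarrow> rat). (\<lambda>p. c * M p)"
  by unfold_locales (auto simp: fun_eq_iff algebra_simps)

lemma sum_fun_apply: "(\<Sum>a\<in>A. f a) x = (\<Sum>a\<in>A. f a x :: rat)"
  by (induction A rule: infinite_finite_induct) auto

lemma dim_by_coordinates:
  fixes V :: "('a \<Rightarrow> rat) set"
  assumes "finite P" "\<And>p. p \<in> P \<Longrightarrow> E p \<in> V"
    and coord: "\<And>p p'. p \<in> P \<Longrightarrow> p' \<in> P \<Longrightarrow> E p (c p') = (if p = p' then 1 else 0)"
    and span: "\<And>M x. M \<in> V \<Longrightarrow> M x = (\<Sum>p\<in>P. M (c p) * E p x)"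
  shows "rat_mat.dim V = card P"
proof -
  have inj: "inj_on E P"
    by (rule inj_onI) (metis coord zero_neq_one)
  have "rat_mat.independent (E ` P)"
    unfolding rat_mat.independent_explicit_module
  proof (intro allI impI)
    fix t u v assume t: "finite t" "t \<subseteq> E ` P" "(\<Sum>v\<in>t. (\<lambda>p. u v * v p)) = 0" and v: "v \<in> t"
    from v t obtain p where p: "p \<in> P" "v = E p" by blast
    have "0 = (\<Sum>w\<in>t. (\<lambda>p. u w * w p)) (c p)" by (simp only: t(3) zero_fun_apply)
    also have "\<dots> = (\<Sum>w\<in>t. u w * w (c p))" by (rule sum_fun_apply)
    also have "\<dots> = (\<Sum>w\<in>t. if w = v then u v else 0)"
      using t(2) p coord by (intro sum.cong refl) (auto split: if_splits)
    also have "\<dots> = u v" using t(1) v by simp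
    finally show "u v = 0" by simp
  qed
  moreover have "V \<subseteq> rat_mat.span (E ` P)"
  proof
    fix M assume "M \<in> V"
    then have "M = (\<Sum>p\<in>P. (\<lambda>x. M (c p) * E p x))"
      by (intro ext) (simp add: sum_fun_apply span[of M])
    also have "\<dots> \<in> rat_mat.span (E ` P)"
      by (intro rat_mat.span_sum rat_mat.span_scale rat_mat.span_base) auto
    finally show "M \<in> rat_mat.span (E ` P)" .
  qed
  ultimately have "rat_mat.dim V = card (E ` P)"
    using assms(2) by (intro rat_mat.dim_unique) auto
  then show ?thesis using inj by (simp add: card_image)
qed

text \<open>Each row and column of \<open>Xmat\<close> has at most one nonzero entry. If
  \<open>Suc k\<close> is the length of s, the left entry is 0 by the first clause, so the second
  clause also contains the annihilation condition.\<close>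

lemma End_mats_iff:
  "M \<in> End_mats n m \<longleftrightarrow>
    (\<forall>x y. M (x, y) \<noteq> 0 \<longrightarrow> x \<in> Idx m \<and> y \<in> Idx m \<and> vertex n x = vertex n y) \<and>
    (\<forall>t q j s r k. (t, q, j) \<in> Idx m \<and> (s, r, k) \<in> Idx m \<longrightarrow>
      M ((t, q, j), (s, r, Suc k)) = (if j = 0 then 0 else M ((t, q, j - 1), (s, r, k))))"
  (is "?L \<longleftrightarrow> ?S \<and> ?C")
proof -
  have "(\<forall>x y. (\<Sum>z\<in>Idx m. M (x, z) * Xmat m (z, y)) = (\<Sum>z\<in>Idx m. Xmat m (x, z) * M (z, y))) \<longleftrightarrow> ?C"
    if S: ?S
  proof -
    have z: "M (x, y) = 0" if "x \<notin> Idx m \<or> y \<notin> Idx m" for x y using S that by blast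
    have 1: "(\<Sum>z\<in>Idx m. M (x, z) * Xmat m (z, (s, r, k))) = (if (s, r, k) \<in> Idx m then M (x, (s, r, Suc k)) else 0)" for x s r k
    proof -
      have "(\<Sum>z\<in>Idx m. M (x, z) * Xmat m (z, (s, r, k)))
          = (\<Sum>z\<in>Idx m. if z = (s, r, Suc k) then (if (s, r, k) \<in> Idx m then M (x, (s, r, Suc k)) else 0) else 0)"
        by (intro sum.cong) (auto simp: Xmat_def)
      then show ?thesis using z[of x "(s, r, Suc k)"] by simp
    qed
    have 2: "(\<Sum>z\<in>Idx m. Xmat m ((t, q, j), z) * M (z, y))
        = (if j = 0 \<or> (t, q, j) \<notin> Idx m then 0 else M ((t, q, j - 1), y))" for t q j y
    proof (cases "j = 0 \<or> (t, q, j) \<notin> Idx m")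
      case True
      then show ?thesis by (auto simp: Xmat_def intro!: sum.neutral)
    next
      case False
      have "(\<Sum>z\<in>Idx m. Xmat m ((t, q, j), z) * M (z, y)) = (\<Sum>z\<in>Idx m. if z = (t, q, j - 1) then M ((t, q, j - 1), y) else 0)"
        using False by (intro sum.cong) (auto simp: Xmat_def split: prod.splits)
      moreover have "(t, q, j - 1) \<in> Idx m" using False by (auto simp: Idx_iff)
      ultimately show ?thesis using False by simp
    qed
    show ?thesis
    proof
      assume C: "\<forall>x y. (\<Sum>z\<in>Idx m. M (x, z) * Xmat m (z, y)) = (\<Sum>z\<in>Idx m. Xmat m (x, z) * M (z, y))"
      show ?C
      proof (intro allI impI)
        fix t q j s r k assume "(t, q, j) \<in> Idx m \<and> (s, r, k) \<in> Idx m"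
        then show "M ((t, q, j), (s, r, Suc k)) = (if j = 0 then 0 else M ((t, q, j - 1), (s, r, k)))"
          using C[rule_format, of "(t, q, j)" "(s, r, k)"] unfolding 1 2 by simp
      qed
    next
      assume C: ?C
      show "\<forall>x y. (\<Sum>z\<in>Idx m. M (x, z) * Xmat m (z, y)) = (\<Sum>z\<in>Idx m. Xmat m (x, z) * M (z, y))"
      proof (intro allI)
        fix x y :: idx
        obtain t q j s r k where xy: "x = (t, q, j)" "y = (s, r, k)" by (cases x; cases y)
        show "(\<Sum>z\<in>Idx m. M (x, z) * Xmat m (z, y)) = (\<Sum>z\<in>Idx m. Xmat m (x, z) * M (z, y))"
          unfolding xy 1 2 using C[rule_format, of t q j s r k] z by (cases "(t, q, j) \<in> Idx m"; cases "(s, r, k) \<in> Idx m") auto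
      qed
    qed
  qed
  then show ?thesis unfolding End_mats_def by blast
qed

text \<open>A basis of the endomorphisms: send the head of one copy of a segment to a basis vector
  annihilated by the same power of the nilpotent operator, and all other heads to 0.\<close>

definition hom_index :: "nat \<Rightarrow> mseg \<Rightarrow> ((seg \<times> nat) \<times> (seg \<times> nat) \<times> nat) set" where
  "hom_index n m = (SIGMA a:(SIGMA s:set_mset m. {..<count m s}). SIGMA b:(SIGMA t:set_mset m. {..<count m t}).
    {j. j < fst (fst b) \<and> fst (fst b) \<le> j + fst (fst a)
      \<and> (int (snd (fst b)) - int j) mod int n = int (snd (fst a)) mod int n})"

definition hom_basis :: "(seg \<times> nat) \<times> (seg \<times> nat) \<times> nat \<Rightarrow> idx \<times> idx \<Rightarrow> rat" where
  "hom_basis = (\<lambda>((s, r), (t, q), j) ((t', q', j'), (s', r', k)).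
    if s' = s \<and> r' = r \<and> t' = t \<and> q' = q \<and> k < fst s \<and> j' < fst t \<and> j' = j + k then 1 else 0)"

definition hom_coord :: "(seg \<times> nat) \<times> (seg \<times> nat) \<times> nat \<Rightarrow> idx \<times> idx" where
  "hom_coord = (\<lambda>((s, r), (t, q), j). ((t, q, j), (s, r, 0)))"

lemma sum_copies:
  "(\<Sum>a\<in>(SIGMA s:set_mset m. {..<count m s}). f (fst a)) = (\<Sum>s\<in>#m. f s)"
  for f :: "'a \<Rightarrow> nat"
proof -
  have "(\<Sum>a\<in>(SIGMA s:set_mset m. {..<count m s}). f (fst a)) = (\<Sum>s\<in>set_mset m. \<Sum>r<count m s. f s)"
    by (subst sum.Sigma) (auto simp: case_prod_unfold)
  also have "\<dots> = (\<Sum>s\<in>#m. f s)"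
  proof (induction m)
    case (add x m)
    have "(\<Sum>s\<in>set_mset (add_mset x m). count (add_mset x m) s * f s)
        = (\<Sum>s\<in>insert x (set_mset m). count m s * f s + (if s = x then f x else 0))"
      by (intro sum.cong) auto
    also have "\<dots> = (\<Sum>s\<in>insert x (set_mset m). count m s * f s) + f x"
      by (simp add: sum.distrib)
    also have "(\<Sum>s\<in>insert x (set_mset m). count m s * f s) = (\<Sum>s\<in>set_mset m. count m s * f s)"
      by (rule sum.mono_neutral_right) (auto simp: not_in_iff)
    finally show ?case using add by simp
  qed simp
  finally show ?thesis .
qed

lemma eps_eq:
  assumes n: "1 \<le> n" and m: "valid_mseg n m"
  shows "eps n m = (\<Sum>s\<in>#m. \<Sum>t\<in>#m. hom_dim n s t)"
proof -
  define C where "C = (SIGMA s:set_mset m. {..<count m s})"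
  have fin: "finite {j. j < fst (fst b) \<and> Q j}" for b :: "seg \<times> nat" and Q
    by (rule finite_subset[of _ "{..<fst (fst b)}"]) auto
  have "rat_mat.dim (End_mats n m) = card (hom_index n m)"
  proof (rule dim_by_coordinates[of _ hom_basis _ hom_coord])
    show "finite (hom_index n m)" unfolding hom_index_def by (intro finite_SigmaI fin) auto
  next
    fix p assume "p \<in> hom_index n m"
    then obtain s r t q j where p: "p = ((s, r), (t, q), j)" and
      j: "r < count m s" "q < count m t" "j < fst t" "fst t \<le> j + fst s"
        "(int (snd t) - int j) mod int n = int (snd s) mod int n"
      by (auto simp: hom_index_def)
    show "hom_basis p \<in> End_mats n m"
      unfolding End_mats_iff
    proof (intro conjI allI impI)
      fix x y assume nz: "hom_basis p (x, y) \<noteq> 0"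
      obtain t' q' j' s' r' k where xy: "x = (t', q', j')" "y = (s', r', k)" by (cases x; cases y)
      have e: "s' = s" "r' = r" "t' = t" "q' = q" "k < fst s" "j' < fst t" "j' = j + k"
        using nz by (auto simp: hom_basis_def p xy split: if_splits)
      show "x \<in> Idx m" "y \<in> Idx m" using e j by (auto simp: xy Idx_iff)
      have "(int (snd t) - int j') mod int n = ((int (snd t) - int j) - int k) mod int n"
        using e by (simp add: algebra_simps)
      also have "\<dots> = (int (snd s) - int k) mod int n"
        using j(5) by (metis mod_diff_left_eq)
      finally show "vertex n x = vertex n y" using e by (simp add: vertex_def xy)
    next
      fix t' q' j' s' r' k assume I: "(t', q', j') \<in> Idx m \<and> (s', r', k) \<in> Idx m"
      then show "hom_basis p ((t', q', j'), (s', r', Suc k))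
          = (if j' = 0 then 0 else hom_basis p ((t', q', j' - 1), (s', r', k)))"
        using j(4) by (auto simp: hom_basis_def p Idx_iff)
    qed
  next
    fix p p' assume "p \<in> hom_index n m" "p' \<in> hom_index n m"
    then show "hom_basis p (hom_coord p') = (if p = p' then 1 else 0)"
      using m by (auto simp: hom_index_def hom_basis_def hom_coord_def valid_mseg_def split: prod.splits)
  next
    fix M and x :: "idx \<times> idx" assume M: "M \<in> End_mats n m"
    obtain t q J s r k where x: "x = ((t, q, J), (s, r, k))" by (metis prod_cases3 surj_pair)
    have Mz: "M (x, y) = 0" if "x \<notin> Idx m \<or> y \<notin> Idx m \<or> vertex n x \<noteq> vertex n y" for x y
      using M that unfolding End_mats_iff by blast
    have MC: "M ((t, q, j), (s, r, Suc k)) = (if j = 0 then 0 else M ((t, q, j - 1), (s, r, k)))"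
      if "(t, q, j) \<in> Idx m" "(s, r, k) \<in> Idx m" for t q j s r k
      using M that unfolding End_mats_iff by blast
    have shift: "M ((t, q, j + a), (s, r, a)) = M ((t, q, j), (s, r, 0))"
      if "j + a < fst t" "q < count m t" "a \<le> fst s" "r < count m s" for j a
      using that
    proof (induction a)
      case (Suc a)
      then show ?case using MC[of t q "j + Suc a" s r a] by (simp add: Idx_iff)
    qed simp
    have shift0: "M ((t, q, a), (s, r, Suc (b + a))) = 0"
      if "a < fst t" "q < count m t" "b + a < fst s" "r < count m s" for a b
      using that
    proof (induction a)
      case 0
      then show ?case using MC[of t q 0 s r b] by (simp add: Idx_iff)
    next
      case (Suc a)
      then show ?case using MC[of t q "Suc a" s r "Suc (b + a)"] by (simp add: Idx_iff)
    qed
    define P where "P = hom_index n m"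
    have finP: "finite P" unfolding P_def hom_index_def by (intro finite_SigmaI fin) auto
    \<comment> \<open>The only basis element that can be nonzero at \<open>x\<close>; for k > J the
      entry vanishes by \<open>shift0\<close>.\<close>
    define p where "p = ((s, r), (t, q), J - k)"
    have other: "hom_basis p' x = 0" if "p' \<in> P" "p' \<noteq> p" for p'
      using that by (cases p') (auto simp: hom_basis_def x p_def split: prod.splits)
    have "(\<Sum>p'\<in>P. M (hom_coord p') * hom_basis p' x)
        = (\<Sum>p'\<in>P. if p' = p then M (hom_coord p) * hom_basis p x else 0)"
      using other by (intro sum.cong refl) auto
    also have "\<dots> = (if p \<in> P then M (hom_coord p) * hom_basis p x else 0)"
      using finP by simp
    also have "\<dots> = M x"
    proof (cases "(t, q, J) \<in> Idx m \<and> (s, r, k) \<in> Idx m")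
      case False
      then have "hom_basis p x = 0 \<or> p \<notin> P"
        by (auto simp: p_def x hom_basis_def P_def hom_index_def Idx_iff)
      then show ?thesis using Mz[of "(t, q, J)" "(s, r, k)"] False x by auto
    next
      case True
      then have I: "q < count m t" "J < fst t" "r < count m s" "k < fst s" by (auto simp: Idx_iff)
      show ?thesis
      proof (cases "k \<le> J")
        case False
        then obtain b where "k = Suc (b + J)" by (metis add.commute add_Suc_right less_imp_Suc_add not_le)
        then show ?thesis using shift0[of J b] I False by (auto simp: x p_def hom_basis_def)
      next
        case kJ: True
        have Mx: "M x = M (hom_coord p)"
          using shift[of "J - k" k] I kJ by (simp add: x hom_coord_def p_def)
        have bas: "hom_basis p x = 1" using I kJ by (simp add: x p_def hom_basis_def)
        show ?thesis
        proof (cases "p \<in> P")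
          case False
          have "M (hom_coord p) = 0"
          proof (cases "fst t \<le> J - k + fst s")
            case True
            then have "(int (snd t) - int (J - k)) mod int n \<noteq> int (snd s) mod int n"
              using False I by (auto simp: P_def p_def hom_index_def simp flip: count_greater_zero_iff)
            then have "vertex n (t, q, J - k) \<noteq> vertex n (s, r, 0)"
              using n by (simp add: vertex_def nat_eq_iff)
            then show ?thesis using Mz by (simp add: hom_coord_def p_def)
          next
            case False
            then have "M ((t, q, J - k), (s, r, 0)) = M ((t, q, J - k + fst s), (s, r, fst s))"
              using shift[of "J - k" "fst s"] I by simp
            then show ?thesis using Mz by (simp add: hom_coord_def p_def Idx_iff)
          qed
          then show ?thesis using Mx False by simp
        qed (use Mx bas in simp)
      qed
    qed
    finally show "M x = (\<Sum>p\<in>hom_index n m. M (hom_coord p) * hom_basis p x)" by (simp add: P_def)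
  qed
  also have "card (hom_index n m) = (\<Sum>a\<in>C. \<Sum>b\<in>C. hom_dim n (fst a) (fst b))"
    unfolding hom_index_def C_def[symmetric]
    by (subst card_SigmaI) (auto simp: C_def fin hom_dim_def card_SigmaI intro!: finite_SigmaI fin sum.cong)
  also have "\<dots> = (\<Sum>s\<in>#m. \<Sum>t\<in>#m. hom_dim n s t)"
    unfolding C_def sum_copies by (rule sum_copies)
  finally show ?thesis by (simp add: eps_def)
qed

section \<open>Change of dimensions when a segment grows by a head\<close>

lemma card_shift:
  fixes Q :: "nat \<Rightarrow> bool"
  shows "int (card {j. 1 \<le> j \<and> j \<le> L \<and> Q j}) = int (card {j. j < L \<and> Q j}) + of_bool (Q L) - of_bool (Q 0)"
proof -
  have fin: "finite {j. j < L \<and> Q j}" "finite {j. 1 \<le> j \<and> j \<le> L \<and> Q j}"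
    by (auto intro: finite_subset[of _ "{..L}"])
  have "{j. j \<le> L \<and> Q j} = (if Q L then insert L {j. j < L \<and> Q j} else {j. j < L \<and> Q j})"
    by (auto simp: le_less)
  then have 1: "card {j. j \<le> L \<and> Q j} = card {j. j < L \<and> Q j} + of_bool (Q L)"
    using fin by simp
  have "{j. j \<le> L \<and> Q j} = (if Q 0 then insert 0 {j. 1 \<le> j \<and> j \<le> L \<and> Q j} else {j. 1 \<le> j \<and> j \<le> L \<and> Q j})"
    by (auto simp: Suc_le_eq) (metis gr0I)
  then have "card {j. j \<le> L \<and> Q j} = card {j. 1 \<le> j \<and> j \<le> L \<and> Q j} + of_bool (Q 0)"
    using fin by simp
  with 1 show ?thesis by (cases "Q 0"; cases "Q L") auto
qed

lemma card_remove_0: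
  assumes "1 \<le> l"
  shows "card {j. j < l \<and> Q j} = card {j. 1 \<le> j \<and> j < l \<and> Q j} + of_bool (Q (0 :: nat))"
proof -
  have "{j. j < l \<and> Q j} = (if Q 0 then insert 0 {j. 1 \<le> j \<and> j < l \<and> Q j} else {j. 1 \<le> j \<and> j < l \<and> Q j})"
    using assms by (auto simp: Suc_le_eq) (metis gr0I)+
  moreover have "finite {j. 1 \<le> j \<and> j < l \<and> Q j}" by (rule finite_subset[of _ "{..<l}"]) auto
  ultimately show ?thesis by simp
qed

lemma card_Suc_image: "card {j. 1 \<le> j \<and> Q j} = card {j. Q (Suc j)}"
proof -
  have "{j. 1 \<le> j \<and> Q j} = Suc ` {j. Q (Suc j)}"
    by (auto simp: image_iff) (metis Suc_le_D)
  then show ?thesis by (simp add: card_image)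
qed

definition seg_dim :: "nat \<Rightarrow> seg \<Rightarrow> nat \<Rightarrow> nat" where
  "seg_dim n s v = card {j. j < fst s \<and> nat ((int (snd s) - int j) mod int n) = v}"

lemma gdim_eq: "gdim n m v = (\<Sum>s\<in>#m. seg_dim n s v)"
proof -
  have "{x \<in> Idx m. vertex n x = v} = (\<lambda>(a, j). (fst a, snd a, j))
      ` (SIGMA a:(SIGMA s:set_mset m. {..<count m s}). {j. j < fst (fst a) \<and> nat ((int (snd (fst a)) - int j) mod int n) = v})"
    by (auto simp: Idx_def vertex_def image_iff)
  then have "gdim n m v = card (SIGMA a:(SIGMA s:set_mset m. {..<count m s}).
      {j. j < fst (fst a) \<and> nat ((int (snd (fst a)) - int j) mod int n) = v})"
    unfolding gdim_def by (simp add: card_image inj_on_def)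
  also have "\<dots> = (\<Sum>a\<in>(SIGMA s:set_mset m. {..<count m s}). seg_dim n (fst a) v)"
    unfolding seg_dim_def by (rule card_SigmaI) auto
  finally show ?thesis using sum_copies[of "\<lambda>s. seg_dim n s v" m] by simp
qed

context cyclic_vertex
begin

lemma mod_pred_iff: "(a - int j) mod int n = int (predI n i) mod int n \<longleftrightarrow> (a - int j + 1) mod int n = int i mod int n"
proof -
  have "int (predI n i) mod int n = (int i - 1) mod int n" using predI_mod[of 0] by simp
  then show ?thesis by (metis add_diff_cancel diff_add_cancel mod_add_left_eq mod_diff_left_eq)
qed

lemma seg_dim_up: "1 \<le> l \<Longrightarrow> seg_dim n (l, i) v = seg_dim n (l - 1, predI n i) v + of_bool (v = i)"
proof -
  assume l: "1 \<le> l"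
  define Q where "Q j \<longleftrightarrow> nat ((int i - int j) mod int n) = v" for j
  have "card {j. j < l \<and> Q j} = card {j. 1 \<le> j \<and> j < l \<and> Q j} + of_bool (Q 0)"
    using l by (rule card_remove_0)
  also have "card {j. 1 \<le> j \<and> j < l \<and> Q j} = card {j. j < l - 1 \<and> nat ((int (predI n i) - int j) mod int n) = v}"
    unfolding card_Suc_image predI_mod by (intro arg_cong[of _ _ card]) (auto simp: Q_def algebra_simps)
  also have "Q 0 \<longleftrightarrow> v = i" using i_less by (auto simp: Q_def)
  finally show ?thesis by (simp add: seg_dim_def Q_def)
qed

text \<open>A basis map with j > 0 lands in the radical (l-1;i-1]; the value j = 0 accounts for the
  map that hits the head.\<close>

lemma hom_dim_to:
  "1 \<le> l \<Longrightarrow> snd t < n \<Longrightarrow>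
    hom_dim n t (l, i) = hom_dim n t (l - 1, predI n i) + of_bool (snd t = i \<and> l \<le> fst t)"
proof -
  assume l: "1 \<le> l" and t: "snd t < n"
  define Q where "Q j \<longleftrightarrow> l \<le> j + fst t \<and> (int i - int j) mod int n = int (snd t) mod int n" for j
  have "card {j. j < l \<and> Q j} = card {j. 1 \<le> j \<and> j < l \<and> Q j} + of_bool (Q 0)"
    using l by (rule card_remove_0)
  also have "card {j. 1 \<le> j \<and> j < l \<and> Q j} = hom_dim n t (l - 1, predI n i)"
    unfolding card_Suc_image hom_dim_def fst_conv snd_conv predI_mod
    by (intro arg_cong[of _ _ card]) (auto simp: Q_def algebra_simps)
  also have "Q 0 \<longleftrightarrow> snd t = i \<and> l \<le> fst t" using t i_less by (auto simp: Q_def)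
  finally show ?thesis by (simp add: hom_dim_def Q_def)
qed

text \<open>Both the difference of the Hom dimensions and that of the graded dimensions come from
  moving a window from 0..L-1 to 1..L. The boundary terms at L agree; those at 0 differ exactly if t
  starts at i - 1 and has length at least l.\<close>

lemma hom_dim_from:
  assumes l: "1 \<le> l" and t: "snd t < n"
  shows "int (hom_dim n (l, i) t) = int (hom_dim n (l - 1, predI n i) t)
    + int (seg_dim n t i) - int (seg_dim n t (predI n i)) + of_bool (snd t = predI n i \<and> l \<le> fst t)"
proof -
  define L where "L = fst t"
  define Q where "Q j \<longleftrightarrow> (int (snd t) - int j) mod int n = int (predI n i) mod int n" for j
  have QS: "(int (snd t) - int j) mod int n = int i mod int n \<longleftrightarrow> Q (Suc j)" for j
    using mod_pred_iff[of "int (snd t)" "Suc j"] by (simp add: Q_def algebra_simps)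
  have dim_i: "seg_dim n t i = card {j. j < L \<and> Q (Suc j)}"
    unfolding seg_dim_def L_def QS[symmetric] using i_less n
    by (intro arg_cong[of _ _ card]) (auto simp: nat_eq_iff)
  have dim_p: "seg_dim n t (predI n i) = card {j. j < L \<and> Q j}"
    unfolding seg_dim_def L_def Q_def using predI_less n
    by (intro arg_cong[of _ _ card]) (auto simp: nat_eq_iff)
  have 1: "int (card {j. j < L \<and> Q (Suc j)}) = int (card {j. j < L \<and> Q j}) + of_bool (Q L) - of_bool (Q 0)"
    using card_shift[of L Q] card_Suc_image[of "\<lambda>j. j \<le> L \<and> Q j"] by (simp add: Suc_le_eq)
  define Q' where "Q' j \<longleftrightarrow> Suc L \<le> j + l \<and> Q j" for j
  have from_i: "hom_dim n (l, i) t = card {j. j < L \<and> Q' (Suc j)}"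
    unfolding hom_dim_def fst_conv snd_conv QS by (simp add: Q'_def L_def conj_ac)
  have from_p: "hom_dim n (l - 1, predI n i) t = card {j. j < L \<and> Q' j}"
    unfolding hom_dim_def Q'_def Q_def using l by (intro arg_cong[of _ _ card]) (auto simp: L_def)
  have "int (card {j. j < L \<and> Q' (Suc j)}) = int (card {j. j < L \<and> Q' j}) + of_bool (Q' L) - of_bool (Q' 0)"
    using card_shift[of L Q'] card_Suc_image[of "\<lambda>j. j \<le> L \<and> Q' j"] by (simp add: Suc_le_eq)
  moreover have "Q' L \<longleftrightarrow> Q L" using l by (auto simp: Q'_def)
  moreover have "Q 0 \<longleftrightarrow> snd t = predI n i" using t predI_less by (auto simp: Q_def)
  moreover have "Q' 0 \<longleftrightarrow> \<not> l \<le> L \<and> Q 0" by (auto simp: Q'_def)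
  ultimately show ?thesis
    unfolding from_i from_p dim_i dim_p using 1 by (auto simp: L_def)
qed

lemma sum_of_bool_eq_size: "(\<Sum>t\<in>#d. of_bool (P t) :: int) = int (size {#t \<in># d. P t#})"
  by (induction d) auto

lemma eps_difference:
  assumes d: "valid_mseg n d" and l: "1 \<le> l"
    and b: "b = (if l = 1 then d else add_mset (l - 1, predI n i) d)" and c: "c = add_mset (l, i) d"
  shows "int (eps n c) - int (eps n b)
    = int (size {#s \<in># d. snd s = i \<and> l \<le> fst s#}) + int (size {#s \<in># d. snd s = predI n i \<and> l \<le> fst s#})
      + int (gdim n c i) - int (gdim n c (predI n i))"
proof -
  define s where "s = (l, i)"
  define s' where "s' = (l - 1, predI n i)"
  have n1: "1 \<le> n" using n by simp
  have vb: "valid_mseg n b" and vc: "valid_mseg n c"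
    using d l i_less predI_less by (auto simp: b c valid_mseg_def)
  define H where "H m = (\<Sum>a\<in>#m. \<Sum>t\<in>#m. hom_dim n a t)" for m
  have H_add: "int (H (add_mset a d)) = int (H d) + (\<Sum>t\<in>#d. int (hom_dim n a t) + int (hom_dim n t a))
      + int (hom_dim n a a)" for a
    by (simp add: H_def sum_mset.distrib of_nat_sum_mset image_mset.compositionality o_def)
  \<comment> \<open>For l = 1 the added segment has length 0 and no homomorphisms, so both cases can
    be treated as adding a segment to \<open>d\<close>.\<close>
  have Hb: "H b = H (add_mset s' d)"
  proof (cases "l = 1")
    case True
    have "hom_dim n s' t = 0" "hom_dim n t s' = 0" for t
      using True by (auto simp: hom_dim_def s'_def)
    then show ?thesis using True by (simp add: b H_def)
  qed (simp add: b s'_def)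
  have "(\<Sum>t\<in>#d. int (hom_dim n s t) + int (hom_dim n t s))
      = (\<Sum>t\<in>#d. (int (hom_dim n s' t) + int (hom_dim n t s')) + (int (seg_dim n t i) - int (seg_dim n t (predI n i))
        + of_bool (snd t = predI n i \<and> l \<le> fst t) + of_bool (snd t = i \<and> l \<le> fst t)))"
  proof (intro arg_cong[of _ _ sum_mset] image_mset_cong)
    fix t assume "t \<in># d"
    then have "snd t < n" using d by (auto simp: valid_mseg_def)
    then show "int (hom_dim n s t) + int (hom_dim n t s)
      = (int (hom_dim n s' t) + int (hom_dim n t s')) + (int (seg_dim n t i) - int (seg_dim n t (predI n i))
        + of_bool (snd t = predI n i \<and> l \<le> fst t) + of_bool (snd t = i \<and> l \<le> fst t))"
      using hom_dim_to[OF l, of t] hom_dim_from[OF l, of t] by (simp add: s_def s'_def)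
  qed
  also have "\<dots> = (\<Sum>t\<in>#d. int (hom_dim n s' t) + int (hom_dim n t s')) + (\<Sum>t\<in>#d. int (seg_dim n t i))
      - (\<Sum>t\<in>#d. int (seg_dim n t (predI n i)))
      + int (size {#t \<in># d. snd t = predI n i \<and> l \<le> fst t#}) + int (size {#t \<in># d. snd t = i \<and> l \<le> fst t#})"
    unfolding sum_of_bool_eq_size[symmetric] by (induction d) auto
  finally have sums: "(\<Sum>t\<in>#d. int (hom_dim n s t) + int (hom_dim n t s)) = \<dots>" .
  have "int (hom_dim n s s) = int (hom_dim n s' s) + int (seg_dim n s i) - int (seg_dim n s (predI n i))"
    using hom_dim_from[OF l, of s] i_less predI_neq by (simp add: s_def s'_def)
  moreover have "hom_dim n s' s = hom_dim n s' s'"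
    using hom_dim_to[OF l, of s'] predI_less predI_neq by (simp add: s_def s'_def)
  moreover have "gdim n c v = seg_dim n s v + (\<Sum>t\<in>#d. seg_dim n t v)" for v
    by (simp add: gdim_eq c s_def)
  then have "int (gdim n c v) = int (seg_dim n s v) + (\<Sum>t\<in>#d. int (seg_dim n t v))" for v
    by (simp add: of_nat_sum_mset image_mset.compositionality o_def)
  moreover have "eps n b = H (add_mset s' d)"
    unfolding eps_eq[OF n1 vb] Hb[symmetric] by (simp only: H_def)
  moreover have "eps n c = H (add_mset s d)"
    unfolding eps_eq[OF n1 vc] by (simp only: H_def c s_def)
  ultimately show ?thesis
    using sums H_add[of s] H_add[of s'] by simp
qed

lemma gdim_up:
  assumes "1 \<le> l" "can_up l b"
  shows "gdim n (up l b) v = gdim n b v + of_bool (v = i)"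
  using assms
proof (cases rule: can_up_cases)
  case 1
  then show ?thesis using seg_dim_up[of 1 v] by (simp add: gdim_eq) (simp add: seg_dim_def)
next
  case (2 m')
  then show ?thesis using seg_dim_up[of l v] assms(1) by (simp add: gdim_eq)
qed

text \<open>The twist of the product and the PBW normalization combine to A_l up to the terms 2G +
  x_l, where G counts the longer segments with head i. The Hall polynomial at q = v^(-2), which is
  v^(-2G) v^(-x_l) [x_l + 1], cancels these.\<close>

lemma pbw_exp_difference:
  assumes b: "valid_mseg n b" and l: "1 \<le> l" "can_up l b"
  shows "int (mform n (gdim n {#(1, i)#}) (gdim n b)) + pbw_exp n b - pbw_exp n (up l b)
    = AA b l + 2 * int (size {#s \<in># up l b. snd s = i \<and> l < fst s#}) + int (xx b l)"
proof -
  define c where "c = up l b"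
  have delta: "gdim n {#(1, i)#} v = of_bool (v = i)" for v
    using seg_dim_up[of 1 v] by (simp add: gdim_eq) (simp add: seg_dim_def)
  have mf: "mform n (gdim n {#(1, i)#}) (gdim n b) = gdim n b (predI n i) + gdim n b i"
    unfolding mform_def delta using i_less by (simp add: of_bool_def if_distrib[of "\<lambda>x. x * _"] cong: if_cong)
  have gc: "gdim n c v = gdim n b v + of_bool (v = i)" for v
    unfolding c_def using l by (rule gdim_up)
  have "(\<Sum>v<n. (gdim n c v)\<^sup>2) = (\<Sum>v<n. (gdim n b v)\<^sup>2 + (if v = i then 2 * gdim n b i + 1 else 0))"
    unfolding gc by (intro sum.cong) (auto simp: power2_eq_square)
  also have "\<dots> = (\<Sum>v<n. (gdim n b v)\<^sup>2) + 2 * gdim n b i + 1"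
    using i_less by (simp add: sum.distrib)
  finally have sq: "(\<Sum>v<n. (gdim n c v)\<^sup>2) = (\<Sum>v<n. (gdim n b v)\<^sup>2) + 2 * gdim n b i + 1" .
  obtain d where d: "valid_mseg n d" "b = (if l = 1 then d else add_mset (l - 1, predI n i) d)"
    "c = add_mset (l, i) d"
    using l(1,2)
  proof (cases rule: can_up_cases)
    case 1
    then show ?thesis using that[of b] b by (simp add: c_def)
  next
    case (2 m')
    then show ?thesis using that[of m'] b by (simp add: c_def valid_mseg_def)
  qed
  have sizes: "size {#s \<in># d. snd s = predI n i \<and> l \<le> fst s#} = size {#s \<in># b. snd s = predI n i \<and> l \<le> fst s#}"
    "size {#s \<in># d. snd s = i \<and> l \<le> fst s#} = size {#s \<in># b. snd s = i \<and> l \<le> fst s#}"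
    "size {#s \<in># c. snd s = i \<and> l < fst s#} = size {#s \<in># b. snd s = i \<and> l < fst s#}"
    using l(1) by (auto simp: d(2,3))
  show ?thesis
    using eps_difference[OF d(1) l(1) d(2,3)] sq gc[of i] gc[of "predI n i"] predI_neq
    unfolding mf pbw_exp_def c_def[symmetric] sizes AA_def size_filter_ge[of i l b] xx_def
    by (simp add: of_nat_sum)
qed

lemma pbw_exp_simple: "pbw_exp n {#(1, i)#} = 0"
proof -
  have delta: "gdim n {#(1, i)#} v = of_bool (v = i)" for v
    using seg_dim_up[of 1 v] by (simp add: gdim_eq) (simp add: seg_dim_def)
  have "(\<Sum>v<n. (gdim n {#(1, i)#} v)\<^sup>2) = (\<Sum>v<n. if v = i then 1 else 0)"
    unfolding delta by (intro sum.cong) auto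
  then have "(\<Sum>v<n. (gdim n {#(1, i)#} v)\<^sup>2) = 1" using i_less by simp
  moreover have "eps n {#(1, i)#} = 1"
  proof -
    have "hom_dim n (1, i) (1, i) = 1"
      using hom_dim_to[of 1 "(1, i)"] i_less by (simp add: hom_dim_def)
    then show ?thesis using n i_less by (subst eps_eq) (auto simp: valid_mseg_def)
  qed
  ultimately show ?thesis by (simp add: pbw_exp_def)
qed

end

section \<open>Translation to the Hall algebra\<close>

lemma size_filter_head:
  fixes m :: mseg
  shows "size {#s \<in># m. snd s = j \<and> k \<le> fst s#} = (\<Sum>l\<in>{l \<in> fst ` set_mset m. k \<le> l}. count m (l, j))"
proof -
  define A where "A = {l \<in> fst ` set_mset m. k \<le> l}"
  have "size {#s \<in># m. snd s = j \<and> k \<le> fst s#} = (\<Sum>s\<in>set_mset {#s \<in># m. snd s = j \<and> k \<le> fst s#}. count m s)"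
    unfolding size_multiset_overloaded_eq by (intro sum.cong) auto
  also have "\<dots> = (\<Sum>s\<in>(\<lambda>l. (l, j)) ` A. count m s)"
    by (rule sum.mono_neutral_left) (auto simp: A_def image_iff not_in_iff, force+)
  also have "\<dots> = (\<Sum>l\<in>A. count m (l, j))"
    by (subst sum.reindex) (auto simp: inj_on_def)
  finally show ?thesis by (simp add: A_def)
qed

definition coords :: "nat \<Rightarrow> H \<Rightarrow> H" where
  "coords n x = (\<lambda>m. x m * vv powi (- pbw_exp n m))"

definition element :: "nat \<Rightarrow> H \<Rightarrow> H" where
  "element n X = (\<lambda>m. X m * vv powi pbw_exp n m)"

lemma coords_element [simp]: "coords n (element n X) = X"
  by (simp add: coords_def element_def fun_eq_iff power_int_minus)

lemma element_coords [simp]: "element n (coords n x) = x"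
  by (simp add: coords_def element_def fun_eq_iff power_int_minus)

lemma coords_eq_0_iff [simp]: "coords n x m = 0 \<longleftrightarrow> x m = 0"
  by (simp add: coords_def)

lemma element_eq_0_iff [simp]: "element n X m = 0 \<longleftrightarrow> X m = 0"
  by (simp add: element_def)

lemma hall_elem_element: "hall_elem n (element n X) \<longleftrightarrow> hall_elem n X"
  by (simp add: hall_elem_def)

lemma hall_elem_coords: "hall_elem n (coords n x) \<longleftrightarrow> hall_elem n x"
  by (simp add: hall_elem_def)

lemma pbw_eq_element: "pbw n m = element n (ubasis m)"
  by (simp add: pbw_def hscale_def ubasis_def element_def fun_eq_iff)

lemma hform_eq_ip:
  assumes "hall_elem n x" "hall_elem n y"
  shows "hform n x y = ip (coords n x) (coords n y)"
proof -
  have "{m. x m \<noteq> 0 \<or> y m \<noteq> 0} = {m. x m \<noteq> 0} \<union> {m. y m \<noteq> 0}" by blast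
  then have "finite {m. x m \<noteq> 0 \<or> y m \<noteq> 0}"
    using assms by (simp only: hall_elem_def finite_Un)
  then have "ip (coords n x) (coords n y) = (\<Sum>m\<in>{m. x m \<noteq> 0 \<or> y m \<noteq> 0}. coords n x m * coords n y m * pbw_norm m)"
    by (rule ip_eq_sum) auto
  then show ?thesis by (simp add: hform_def pbw_coeff_def coords_def)
qed

context cyclic_vertex
begin

lemma S_sum_eq: "S_sum n m i k = SS m k"
proof -
  have "S_sum n m i k = int (size {#s \<in># m. snd s = predI n i \<and> k \<le> fst s#}) - int (size {#s \<in># m. snd s = i \<and> k \<le> fst s#})"
    unfolding S_sum_def size_filter_head by (simp add: sum_subtractf)
  then show ?thesis
    unfolding SS_def AA_def xx_def size_filter_ge[of i k m] by simp
qed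

lemma hall_struct_dn:
  assumes c: "valid_mseg n c" and l: "1 \<le> l" "0 < xx c l"
  shows "hall_struct n {#(1, i)#} (dn l c) c * vv powi pbw_exp n (dn l c) * vv powi (- pbw_exp n c)
    = vv powi AA c l * qint (int (xx c l))"
proof -
  define b where "b = dn l c"
  define G where "G = size {#s \<in># c. snd s = i \<and> l < fst s#}"
  obtain x where x: "xx c l = Suc x" using l(2) by (cases "xx c l") auto
  have u: "can_up l b" "up l b = c" using l by (simp_all add: b_def can_up_dn up_dn)
  have vb: "valid_mseg n b" using c valid_dn[OF l] by (simp add: b_def)
  have AA: "AA b l = AA c l" "xx b l = x" using l x by (simp_all add: b_def AA_dn xx_dn)
  have map: "map_poly (\<lambda>z. of_int z :: K) (monom 1 G * (\<Sum>j<k. monom 1 j)) = monom 1 G * (\<Sum>j<k. monom 1 j)" for k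
  proof (rule poly_eqI)
    fix e
    show "coeff (map_poly (\<lambda>z. of_int z :: K) (monom 1 G * (\<Sum>j<k. monom 1 j))) e = coeff (monom 1 G * (\<Sum>j<k. monom 1 j)) e"
      by (simp add: coeff_map_poly coeff_monom_mult coeff_sum of_int_sum if_distrib cong: if_cong)
  qed
  \<comment> \<open>At q = v^(-2) the geometric sum is a quantum integer up to a power of v.\<close>
  have geo: "(\<Sum>j<Suc k. (inverse (vv\<^sup>2)) ^ j) = vv powi (- int k) * qint (int (Suc k))" for k
  proof (induction k)
    case (Suc k)
    have "vv powi (- int (Suc k)) * qint (int (Suc (Suc k)))
        = vv powi (- int (Suc k)) * (vv powi (- 1) * qint (int (Suc k)) + vv powi int (Suc k) * qint 1)"
      using qint_add[of "int (Suc k)" 1] by (simp add: add.commute)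
    also have "\<dots> = vv powi (- int (Suc k)) * vv powi int (Suc k)
        + (vv powi (- int (Suc k)) * vv powi (- 1)) * qint (int (Suc k))"
      by (simp add: algebra_simps)
    also have "vv powi (- int (Suc k)) * vv powi int (Suc k) = 1"
      by (subst power_int_add[symmetric]) simp_all
    also have "vv powi (- int (Suc k)) * vv powi (- 1) = inverse (vv\<^sup>2) * vv powi (- int k)"
    proof -
      have "inverse (vv\<^sup>2) = vv powi (- 2)" by (simp add: power_int_minus)
      then show ?thesis by (simp only:) (subst (1 2) power_int_add[symmetric]; simp)
    qed
    finally show ?case
      unfolding sum.lessThan_Suc_shift[of _ "Suc k"] using Suc.IH
      by (simp add: sum_distrib_left[symmetric] mult.assoc del: sum.lessThan_Suc of_nat_Suc)
  qed simp
  have "hall_struct n {#(1, i)#} b c = vv powi int (mform n (gdim n {#(1, i)#}) (gdim n b))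
      * ((inverse (vv\<^sup>2)) ^ G * (vv powi (- int x) * qint (int (Suc x))))"
    using c unfolding hall_struct_def b_def hall_poly_dn[OF c l] G_def[symmetric] map x geo[symmetric]
    by (simp add: poly_monom poly_sum)
  also have "(inverse (vv\<^sup>2)) ^ G = vv powi (- 2 * int G)"
  proof -
    have "vv powi (- 2 * int G) = vv powi (- int (2 * G))" by simp
    also have "\<dots> = inverse (vv ^ (2 * G))" by (simp only: power_int_minus power_int_of_nat)
    finally show ?thesis by (simp add: power_inverse power_mult)
  qed
  finally have "hall_struct n {#(1, i)#} b c * vv powi pbw_exp n b * vv powi (- pbw_exp n c)
      = vv powi int (mform n (gdim n {#(1, i)#}) (gdim n b)) * vv powi (- 2 * int G) * vv powi (- int x)
        * vv powi pbw_exp n b * vv powi (- pbw_exp n c) * qint (int (Suc x))"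
    by (simp only: mult_ac)
  also have "\<dots> = vv powi (int (mform n (gdim n {#(1, i)#}) (gdim n b)) + (- 2 * int G) + (- int x)
        + pbw_exp n b + (- pbw_exp n c)) * qint (int (Suc x))"
    by (simp only: power_int_add vv_neq_0 simp_thms)
  also have "int (mform n (gdim n {#(1, i)#}) (gdim n b)) + (- 2 * int G) + (- int x)
        + pbw_exp n b + (- pbw_exp n c) = AA c l"
    using pbw_exp_difference[OF vb l(1) u(1)] unfolding u(2) AA by (simp add: G_def)
  finally show ?thesis by (simp add: b_def x)
qed

lemma coords_f_op:
  assumes x: "hall_elem n x"
  shows "coords n (f_op n i x) = ff (coords n x)"
proof
  fix c
  define S where "S = {b. x b \<noteq> 0}"
  have fin: "finite S" using x by (simp add: hall_elem_def S_def)
  have "pbw n {#(1, i)#} = ubasis {#(1, i)#}"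
    unfolding pbw_def pbw_exp_simple hscale_def by simp
  then have f: "f_op n i x c = (\<Sum>b\<in>S. x b * hall_struct n {#(1, i)#} b c)"
    by (simp add: f_op_def hmult_def ubasis_def S_def)
  show "coords n (f_op n i x) c = ff (coords n x) c"
  proof (cases "valid_mseg n c")
    case False
    have "f_op n i x c = 0" unfolding f using False by (intro sum.neutral) (simp add: hall_struct_def)
    moreover have "ff (coords n x) c = 0"
    proof (rule ccontr)
      assume "ff (coords n x) c \<noteq> 0"
      then obtain l where "1 \<le> l" "0 < xx c l" "coords n x (dn l c) \<noteq> 0" by (rule ff_support)
      then show False using False valid_dn[of l c] x by (auto simp: hall_elem_def)
    qed
    ultimately show ?thesis by (simp add: coords_def)
  next
    case c: True
    define L where "L = {l \<in> {1..len c}. 0 < xx c l}"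
    have inj: "inj_on (\<lambda>l. dn l c) L"
      by (rule inj_onI) (auto simp: L_def intro: dn_inj)
    \<comment> \<open>Neither the support of \<open>x\<close> nor the set of all
      \<open>dn l c\<close> contains the other in general, so the sum passes through their
      union.\<close>
    have "f_op n i x c = (\<Sum>b\<in>S \<union> (\<lambda>l. dn l c) ` L. x b * hall_struct n {#(1, i)#} b c)"
      unfolding f using fin by (intro sum.mono_neutral_left) (auto simp: S_def L_def)
    also have "\<dots> = (\<Sum>b\<in>(\<lambda>l. dn l c) ` L. x b * hall_struct n {#(1, i)#} b c)"
    proof (rule sum.mono_neutral_right)
      show "\<forall>b\<in>S \<union> (\<lambda>l. dn l c) ` L - (\<lambda>l. dn l c) ` L. x b * hall_struct n {#(1, i)#} b c = 0"
      proof
        fix b assume b: "b \<in> S \<union> (\<lambda>l. dn l c) ` L - (\<lambda>l. dn l c) ` L"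
        have "valid_mseg n b" using b x by (auto simp: S_def hall_elem_def)
        moreover have "dn l c \<noteq> b" if "1 \<le> l" "0 < xx c l" for l
        proof -
          have "l \<in> L" using that xx_large[of c l] by (cases "len c < l") (auto simp: L_def)
          then show ?thesis using b by auto
        qed
        ultimately have "hall_poly n {#(1, i)#} b c = 0" using c by (intro hall_poly_zero) auto
        then show "x b * hall_struct n {#(1, i)#} b c = 0" by (simp add: hall_struct_def)
      qed
    qed (use fin in \<open>auto simp: L_def\<close>)
    also have "\<dots> = (\<Sum>l\<in>L. x (dn l c) * hall_struct n {#(1, i)#} (dn l c) c)"
      using inj by (simp add: sum.reindex)
    finally have "coords n (f_op n i x) c = (\<Sum>l\<in>L. x (dn l c) * hall_struct n {#(1, i)#} (dn l c) c * vv powi (- pbw_exp n c))"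
      by (simp add: coords_def sum_distrib_right)
    also have "\<dots> = (\<Sum>l\<in>L. fl l (coords n x) c)"
    proof (intro sum.cong refl)
      fix l assume l: "l \<in> L"
      have "x (dn l c) = coords n x (dn l c) * vv powi pbw_exp n (dn l c)"
        by (simp add: coords_def power_int_minus)
      then have "x (dn l c) * hall_struct n {#(1, i)#} (dn l c) c * vv powi (- pbw_exp n c)
        = (hall_struct n {#(1, i)#} (dn l c) c * vv powi pbw_exp n (dn l c) * vv powi (- pbw_exp n c)) * coords n x (dn l c)"
        by (simp only: mult_ac)
      then show "x (dn l c) * hall_struct n {#(1, i)#} (dn l c) c * vv powi (- pbw_exp n c) = fl l (coords n x) c"
        using hall_struct_dn[OF c, of l] l by (simp only: fl_def L_def mem_Collect_eq atLeastAtMost_iff simp_thms)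
    qed
    also have "\<dots> = ff (coords n x) c"
      unfolding ff_def L_def by (rule sum.mono_neutral_left) (auto intro: fl_eq_0)
    finally show ?thesis .
  qed
qed

lemma hall_elem_ff: assumes "hall_elem n X" shows "hall_elem n (ff X)"
proof -
  have "c \<in> (\<Union>b\<in>{b. X b \<noteq> 0}. (\<lambda>l. up l b) ` {1..Suc (len b)}) \<and> valid_mseg n c" if nz: "ff X c \<noteq> 0" for c
  proof -
    from nz obtain l where l: "1 \<le> l" "0 < xx c l" "X (dn l c) \<noteq> 0" by (rule ff_support)
    then have "c = up l (dn l c)" "l \<le> Suc (len (dn l c))"
      using up_dn[of l c] can_up_le[OF can_up_dn] by auto
    moreover have "valid_mseg n c" using l assms valid_dn[of l c] by (auto simp: hall_elem_def)
    ultimately show ?thesis using l by fastforce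
  qed
  then show ?thesis
    using assms unfolding hall_elem_def
    by (auto intro!: finite_subset[of "{c. ff X c \<noteq> 0}" "\<Union>b\<in>{b. X b \<noteq> 0}. (\<lambda>l. up l b) ` {1..Suc (len b)}"])
qed

lemma hall_elem_ee: assumes "hall_elem n X" shows "hall_elem n (ee X)"
proof -
  have "m \<in> (\<Union>c\<in>{c. X c \<noteq> 0}. (\<lambda>l. dn l c) ` {1..len c}) \<and> valid_mseg n m" if nz: "ee X m \<noteq> 0" for m
  proof -
    from nz obtain l where l: "1 \<le> l" "can_up l m" "X (up l m) \<noteq> 0" by (rule ee_support)
    have "m = dn l (up l m)" using l by (simp add: dn_up)
    moreover have "l \<le> len (up l m)" using can_up_le[OF l(2)] len_up[OF l(1,2)] by simp
    moreover have "valid_mseg n m" using l assms valid_up[of l m] by (auto simp: hall_elem_def)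
    ultimately show ?thesis using l by fastforce
  qed
  then show ?thesis
    using assms unfolding hall_elem_def
    by (auto intro!: finite_subset[of "{m. ee X m \<noteq> 0}" "\<Union>c\<in>{c. X c \<noteq> 0}. (\<lambda>l. dn l c) ` {1..len c}"])
qed

lemma f_op_eq: "hall_elem n x \<Longrightarrow> f_op n i x = element n (ff (coords n x))"
  using coords_f_op[of x] by (metis element_coords)

lemma hall_elem_f_op: "hall_elem n x \<Longrightarrow> hall_elem n (f_op n i x)"
  by (simp add: f_op_eq hall_elem_element hall_elem_ff hall_elem_coords)

lemma pbw_norm_neq_0: "pbw_norm m \<noteq> 0"
  using val0_pbw_norm[of m] val0_unique[OF val0_0, of 1] by auto

text \<open>\<open>ff_adjoint\<close> shows that \<open>ee\<close> provides an adjoint. Uniqueness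
  is tested on PBW elements, whose norms are nonzero, and at invalid multisegments every element of
  H is 0.\<close>

lemma e'_op_eq:
  assumes x: "hall_elem n x"
  shows "e'_op n i x = element n (ee (coords n x))"
  unfolding e'_op_def
proof (rule the_equality)
  have X: "hall_elem n (coords n x)" using x by (simp add: hall_elem_coords)
  have adj: "hform n (element n (ee (coords n x))) z = hform n x (f_op n i z)" if z: "hall_elem n z" for z
  proof -
    have "hform n (element n (ee (coords n x))) z = ip (coords n z) (ee (coords n x))"
      using hform_eq_ip[OF _ z] X by (simp add: hall_elem_element hall_elem_ee ip_commute)
    also have "\<dots> = ip (ff (coords n z)) (coords n x)"
      using x z by (intro ff_adjoint[symmetric]) (simp_all add: hall_elem_def)
    also have "\<dots> = hform n x (f_op n i z)"
      using hform_eq_ip[OF x hall_elem_f_op[OF z]] coords_f_op[OF z] by (simp add: ip_commute)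
    finally show ?thesis .
  qed
  show "hall_elem n (element n (ee (coords n x))) \<and>
      (\<forall>z. hall_elem n z \<longrightarrow> hform n (element n (ee (coords n x))) z = hform n x (f_op n i z))"
    using adj X by (simp add: hall_elem_element hall_elem_ee)
  fix y assume y: "hall_elem n y \<and> (\<forall>z. hall_elem n z \<longrightarrow> hform n y z = hform n x (f_op n i z))"
  have "coords n y m = ee (coords n x) m" for m
  proof (cases "valid_mseg n m")
    case True
    then have h: "hall_elem n (pbw n m)"
      by (simp add: pbw_eq_element hall_elem_element) (simp add: hall_elem_def ubasis_def)
    have val: "ip Y (ubasis m) = Y m * pbw_norm m" for Y
    proof -
      have "ip Y (ubasis m) = (\<Sum>b\<in>{m}. Y b * ubasis m b * pbw_norm b)"
        by (rule ip_eq_sum) (auto simp: ubasis_def split: if_splits)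
      then show ?thesis by (simp add: ubasis_def)
    qed
    have "hform n y (pbw n m) = hform n (element n (ee (coords n x))) (pbw n m)"
      using y h adj by simp
    then show ?thesis
      using y h X hform_eq_ip[of n _ "pbw n m"] pbw_norm_neq_0[of m]
      by (simp add: pbw_eq_element val hall_elem_element hall_elem_ee)
  next
    case False
    then have "y m = 0" "ee (coords n x) m = 0"
      using y hall_elem_ee[OF X] unfolding hall_elem_def by blast+
    then show ?thesis by (simp add: coords_def)
  qed
  then show "y = element n (ee (coords n x))" by (metis element_coords ext)
qed

lemma coords_f_div:
  assumes "hall_elem n x"
  shows "coords n (f_div n i k x) = fd k (coords n x)"
proof -
  have "coords n ((f_op n i ^^ k) x) = (ff ^^ k) (coords n x) \<and> hall_elem n ((f_op n i ^^ k) x)"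
    using assms by (induction k) (simp_all add: coords_f_op hall_elem_f_op)
  then show ?thesis
    by (simp add: f_div_def hscale_def coords_def fd_def divided_power_def fun_eq_iff mult.assoc)
qed

lemma coords_sum: "coords n (\<Sum>k\<le>N. x k) = (\<lambda>c. \<Sum>k\<le>N. coords n (x k) c)"
  for N :: nat
proof -
  have "(\<Sum>k\<le>N. x k) c = (\<Sum>k\<le>N. x k c)" for c
    by (induction N) auto
  then show ?thesis by (simp add: coords_def sum_distrib_right)
qed

lemma coords_zero: "coords n 0 = (\<lambda>c. 0)" and element_zero: "element n (\<lambda>c. 0) = 0"
  by (auto simp: coords_def element_def)

text \<open>The integral decomposition from \<open>component\<close> is a witness for the
  description. A competing decomposition over C(v) has PBW coordinates to which
  \<open>decomposition_unique\<close> applies.\<close>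

lemma kf_op_pbw:
  assumes m: "m \<in> msegs d"
  shows "kf_op n i (pbw n m) = element n (f_tilde m)"
  unfolding kf_op_def
proof (rule the_equality)
  define C where "C k = (if k \<le> d then component m k else (\<lambda>c. 0))" for k
  have C: "ee (C k) = (\<lambda>c. 0)" "hall_elem n (C k)" for k
    using component(1,2)[OF m, of k] graded_finite[OF component(1)[OF m, of k]] lin_zero[OF lin_ee]
    by (auto simp: C_def hall_elem_def graded_def)
  have sumC: "(\<lambda>c. \<Sum>k\<le>N. fd (g k) (C k) c) = (\<lambda>c. \<Sum>k\<le>d. fd (g k) (component m k) c)" if "d \<le> N" for N g
  proof
    fix c
    have "(\<Sum>k\<le>N. fd (g k) (C k) c) = (\<Sum>k\<le>d. fd (g k) (C k) c)"
      using that lin_zero[OF lin_fd] by (intro sum.mono_neutral_right) (auto simp: C_def)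
    then show "(\<Sum>k\<le>N. fd (g k) (C k) c) = (\<Sum>k\<le>d. fd (g k) (component m k) c)"
      by (simp add: C_def)
  qed
  define xs where "xs k = element n (C k)" for k
  have xs: "hall_elem n (xs k)" "coords n (xs k) = C k" for k
    using C by (simp_all add: xs_def hall_elem_element)
  have "e'_op n i (xs k) = 0" for k
    using e'_op_eq[OF xs(1)] xs(2) C(1) element_zero by simp
  moreover have "xs k = 0" if "k > d" for k
    using that element_zero by (simp add: xs_def C_def)
  moreover have "pbw n m = (\<Sum>k\<le>d. f_div n i k (xs k))"
  proof -
    have "coords n (\<Sum>k\<le>d. f_div n i k (xs k)) = ubasis m"
      using sumC[of d "\<lambda>k. k"] component(3)[OF m] by (simp add: coords_sum coords_f_div xs)
    then show ?thesis by (metis pbw_eq_element element_coords)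
  qed
  moreover have "element n (f_tilde m) = (\<Sum>k\<le>d. f_div n i (Suc k) (xs k))"
  proof -
    have "coords n (\<Sum>k\<le>d. f_div n i (Suc k) (xs k)) = f_tilde m"
      using sumC[of d Suc] f_tilde[OF m] by (simp add: coords_sum coords_f_div xs)
    then show ?thesis by (metis element_coords)
  qed
  ultimately show "\<exists>xs N. (\<forall>k. hall_elem n (xs k) \<and> e'_op n i (xs k) = 0) \<and> (\<forall>k>N. xs k = 0) \<and>
      pbw n m = (\<Sum>k\<le>N. f_div n i k (xs k)) \<and> element n (f_tilde m) = (\<Sum>k\<le>N. f_div n i (Suc k) (xs k))"
    using xs(1) by blast
  fix y assume "\<exists>xs N. (\<forall>k. hall_elem n (xs k) \<and> e'_op n i (xs k) = 0) \<and> (\<forall>k>N. xs k = 0) \<and>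
      pbw n m = (\<Sum>k\<le>N. f_div n i k (xs k)) \<and> y = (\<Sum>k\<le>N. f_div n i (Suc k) (xs k))"
  then obtain zs N where zs: "\<And>k. hall_elem n (zs k)" "\<And>k. e'_op n i (zs k) = 0" "\<And>k. k > N \<Longrightarrow> zs k = 0"
    "pbw n m = (\<Sum>k\<le>N. f_div n i k (zs k))" "y = (\<Sum>k\<le>N. f_div n i (Suc k) (zs k))" by blast
  define Z where "Z k = coords n (zs k)" for k
  have Z: "ee (Z k) = (\<lambda>c. 0)" for k
    using zs(2)[of k] e'_op_eq[OF zs(1)] coords_element[of n "ee (Z k)"] coords_zero unfolding Z_def by metis
  \<comment> \<open>The two decompositions may end at different indices; both are padded with zeros
    up to a common bound.\<close>
  define N' where "N' = max N d"
  have Z0: "Z k = (\<lambda>c. 0)" if "k > N" for k using zs(3)[OF that] coords_zero by (simp add: Z_def)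
  have sumZ: "(\<lambda>c. \<Sum>k\<le>N. fd (g k) (Z k) c) = (\<lambda>c. \<Sum>k\<le>N'. fd (g k) (Z k) c)" for g
    using Z0 lin_zero[OF lin_fd] by (intro ext sum.mono_neutral_left) (auto simp: N'_def)
  have "ubasis m = coords n (\<Sum>k\<le>N. f_div n i k (zs k))"
    using zs(4) pbw_eq_element coords_element by metis
  then have u: "ubasis m = (\<lambda>c. \<Sum>k\<le>N'. fd k (Z k) c)"
    using sumZ[of "\<lambda>k. k"] by (simp add: coords_sum coords_f_div zs(1) Z_def)
  have "(\<lambda>c. Z k c - C k c) = (\<lambda>c. 0)" if "k \<le> N'" for k
  proof (rule decomposition_unique[of N' "\<lambda>k c. Z k c - C k c"])
    show "\<forall>k\<le>N'. ee (\<lambda>c. Z k c - C k c) = (\<lambda>c. 0)"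
      using Z C by (simp add: lin_diff[OF lin_ee])
    show "(\<lambda>c. \<Sum>k\<le>N'. fd k (\<lambda>c. Z k c - C k c) c) = (\<lambda>c. 0)"
    proof
      fix c
      have "(\<Sum>k\<le>N'. fd k (Z k) c) = (\<Sum>k\<le>N'. fd k (C k) c)"
        using fun_cong[OF u, of c] fun_cong[OF component(3)[OF m], of c] fun_cong[OF sumC[of N' "\<lambda>k. k"], of c]
        by (simp add: N'_def)
      then show "(\<Sum>k\<le>N'. fd k (\<lambda>c. Z k c - C k c) c) = 0"
        by (simp add: lin_diff[OF lin_fd] sum_subtractf)
    qed
  qed (rule that)
  then have ZC: "Z k = C k" if "k \<le> N'" for k using that by (fastforce simp: fun_eq_iff)
  have "coords n y = (\<lambda>c. \<Sum>k\<le>N. fd (Suc k) (Z k) c)"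
    unfolding zs(5) by (simp add: coords_sum coords_f_div zs(1) Z_def)
  also have "\<dots> = (\<lambda>c. \<Sum>k\<le>N'. fd (Suc k) (C k) c)"
    unfolding sumZ using ZC by simp
  also have "\<dots> = f_tilde m" using sumC[of N' Suc] f_tilde[OF m] by (simp add: N'_def)
  finally show "y = element n (f_tilde m)" by (metis element_coords)
qed

lemma crystal_arrow_up:
  assumes "valid_mseg n m"
  shows "crystal_arrow n i m (up (first m) m)"
proof -
  define d where "d = len m"
  have m: "m \<in> msegs d" using assms by (simp add: msegs_def d_def)
  define m' where "m' = up (first m) m"
  have m': "m' \<in> msegs (Suc d)" using succ_mseg(1)[OF m] succ_mseg_eq_up[OF m] by (simp add: m'_def)
  have "\<forall>c. \<exists>P. f_tilde m c - ubasis m' c = vv * ev P"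
    using f_tilde_congruent[OF m] unfolding m'_def by blast
  then obtain P where P: "\<And>c. f_tilde m c - ubasis m' c = vv * ev (P c)" by metis
  have "kf_op n i (pbw n m) - pbw n m' = (\<Sum>c\<in>msegs (Suc d). hscale (vv * ev (P c)) (pbw n c))"
  proof
    fix c
    have app: "(\<Sum>c\<in>S. g c) x = (\<Sum>c\<in>S. g c x)" for S :: "mseg set" and g :: "mseg \<Rightarrow> H" and x
      by (induction S rule: infinite_finite_induct) auto
    have "(\<Sum>c\<in>msegs (Suc d). hscale (vv * ev (P c)) (pbw n c)) c
        = (\<Sum>b\<in>msegs (Suc d). if b = c then vv * ev (P c) * vv powi pbw_exp n c else 0)"
      unfolding app by (intro sum.cong refl) (auto simp: hscale_def pbw_def ubasis_def)
    also have "\<dots> = (if c \<in> msegs (Suc d) then vv * ev (P c) * vv powi pbw_exp n c else 0)"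
      using finite_msegs by simp
    also have "\<dots> = (f_tilde m c - ubasis m' c) * vv powi pbw_exp n c"
    proof (cases "c \<in> msegs (Suc d)")
      case False
      then have "f_tilde m c = 0" "ubasis m' c = 0"
        using graded_eq_0[OF graded_f_tilde[OF m]] m' by (auto simp: ubasis_def)
      then show ?thesis using False by simp
    qed (simp add: P)
    finally show "(kf_op n i (pbw n m) - pbw n m') c = (\<Sum>c\<in>msegs (Suc d). hscale (vv * ev (P c)) (pbw n c)) c"
      unfolding kf_op_pbw[OF m] pbw_eq_element[of n m'] by (simp add: element_def left_diff_distrib)
  qed
  then show ?thesis
    unfolding crystal_arrow_def in_vL_def m'_def[symmetric] ev_def using finite_msegs
    by (intro exI[of _ "msegs (Suc d)"] exI[of _ P]) (auto simp: msegs_def)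
qed

end

theorem theorem1:
  fixes n i k0 :: nat and m :: mseg
  assumes "2 \<le> n"
    and "valid_mseg n m"
    and "i < n"
    and "1 \<le> k0"
    and "\<forall>k \<ge> 1. S_sum n m i k0 \<le> S_sum n m i k"
    and "\<forall>k. 1 \<le> k \<and> k < k0 \<longrightarrow> S_sum n m i k0 < S_sum n m i k"
  shows "crystal_arrow n i m (m_plus n m k0 i)"
proof -
  interpret cyclic_vertex n i by standard (use assms in auto)
  have "ep m = - SS m k0"
    by (rule ep_eqI[of _ _ k0]) (use assms in \<open>auto simp: S_sum_eq\<close>)
  then have "first m = k0"
    using assms by (intro first_eqI) (auto simp: S_sum_eq)
  moreover have "m_plus n m k0 i = up k0 m" by (simp add: m_plus_def up_def)
  ultimately show ?thesis using crystal_arrow_up[OF assms(2)] by simp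
qed

end
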